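(* Let $U$ be a universal nondeterministic Turing machine as described in the context. For every nondeterministic Turing machine $M$ over the binary alphabet $\Sigma=\{0,1\}$, there exist a Ptime computable function $h:\mathbb{N}\to\mathbb{N}$ and an SGPtime reduction $f$ from $DBH(M)$ to $DBH(U,h)$.
   Context: Decision problems: $D=(\Sigma^\ast,D^+)$, $\Sigma$ finite; spherical ensembles $\mu=\{\mu_n\}$ of probability functions on $\Sigma^n$; $\mu^\ast_{|x|}(x)=\mu_{|x|}(\{y\in\Sigma^{|x|}:y<_{lex}x\})$; $\mathbf{DistNP}$: $(D,\mu)$ with $D\in\mathbf{NP}$ and $x\mapsto\mu^\ast_{|x|}(x)$ Ptime computable (approximable to within $2^{-k}$ in time polynomial in $|x|$ and $k$). A TM partially decides $D$ if on each input it does not halt, halts with DontKnow, or halts with the correct Yes/No; $T_M(x)$ = steps to a Yes/No halt, else $\infty$. $M$ SGPtime decides $(D,\mu)$ if it partially decides $D$ and for some polynomial $p$ and all polynomials $q$, $\mu_n\{x\in\Sigma^n:T_M(x)>p(n)\}=o(1/q(n))$. A Ptime reduction $f$ from $D$ to $E$ is polynomial-time computable with $x\in D^+\iff f(x)\in E^+$; size-invariant: $|x_1|<|x_2|\iff|f(x_1)|<|f(x_2)|$. For $(D,\mu),(E,\nu)\in\mathbf{DistNP}$, a size-invariant Ptime reduction is an SGPtime reduction if for every TM $M$ SGPtime deciding $(E,\nu)$, $M\circ f$ SGPtime decides $(D,\mu)$. Bounded halting: for an NTM $M$ over $\{0,1\}$ and $n>|w|$, $c(n,w)=1^m0w$ with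 $|1^m0w|=n$; $BH(M)^+=\{c(n,w):M$ has a halting computation on $w$ of at most $n$ steps$\}$; $\nu_{|u|}(u)=1/(|u|2^{|w|})$ if $u=1^m0w$, $\nu(\varepsilon)=1$, $\nu_{|u|}(1^k)=0$ for $k\ge 1$; $DBH(M)=(BH(M),\nu)$. For $h:\mathbb{N}\to\mathbb{N}$ with $h(n)\ge n$ strictly increasing, $C(h)=\{c(h(|w|),w):w\in\{0,1\}^\ast\}$, $\nu_h$ is the $C(h)$-induced ensemble ($(\nu_h)_{|x|}(x)=\nu_{|x|}(\{x\}\cap C(h))/\nu_{|x|}(C(h)\cap\{0,1\}^{|x|})$ if the denominator is nonzero, else $\nu_{|x|}(x)$), and $DBH(U,h)=(BH(U),\nu_h)$. Encodings: for $n\in\mathbb{N}$ with binary expansion $b_k\dots b_0$ ($b_k=1$), $\overline{n}=1b_k1b_{k-1}\dots1b_0$. Fix a polynomial-time computable enumeration $\gamma$ of NTMs onto $\mathbb{N}$ and set $\overline{M}=\overline{\gamma(M)}$. $U$ is an NTM such that (a) $U$ accepts inputs of the form $\overline{M}0w$ with $M$ an NTM over a binary alphabet and $w\in\{0,1\}^\ast$; (b) $M$ halts on $w$ iff $U$ halts on $\overline{M}0w$, with the same answer; (c) there is a polynomial $s$ with $T_M(w)\ge T_U(\overline{M}0w)/s(|w|)$. *)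

theory Defs
  imports
    Complex_Main
    "HOL-Library.Extended_Nat"
    "HOL-Library.Landau_Symbols"
    "HOL-Computational_Algebra.Polynomial"
begin

section \<open>Turing machines over the binary alphabet\<close>

text \<open>
  The alphabet \<open>{0,1}\<close> is \<^typ>\<open>bool\<close>, with \<^term>\<open>False\<close> for 0 and \<^term>\<open>True\<close> for 1.
  Machines have a finite number of two-way infinite tapes and may write auxiliary symbols. A machine
  is nondeterministic unless \<open>deterministic\<close> is required, and every value of type \<open>tm\<close> is a machine:
  an instruction whose lists do not have one entry per tape is never applicable.
\<close>

datatype sym = Blank | Bit bool | Aux nat

datatype move = Lft | Rgt | Stay

datatype answer = Yes | No | DontKnow

datatype state = Run nat | Halt answer

text \<open>
  \<open>((q, as), (q', acts))\<close>: in state \<open>Run q\<close>, scanning \<open>as\<close>, go to \<open>q'\<close>, writing and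
  moving on the tapes according to \<open>acts\<close>.
\<close>

type_synonym instr = "(nat \<times> sym list) \<times> (state \<times> (sym \<times> move) list)"

datatype tm = TM (work_tapes: nat) (instrs: "instr list")

text \<open>
  A tape is stored relative to its head, which always scans cell 0.
\<close>

type_synonym tape = "int \<Rightarrow> sym"

type_synonym config = "state \<times> tape list"

fun shift :: "move \<Rightarrow> tape \<Rightarrow> tape" where
  "shift Lft t = (\<lambda>i. t (i - 1))"
| "shift Rgt t = (\<lambda>i. t (i + 1))"
| "shift Stay t = t"

fun act :: "sym \<times> move \<Rightarrow> tape \<Rightarrow> tape" where
  "act (a, d) t = shift d (t(0 := a))"

definition input_tape :: "bool list \<Rightarrow> tape" where
  "input_tape w = (\<lambda>i. if 0 \<le> i \<and> i < int (length w) then Bit (w ! nat i) else Blank)"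

definition init :: "tm \<Rightarrow> bool list \<Rightarrow> config" where
  "init M w = (Run 0, input_tape w # replicate (work_tapes M) (\<lambda>_. Blank))"

definition tm_step :: "tm \<Rightarrow> config \<Rightarrow> config \<Rightarrow> bool" where
  "tm_step M c c' \<longleftrightarrow>
     (\<exists>q as q' acts ts. ((q, as), (q', acts)) \<in> set (instrs M) \<and> c = (Run q, ts) \<and>
        as = map (\<lambda>t. t 0) ts \<and> length acts = length ts \<and> c' = (q', map2 act acts ts))"

definition deterministic :: "tm \<Rightarrow> bool" where
  "deterministic M \<longleftrightarrow> single_valued (set (instrs M))"

text \<open>
  Halting means entering a state \<open>Halt a\<close>. A computation that is stuck in a state \<open>Run q\<close>
  does not count as halting. As the initial state is \<open>Run 0\<close>, a halting computation has at least
  one step.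
\<close>

definition halts_in :: "tm \<Rightarrow> bool list \<Rightarrow> nat \<Rightarrow> answer \<Rightarrow> bool" where
  "halts_in M w t a \<longleftrightarrow> (\<exists>ts. (tm_step M ^^ t) (init M w) (Halt a, ts))"

text \<open>
  The number of steps to a Yes/No halt, \<open>\<infinity>\<close> if there is none; for a nondeterministic machine, the
  length of a shortest such computation.
\<close>

definition run_time :: "tm \<Rightarrow> bool list \<Rightarrow> enat" where
  "run_time M w = Inf {enat t | t. halts_in M w t Yes \<or> halts_in M w t No}"

section \<open>Polynomial time\<close>

text \<open>
  The output of a function-computing machine is the bit string that starts at the head of the first
  tape and ends before the next blank.
\<close>

definition holds_output :: "tape \<Rightarrow> bool list \<Rightarrow> bool" where
  "holds_output t y \<longleftrightarrow> (\<forall>i < length y. t (int i) = Bit (y ! i)) \<and> t (int (length y)) = Blank"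

definition ptime_fun :: "(bool list \<Rightarrow> bool list) \<Rightarrow> bool" where
  "ptime_fun f \<longleftrightarrow>
     (\<exists>M (p :: nat poly). deterministic M \<and>
        (\<forall>x. \<exists>t \<le> poly p (length x). \<exists>a ts.
           (tm_step M ^^ t) (init M x) (Halt a, ts) \<and> holds_output (hd ts) (f x)))"

text \<open>
  Most significant bit first, without leading zeros; in particular 0 has the empty expansion.
\<close>

fun bin :: "nat \<Rightarrow> bool list" where
  "bin n = (if n = 0 then [] else bin (n div 2) @ [odd n])"

declare bin.simps [simp del]

definition ptime_nat_fun :: "(nat \<Rightarrow> nat) \<Rightarrow> bool" where
  "ptime_nat_fun h \<longleftrightarrow> (\<exists>g. ptime_fun g \<and> (\<forall>n. g (bin n) = bin (h n)))"

text \<open>The number \<open>0.b\<^sub>1b\<^sub>2\<dots>\<close> in binary notation.\<close>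

definition bin_frac :: "bool list \<Rightarrow> real" where
  "bin_frac bs = (\<Sum>i < length bs. of_bool (bs ! i) / 2 ^ Suc i)"

text \<open>
  For \<open>g\<close> with values in \<open>[0,1]\<close>. The pair \<open>(x, k)\<close> is presented to the machine as \<open>1\<^sup>k0x\<close>,
  so that the time is polynomial in \<open>k\<close> and the length of \<open>x\<close>.
\<close>

definition ptime_real_fun :: "(bool list \<Rightarrow> real) \<Rightarrow> bool" where
  "ptime_real_fun g \<longleftrightarrow>
     (\<exists>F. ptime_fun F \<and>
        (\<forall>x k. \<bar>bin_frac (F (replicate k True @ False # x)) - g x\<bar> \<le> 1 / 2 ^ k))"

section \<open>Distributional problems\<close>

text \<open>
  A decision problem over the binary alphabet is given by the set \<open>D\<^sup>+\<close> of its positive instances.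
  A family of functions \<open>\<mu>\<^sub>n\<close> on the spheres \<open>{0,1}\<^sup>n\<close> is given by a single function on strings, whose
  restriction to \<open>{0,1}\<^sup>n\<close> is \<open>\<mu>\<^sub>n\<close>.
\<close>

type_synonym problem = "bool list set"

type_synonym ensemble = "bool list \<Rightarrow> real"

definition sphere_prob :: "ensemble \<Rightarrow> nat \<Rightarrow> bool list set \<Rightarrow> real" where
  "sphere_prob \<mu> n S = (\<Sum>x \<in> {x \<in> S. length x = n}. \<mu> x)"

definition spherical_ensemble :: "ensemble \<Rightarrow> bool" where
  "spherical_ensemble \<mu> \<longleftrightarrow> (\<forall>x. 0 \<le> \<mu> x) \<and> (\<forall>n. sphere_prob \<mu> n UNIV = 1)"

text \<open>\<^const>\<open>lex\<close> only relates lists of equal length.\<close>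

definition cumulative :: "ensemble \<Rightarrow> bool list \<Rightarrow> real" where
  "cumulative \<mu> x = sphere_prob \<mu> (length x) {y. (y, x) \<in> lex {(False, True)}}"

definition NP :: "problem set" where
  "NP = {D. \<exists>N (p :: nat poly). \<forall>x.
     (\<forall>t c. (tm_step N ^^ t) (init N x) c \<longrightarrow> t \<le> poly p (length x)) \<and>
     (x \<in> D \<longleftrightarrow> (\<exists>t. halts_in N x t Yes))}"

definition DistNP :: "(problem \<times> ensemble) set" where
  "DistNP = {(D, \<mu>). D \<in> NP \<and> spherical_ensemble \<mu> \<and> ptime_real_fun (cumulative \<mu>)}"

definition partially_decides :: "tm \<Rightarrow> problem \<Rightarrow> bool" where
  "partially_decides M D \<longleftrightarrow> deterministic M \<and>
     (\<forall>x t a. halts_in M x t a \<longrightarrow>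
        a = DontKnow \<or> (a = Yes \<and> x \<in> D) \<or> (a = No \<and> x \<notin> D))"

fun SGPtime_decides :: "tm \<Rightarrow> problem \<times> ensemble \<Rightarrow> bool" where
  "SGPtime_decides M (D, \<mu>) \<longleftrightarrow> partially_decides M D \<and>
     (\<exists>p :: nat poly. \<forall>q :: real poly. q \<noteq> 0 \<longrightarrow>
        (\<lambda>n. sphere_prob \<mu> n {x. run_time M x > enat (poly p n)})
          \<in> o(\<lambda>n. 1 / poly q (real n)))"

text \<open>
  \<open>N\<close> is a machine \<open>M \<circ> f\<close>: it computes \<open>f x\<close> in polynomial time and then runs \<open>M\<close> on it. It thus
  halts on \<open>x\<close> exactly if \<open>M\<close> halts on \<open>f x\<close>, with the same answer, and after the number of steps
  of \<open>M\<close> plus a polynomially bounded number of steps.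
\<close>

definition composite :: "tm \<Rightarrow> tm \<Rightarrow> (bool list \<Rightarrow> bool list) \<Rightarrow> bool" where
  "composite N M f \<longleftrightarrow> deterministic N \<and>
     (\<exists>r :: nat poly. \<forall>x a.
        (\<forall>t. halts_in M (f x) t a \<longrightarrow> (\<exists>d \<le> poly r (length x). halts_in N x (d + t) a)) \<and>
        (\<forall>t. halts_in N x t a \<longrightarrow> (\<exists>t' \<le> t. halts_in M (f x) t' a)))"

definition ptime_reduction :: "problem \<Rightarrow> problem \<Rightarrow> (bool list \<Rightarrow> bool list) \<Rightarrow> bool" where
  "ptime_reduction D E f \<longleftrightarrow> ptime_fun f \<and> (\<forall>x. x \<in> D \<longleftrightarrow> f x \<in> E)"

definition size_invariant :: "(bool list \<Rightarrow> bool list) \<Rightarrow> bool" where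
  "size_invariant f \<longleftrightarrow>
     (\<forall>x\<^sub>1 x\<^sub>2. length x\<^sub>1 < length x\<^sub>2 \<longleftrightarrow> length (f x\<^sub>1) < length (f x\<^sub>2))"

definition SGPtime_reduction ::
    "problem \<times> ensemble \<Rightarrow> problem \<times> ensemble \<Rightarrow> (bool list \<Rightarrow> bool list) \<Rightarrow> bool" where
  "SGPtime_reduction P Q f \<longleftrightarrow>
     P \<in> DistNP \<and> Q \<in> DistNP \<and>
     ptime_reduction (fst P) (fst Q) f \<and> size_invariant f \<and>
     (\<forall>M. SGPtime_decides M Q \<longrightarrow> (\<exists>N. composite N M f \<and> SGPtime_decides N P))"

section \<open>Bounded halting\<close>

text \<open>The string \<open>c(n,w)\<close>, meaningful for \<open>n > |w|\<close> only.\<close>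

definition pad :: "nat \<Rightarrow> bool list \<Rightarrow> bool list" where
  "pad n w = replicate (n - Suc (length w)) True @ False # w"

lemma length_pad: "length w < n \<Longrightarrow> length (pad n w) = n"
  by (simp add: pad_def)

definition BH :: "tm \<Rightarrow> problem" where
  "BH M = {pad n w | n w. length w < n \<and> (\<exists>t \<le> n. \<exists>a. halts_in M w t a)}"

definition bh_ensemble :: ensemble where
  "bh_ensemble u =
     (case dropWhile (\<lambda>b. b) u of
        [] \<Rightarrow> if u = [] then 1 else 0
      | _ # w \<Rightarrow> 1 / (real (length u) * 2 ^ length w))"

lemma bh_ensemble_values:
  "bh_ensemble [] = 1"
  "1 \<le> k \<Longrightarrow> bh_ensemble (replicate k True) = 0"
  "bh_ensemble (replicate m True @ False # w) = 1 / (real (m + 1 + length w) * 2 ^ length w)"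
  by (auto simp: bh_ensemble_def dropWhile_append)

definition DBH :: "tm \<Rightarrow> problem \<times> ensemble" where
  "DBH M = (BH M, bh_ensemble)"

text \<open>The guard makes \<open>c(h(|w|),w)\<close> well-defined when \<open>h\<close> is only required to satisfy \<open>h(n) \<ge> n\<close>.\<close>

definition padded_set :: "(nat \<Rightarrow> nat) \<Rightarrow> bool list set" where
  "padded_set h = {pad (h (length w)) w | w. length w < h (length w)}"

definition induced_ensemble :: "bool list set \<Rightarrow> ensemble \<Rightarrow> ensemble" where
  "induced_ensemble S \<mu> x =
     (if sphere_prob \<mu> (length x) S \<noteq> 0
      then sphere_prob \<mu> (length x) ({x} \<inter> S) / sphere_prob \<mu> (length x) S
      else \<mu> x)"

definition DBH_padded :: "tm \<Rightarrow> (nat \<Rightarrow> nat) \<Rightarrow> problem \<times> ensemble" where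
  "DBH_padded M h = (BH M, induced_ensemble (padded_set h) bh_ensemble)"

section \<open>Universal machines\<close>

text \<open>
  A self-delimiting standard description of a machine as a bit string, relative to which an
  enumeration of the machines is polynomial-time computable.
\<close>

definition enc_nat :: "nat \<Rightarrow> bool list" where
  "enc_nat n = replicate n True @ [False]"

definition enc_list :: "('a \<Rightarrow> bool list) \<Rightarrow> 'a list \<Rightarrow> bool list" where
  "enc_list e xs = enc_nat (length xs) @ concat (map e xs)"

fun enc_sym :: "sym \<Rightarrow> bool list" where
  "enc_sym Blank = enc_nat 0"
| "enc_sym (Bit b) = enc_nat (if b then 2 else 1)"
| "enc_sym (Aux k) = enc_nat (k + 3)"

fun enc_move :: "move \<Rightarrow> bool list" where
  "enc_move Lft = enc_nat 0"
| "enc_move Rgt = enc_nat 1"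
| "enc_move Stay = enc_nat 2"

fun enc_state :: "state \<Rightarrow> bool list" where
  "enc_state (Halt Yes) = enc_nat 0"
| "enc_state (Halt No) = enc_nat 1"
| "enc_state (Halt DontKnow) = enc_nat 2"
| "enc_state (Run q) = enc_nat (q + 3)"

fun enc_instr :: "instr \<Rightarrow> bool list" where
  "enc_instr ((q, as), (q', acts)) =
     enc_nat q @ enc_list enc_sym as @ enc_state q' @
     enc_list (\<lambda>(a, d). enc_sym a @ enc_move d) acts"

definition enc_tm :: "tm \<Rightarrow> bool list" where
  "enc_tm M = enc_nat (work_tapes M) @ enc_list enc_instr (instrs M)"

definition ptime_enumeration :: "(tm \<Rightarrow> nat) \<Rightarrow> bool" where
  "ptime_enumeration \<gamma> \<longleftrightarrow>
     surj \<gamma> \<and> (\<exists>g. ptime_fun g \<and> (\<forall>M. g (enc_tm M) = bin (\<gamma> M)))"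

text \<open>\<open>1b\<^sub>k1b\<^sub>k\<^sub>-\<^sub>1\<dots>1b\<^sub>0\<close> for \<open>n\<close> with binary expansion \<open>b\<^sub>k\<dots>b\<^sub>0\<close>\<close>

definition overline_nat :: "nat \<Rightarrow> bool list" where
  "overline_nat n = concat (map (\<lambda>b. [True, b]) (bin n))"

text \<open>
  The answers compared are those of individual computations. The polynomial \<open>s\<close> bounds the overhead
  in terms of the length of \<open>w\<close> only, so it is allowed to depend on the simulated machine \<open>M\<close>.
\<close>

definition universal_tm :: "(tm \<Rightarrow> nat) \<Rightarrow> tm \<Rightarrow> bool" where
  "universal_tm \<gamma> U \<longleftrightarrow>
     (\<forall>M w a. (\<exists>t. halts_in M w t a) \<longleftrightarrow>
        (\<exists>t. halts_in U (overline_nat (\<gamma> M) @ False # w) t a)) \<and>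
     (\<forall>M. \<exists>s :: nat poly. \<forall>w.
        run_time U (overline_nat (\<gamma> M) @ False # w) \<le> enat (poly s (length w)) * run_time M w)"

end

theory Submission
  imports Defs
begin

text \<open>
  The freedom to choose \<open>h\<close> is used as follows. With \<open>h(l) = 2l + 1\<close> the set \<open>C(h)\<close> misses the
  spheres of even size, so that the induced distribution agrees there with the one of \<open>DBH(U)\<close>. An
  instance \<open>1\<^sup>m0w\<close> of size \<open>n\<close> of \<open>BH(M)\<close> is sent to an instance of even size \<open>N(n)\<close> of \<open>BH(U)\<close>
  asking \<open>U\<close> to run, on \<open>w\<close> preceded by the self-delimiting binary code of \<open>n\<close>, the machine that
  decodes \<open>n\<close> and then simulates \<open>n\<close> steps of \<open>M\<close>. The code of \<open>n\<close> has length \<open>O(log n)\<close>, which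
  costs only a polynomial factor in probability; and \<open>N\<close> is a polynomial exceeding the running
  time of \<open>U\<close> on such inputs, so that the time bound of the new instance is never the obstacle.

  All machines are obtained by compiling programs for stacks. The cumulative distribution of
  \<open>DBH(M)\<close> at \<open>1\<^sup>m0w\<close> is \<open>(m + 0.w)/n\<close>, which is computed by long division with a unary remainder.
\<close>

section \<open>Stack programs\<close>

text \<open>Words of C(h) cannot be the target, because of the probabilities. A size-invariant map
  sends words of one size to words of one size. On a sphere that meets C(h) the induced measure is
  uniform on words with tails of a single length l, each of mass 2^-l, whereas the instances 1^m0w
  of size n have masses ranging from 1/n down to 1/(n 2^(n-1)). A target tail holding w in full for
  all of them has l at least about n, and then the mass of the instances with short w drops
  exponentially. A sphere of DBH(U) itself gives every tail length the same share.

  The clock in the simulated machine is forced as well. The new time bound N(n) is larger than n, so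
  without it the halts of M after more than n steps would turn negative instances into positive
  ones. With the clock such computations get stuck, and a stuck computation never halts, so any halt
  of U is conclusive however late it comes. The clocked machine moreover answers Yes at every halt:
  BH counts halts with DontKnow, but the overhead of U is bounded through \<open>run_time\<close>,
  which ignores them.\<close>

lemma relpowp_Suc_left: "(R ^^ Suc n) x y \<longleftrightarrow> (\<exists>z. R x z \<and> (R ^^ n) z y)"
  by (simp only: relpowp.simps relpowp_commute[symmetric] relcompp_apply)

text \<open>Uniqueness of the successor is built in. A compiled program is put in front of a
  nondeterministic machine, and all computations of the combined machine must share this
  prefix.\<close>

fun forced :: "('a \<Rightarrow> 'a \<Rightarrow> bool) \<Rightarrow> nat \<Rightarrow> 'a \<Rightarrow> 'a \<Rightarrow> bool" where
  "forced R 0 x y \<longleftrightarrow> x = y"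
| "forced R (Suc d) x y \<longleftrightarrow> (\<exists>z. (\<forall>z'. R x z' \<longleftrightarrow> z' = z) \<and> forced R d z y)"

lemma forced_step: "(\<And>z'. R x z' \<longleftrightarrow> z' = z) \<Longrightarrow> forced R 1 x z"
  by simp

lemma forced_trans: "forced R d x y \<Longrightarrow> forced R e y z \<Longrightarrow> forced R (d + e) x z"
  by (induction d arbitrary: x) auto

lemma forced_relpowp: "forced R d x y \<Longrightarrow> (R ^^ (d + t)) x c \<longleftrightarrow> (R ^^ t) y c"
  by (induction d arbitrary: x) (auto simp add: relpowp_Suc_left simp del: relpowp.simps)

text \<open>Excludes a halt inside a forced prefix: a halted configuration has no successor.\<close>

lemma forced_relpowp_less: "forced R d x y \<Longrightarrow> t < d \<Longrightarrow> (R ^^ t) x c \<Longrightarrow> \<exists>c'. R c c'"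
proof (induction t arbitrary: d x)
  case 0
  then show ?case by (cases d) auto
next
  case (Suc t)
  then obtain e where "d = Suc e" by (cases d) auto
  with Suc show ?case
    by (auto simp add: relpowp_Suc_left simp del: relpowp.simps)
qed

declare forced.simps(2) [simp del]

text \<open>A lockstep simulation in both directions; the invariant \<open>I\<close> will confine it
  to configurations with the right number of tapes.\<close>

lemma relpowp_embed:
  assumes "\<And>x c. I x \<Longrightarrow> R (e x) c \<longleftrightarrow> (\<exists>y. S x y \<and> c = e y)"
    and "\<And>x y. I x \<Longrightarrow> S x y \<Longrightarrow> I y"
    and "I x"
  shows "(R ^^ t) (e x) c \<longleftrightarrow> (\<exists>y. (S ^^ t) x y \<and> c = e y)"
  using assms(3)
proof (induction t arbitrary: x)
  case 0
  then show ?case by auto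
next
  case (Suc t)
  have "(R ^^ Suc t) (e x) c \<longleftrightarrow> (\<exists>z. S x z \<and> (R ^^ t) (e z) c)"
    using assms(1)[OF Suc.prems] by (auto simp add: relpowp_Suc_left simp del: relpowp.simps)
  also have "\<dots> \<longleftrightarrow> (\<exists>z. S x z \<and> (\<exists>y. (S ^^ t) z y \<and> c = e y))"
    using Suc.IH assms(2)[OF Suc.prems] by blast
  also have "\<dots> \<longleftrightarrow> (\<exists>y. (S ^^ Suc t) x y \<and> c = e y)"
    by (auto simp add: relpowp_Suc_left simp del: relpowp.simps)
  finally show ?case .
qed

section \<open>Syntax and costs of stack programs\<close>

text \<open>
  The tape \<open>input_tape w\<close> serves as a stack with contents \<open>w\<close>: its head scans the top of the stack,
  a blank meaning that the stack is empty.
\<close>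

datatype com =
    Skip
  | Push nat bool
  | Pop nat
  | Seq com com (infixr ";;" 60)
  | Cond nat "sym \<Rightarrow> bool" com com
  | While nat "sym \<Rightarrow> bool" com

fun top_sym :: "bool list \<Rightarrow> sym" where
  "top_sym [] = Blank"
| "top_sym (b # w) = Bit b"

type_synonym store = "nat \<Rightarrow> bool list"

text \<open>The costs are the exact step counts of the compiled code: a push moves left and then
  writes, and the then branch and the loop body each end with one jump, which the else branch lacks.
  Exactness is what allows the runs to become \<open>forced\<close> steps.\<close>

inductive run :: "com \<Rightarrow> store \<Rightarrow> nat \<Rightarrow> store \<Rightarrow> bool" where
  Skip: "run Skip s 0 s"
| Push: "run (Push i b) s 2 (s(i := b # s i))"
| Pop: "run (Pop i) s 1 (s(i := tl (s i)))"
| Seq: "run c s t s' \<Longrightarrow> run d s' u s'' \<Longrightarrow> run (c ;; d) s (t + u) s''"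
| CondT: "P (top_sym (s i)) \<Longrightarrow> run c s t s' \<Longrightarrow> run (Cond i P c d) s (t + 2) s'"
| CondF: "\<not> P (top_sym (s i)) \<Longrightarrow> run d s t s' \<Longrightarrow> run (Cond i P c d) s (t + 1) s'"
| WhileF: "\<not> P (top_sym (s i)) \<Longrightarrow> run (While i P c) s 1 s"
| WhileT: "P (top_sym (s i)) \<Longrightarrow> run c s t s' \<Longrightarrow> run (While i P c) s' u s'' \<Longrightarrow>
    run (While i P c) s (t + u + 2) s''"

fun regs :: "com \<Rightarrow> nat set" where
  "regs Skip = {}"
| "regs (Push i b) = {i}"
| "regs (Pop i) = {i}"
| "regs (c ;; d) = regs c \<union> regs d"
| "regs (Cond i P c d) = insert i (regs c \<union> regs d)"
| "regs (While i P c) = insert i (regs c)"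

section \<open>Compilation to Turing machines\<close>

text \<open>The tape that is acted on and, depending on the symbol scanned there, the action and the
  next address.\<close>

type_synonym line = "nat \<times> (sym \<Rightarrow> (sym \<times> move) \<times> nat)"

fun code_len :: "com \<Rightarrow> nat" where
  "code_len Skip = 0"
| "code_len (Push i b) = 2"
| "code_len (Pop i) = 1"
| "code_len (c ;; d) = code_len c + code_len d"
| "code_len (Cond i P c d) = code_len c + code_len d + 2"
| "code_len (While i P c) = code_len c + 2"

fun compile :: "com \<Rightarrow> nat \<Rightarrow> line list" where
  "compile Skip p = []"
| "compile (Push i b) p = [(i, \<lambda>a. ((a, Lft), p + 1)), (i, \<lambda>a. ((Bit b, Stay), p + 2))]"
| "compile (Pop i) p = [(i, \<lambda>a. ((Blank, Rgt), p + 1))]"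
| "compile (c ;; d) p = compile c p @ compile d (p + code_len c)"
| "compile (Cond i P c d) p =
     (i, \<lambda>a. ((a, Stay), if P a then p + 1 else p + 2 + code_len c)) # compile c (p + 1) @
     (i, \<lambda>a. ((a, Stay), p + 2 + code_len c + code_len d)) # compile d (p + 2 + code_len c)"
| "compile (While i P c) p =
     (i, \<lambda>a. ((a, Stay), if P a then p + 1 else p + 2 + code_len c)) # compile c (p + 1) @
     [(i, \<lambda>a. ((a, Stay), p))]"

lemma length_compile [simp]: "length (compile c p) = code_len c"
  by (induction c arbitrary: p) auto

section \<open>Instruction tables, and a machine glued behind a program\<close>

definition stack_syms :: "sym list" where
  "stack_syms = [Blank, Bit False, Bit True]"

text \<open>A machine instruction names the scanned symbols of all tapes, so a line is expanded over
  all tuples of symbols that stacks can show; the tapes other than its own are left as they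
  are.\<close>

definition code_instrs :: "nat \<Rightarrow> line list \<Rightarrow> instr list" where
  "code_instrs k P =
     concat (map (\<lambda>pc. map (\<lambda>as. ((pc, as),
        (Run (snd (snd (P ! pc) (as ! fst (P ! pc)))),
         (map (\<lambda>a. (a, Stay)) as)[fst (P ! pc) := fst (snd (P ! pc) (as ! fst (P ! pc)))])))
        (List.n_lists k stack_syms)) [0..<length P])"

lemma set_code_instrs:
  "((pc, as), r) \<in> set (code_instrs k P) \<longleftrightarrow>
     pc < length P \<and> length as = k \<and> set as \<subseteq> set stack_syms \<and>
     r = (Run (snd (snd (P ! pc) (as ! fst (P ! pc)))),
         (map (\<lambda>a. (a, Stay)) as)[fst (P ! pc) := fst (snd (P ! pc) (as ! fst (P ! pc)))])"
  by (auto simp: code_instrs_def set_n_lists)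

text \<open>Shifting by the code length \<open>E\<close> makes \<open>Run E\<close>, the address at
  which the program falls off its end, the image of the initial state \<open>Run 0\<close> of the
  machine behind it.\<close>

fun relocate :: "nat \<Rightarrow> (answer \<Rightarrow> answer) \<Rightarrow> state \<Rightarrow> state" where
  "relocate E h (Run q) = Run (q + E)"
| "relocate E h (Halt a) = Halt (h a)"

text \<open>
  The tapes of \<open>M\<close> are its input tape, which is tape 0, and the tapes after the first
  \<open>r + 1\<close> ones. The pairs in \<open>X\<close> say what to do on the tapes \<open>1, \<dots>, r\<close> while \<open>M\<close> is running.
\<close>

definition lift_instrs ::
    "nat \<Rightarrow> (answer \<Rightarrow> answer) \<Rightarrow> (sym list \<times> (sym \<times> move) list) list \<Rightarrow> tm \<Rightarrow> instr list" where
  "lift_instrs E h X M =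
     concat (map (\<lambda>((q, as), (q', acts)).
        if length as = Suc (work_tapes M) \<and> length acts = Suc (work_tapes M)
        then map (\<lambda>(e, e'). ((q + E, hd as # e @ tl as), (relocate E h q', hd acts # e' @ tl acts))) X
        else []) (instrs M))"

lemma set_lift_instrs:
  "i \<in> set (lift_instrs E h X M) \<longleftrightarrow>
     (\<exists>q a as q' b acts e e'. ((q, a # as), (q', b # acts)) \<in> set (instrs M) \<and>
        length as = work_tapes M \<and> length acts = work_tapes M \<and> (e, e') \<in> set X \<and>
        i = ((q + E, a # e @ as), (relocate E h q', b # e' @ acts)))" (is "?L = ?R")
proof
  assume ?L
  then obtain q as q' acts e e' where *: "((q, as), (q', acts)) \<in> set (instrs M)"
      "length as = Suc (work_tapes M)" "length acts = Suc (work_tapes M)" "(e, e') \<in> set X"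
      "i = ((q + E, hd as # e @ tl as), (relocate E h q', hd acts # e' @ tl acts))"
    by (auto simp: lift_instrs_def split: if_splits)
  then obtain a as' b acts' where "as = a # as'" "acts = b # acts'"
    by (metis length_Suc_conv)
  with * show ?R by (metis length_Cons nat.inject list.sel(1,3))
next
  assume ?R
  then obtain q a as q' b acts e e' where *: "((q, a # as), (q', b # acts)) \<in> set (instrs M)"
      "length as = work_tapes M" "length acts = work_tapes M" "(e, e') \<in> set X"
      "i = ((q + E, a # e @ as), (relocate E h q', b # e' @ acts))"
    by blast
  let ?f = "\<lambda>(e, e'). ((q + E, a # e @ as), (relocate E h q', b # e' @ acts))"
  have "i \<in> set (map ?f X)"
    using *(4) imageI[OF *(4), of ?f] by (simp add: *(5))
  then show ?L
    unfolding lift_instrs_def set_concat set_map image_image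
    by (intro UN_I[OF *(1)]) (use * in simp)
qed

definition glue ::
    "com \<Rightarrow> nat \<Rightarrow> (answer \<Rightarrow> answer) \<Rightarrow> (sym list \<times> (sym \<times> move) list) list \<Rightarrow> tm \<Rightarrow> tm" where
  "glue c r h X M = TM (r + work_tapes M)
     (code_instrs (Suc (r + work_tapes M)) (compile c 0) @ lift_instrs (code_len c) h X M)"

section \<open>Stores as tapes, and correctness of the compiler\<close>

definition tapes :: "nat \<Rightarrow> store \<Rightarrow> tape list" where
  "tapes k s = map (\<lambda>i. input_tape (s i)) [0..<k]"

definition input_store :: "bool list \<Rightarrow> store" where
  "input_store x = (\<lambda>_. [])(0 := x)"

lemma input_tape_Nil: "input_tape [] = (\<lambda>_. Blank)"
  by (auto simp: input_tape_def)

lemma input_tape_0: "input_tape w 0 = top_sym w"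
  by (cases w) (auto simp: input_tape_def)

lemma top_sym_in: "top_sym w \<in> set stack_syms"
  by (cases w) (auto simp: stack_syms_def)

lemma Blank_in: "Blank \<in> set stack_syms"
  by (simp add: stack_syms_def)

lemma input_tape_upd_top: "(input_tape w)(0 := top_sym w) = input_tape w"
  by (simp add: fun_upd_idem input_tape_0)

lemma push_tape: "(\<lambda>i. input_tape w (i - 1))(0 := Bit b) = input_tape (b # w)"
proof
  fix i :: int
  show "((\<lambda>i. input_tape w (i - 1))(0 := Bit b)) i = input_tape (b # w) i"
  proof (cases "i \<ge> 1")
    case True
    then have "nat i = Suc (nat (i - 1))" by linarith
    with True show ?thesis by (auto simp: input_tape_def)
  qed (auto simp: input_tape_def)
qed

lemma pop_tape: "(\<lambda>i. ((input_tape w)(0 := Blank)) (i + 1)) = input_tape (tl w)"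
proof
  fix i :: int
  show "((input_tape w)(0 := Blank)) (i + 1) = input_tape (tl w) i"
  proof (cases "i \<ge> 0")
    case True
    then have "nat (i + 1) = Suc (nat i)" by linarith
    with True show ?thesis by (cases w) (auto simp: input_tape_def)
  next
    case False
    then show ?thesis by (auto simp: input_tape_def)
  qed
qed

lemma length_tapes [simp]: "length (tapes k s) = k"
  by (simp add: tapes_def)

lemma nth_tapes [simp]: "i < k \<Longrightarrow> tapes k s ! i = input_tape (s i)"
  by (simp add: tapes_def)

lemma tapes_upd: "i < k \<Longrightarrow> (tapes k s)[i := input_tape w] = tapes k (s(i := w))"
  by (auto intro!: nth_equalityI simp: nth_list_update)

lemma init_glue: "init (glue c r h X M) x = (Run 0, tapes (Suc (r + work_tapes M)) (input_store x))"
  by (auto simp: init_def glue_def tapes_def input_store_def input_tape_Nil upt_conv_Cons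
      intro!: nth_equalityI simp del: upt_Suc)

lemma map2_stay:
  assumes "i < length ts"
  shows "map2 act ((map (\<lambda>a. (a, Stay)) (map (\<lambda>t. t 0) ts))[i := b]) ts = ts[i := act b (ts ! i)]"
  using assms by (intro nth_equalityI) (auto simp: nth_list_update)

text \<open>Stated for arbitrary tapes because in the middle of a push one tape is not of the form
  \<open>input_tape w\<close>.\<close>

lemma glue_code_step:
  assumes "pc < code_len c" "compile c 0 ! pc = (i, \<delta>)" "i < k" "k = Suc (r + work_tapes M)"
    "length ts = k" "\<And>j. j < k \<Longrightarrow> (ts ! j) 0 \<in> set stack_syms"
  shows "tm_step (glue c r h X M) (Run pc, ts) c' \<longleftrightarrow>
    c' = (Run (snd (\<delta> ((ts ! i) 0))), ts[i := act (fst (\<delta> ((ts ! i) 0))) (ts ! i)])"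
proof -
  let ?as = "map (\<lambda>t. t 0) ts"
  have as: "set ?as \<subseteq> set stack_syms"
    using assms(5,6) by (auto simp: in_set_conv_nth)
  have iff: "((pc, ?as), rr) \<in> set (instrs (glue c r h X M)) \<longleftrightarrow>
     rr = (Run (snd (\<delta> ((ts ! i) 0))),
           (map (\<lambda>a. (a, Stay)) ?as)[i := fst (\<delta> ((ts ! i) 0))])" for rr
    using assms as by (auto simp: glue_def set_code_instrs set_lift_instrs)
  have "tm_step (glue c r h X M) (Run pc, ts) c' \<longleftrightarrow>
     (\<exists>q' acts. ((pc, ?as), (q', acts)) \<in> set (instrs (glue c r h X M)) \<and>
        length acts = length ts \<and> c' = (q', map2 act acts ts))"
    by (auto simp: tm_step_def)
  also have "\<dots> \<longleftrightarrow> c' = (Run (snd (\<delta> ((ts ! i) 0))), ts[i := act (fst (\<delta> ((ts ! i) 0))) (ts ! i)])"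
    unfolding iff using assms map2_stay[of i ts] by auto
  finally show ?thesis .
qed

lemma glue_jump:
  assumes "pc < code_len c" "compile c 0 ! pc = (i, \<lambda>a. ((a, Stay), g a))" "i < k"
    "k = Suc (r + work_tapes M)"
  shows "forced (tm_step (glue c r h X M)) 1 (Run pc, tapes k s)
     (Run (g (top_sym (s i))), tapes k s)"
proof -
  have "tm_step (glue c r h X M) (Run pc, tapes k s) c' \<longleftrightarrow>
     c' = (Run (g (top_sym (s i))), tapes k s)" for c'
    using glue_code_step[OF assms(1,2,3,4), of "tapes k s" h X c'] assms(3)
    by (simp add: input_tape_0 top_sym_in input_tape_upd_top tapes_upd fun_upd_triv
        del: fun_upd_apply)
  then show ?thesis by (rule forced_step)
qed

lemma glue_push:
  assumes "Suc pc < code_len c" "compile c 0 ! pc = (i, \<lambda>a. ((a, Lft), pc + 1))"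
    "compile c 0 ! Suc pc = (i, \<lambda>a. ((Bit b, Stay), pc + 2))" "i < k"
    "k = Suc (r + work_tapes M)"
  shows "forced (tm_step (glue c r h X M)) 2 (Run pc, tapes k s)
     (Run (pc + 2), tapes k (s(i := b # s i)))"
proof -
  let ?ts = "(tapes k s)[i := shift Lft (input_tape (s i))]"
  \<comment> \<open>This is the cell under the head between the two steps of a push; the instruction
    table covers it since it is blank.\<close>
  have b: "input_tape w (- 1) = Blank" for w by (simp add: input_tape_def)
  have "tm_step (glue c r h X M) (Run pc, tapes k s) c' \<longleftrightarrow> c' = (Run (Suc pc), ?ts)" for c'
    using glue_code_step[OF _ assms(2,4,5), of "tapes k s" h X c'] assms(1,4)
    by (simp add: input_tape_0 top_sym_in input_tape_upd_top del: fun_upd_apply)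
  then have 1: "forced (tm_step (glue c r h X M)) 1 (Run pc, tapes k s) (Run (Suc pc), ?ts)"
    by (rule forced_step)
  have "tm_step (glue c r h X M) (Run (Suc pc), ?ts) c' \<longleftrightarrow>
      c' = (Run (pc + 2), tapes k (s(i := b # s i)))" for c'
    using glue_code_step[OF assms(1,3,4,5), of ?ts h X c'] assms(4)
    by (simp add: nth_list_update input_tape_0 top_sym_in b Blank_in push_tape tapes_upd
        del: fun_upd_apply)
  then have 2: "forced (tm_step (glue c r h X M)) 1 (Run (Suc pc), ?ts)
      (Run (pc + 2), tapes k (s(i := b # s i)))"
    by (rule forced_step)
  show ?thesis
    using forced_trans[OF 1 2] by (simp only: one_add_one)
qed

lemma glue_pop:
  assumes "pc < code_len c" "compile c 0 ! pc = (i, \<lambda>a. ((Blank, Rgt), pc + 1))" "i < k"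
    "k = Suc (r + work_tapes M)"
  shows "forced (tm_step (glue c r h X M)) 1 (Run pc, tapes k s)
     (Run (pc + 1), tapes k (s(i := tl (s i))))"
proof -
  have "tm_step (glue c r h X M) (Run pc, tapes k s) c' \<longleftrightarrow>
      c' = (Run (pc + 1), tapes k (s(i := tl (s i))))" for c'
    using glue_code_step[OF assms(1,2,3,4), of "tapes k s" h X c'] assms(3)
    by (simp add: input_tape_0 top_sym_in pop_tape tapes_upd del: fun_upd_apply)
  then show ?thesis by (rule forced_step)
qed

text \<open>Jump addresses are absolute, so a fragment is tracked together with its context
  \<open>xs\<close>, \<open>ys\<close> in the whole program, and each case of the induction moves
  the boundary of the context.\<close>

lemma glue_forced:
  assumes "run c s t s'" "compile c0 0 = xs @ compile c (length xs) @ ys"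
    "regs c \<subseteq> {..<k}" "k = Suc (r + work_tapes M)"
  shows "forced (tm_step (glue c0 r h X M)) t (Run (length xs), tapes k s)
     (Run (length xs + code_len c), tapes k s')"
  using assms
proof (induction arbitrary: xs ys rule: run.induct)
  case (Skip s)
  then show ?case by simp
next
  case (Push i b s)
  have len: "length xs + 2 \<le> code_len c0"
    using arg_cong[OF Push.prems(1), of length] by simp
  have n0: "compile c0 0 ! length xs = (i, \<lambda>a. ((a, Lft), length xs + 1))"
    and n1: "compile c0 0 ! Suc (length xs) = (i, \<lambda>a. ((Bit b, Stay), length xs + 2))"
    using Push.prems by (auto simp: nth_append)
  have "i < k" using Push by simp
  then show ?case using glue_push[OF _ n0 n1] len Push.prems(3) by (simp del: fun_upd_apply)
next
  case (Pop i s)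
  have len: "length xs + 1 \<le> code_len c0"
    using arg_cong[OF Pop.prems(1), of length] by simp
  have n0: "compile c0 0 ! length xs = (i, \<lambda>a. ((Blank, Rgt), length xs + 1))"
    using Pop.prems by (auto simp: nth_append)
  have "i < k" using Pop by simp
  then show ?case using glue_pop[OF _ n0] len Pop.prems(3) by (simp del: fun_upd_apply)
next
  case (Seq c s t s' d u s'')
  have "forced (tm_step (glue c0 r h X M)) u (Run (length (xs @ compile c (length xs))), tapes k s')
     (Run (length (xs @ compile c (length xs)) + code_len d), tapes k s'')"
    using Seq.prems by (intro Seq.IH(2)[of _ ys]) auto
  moreover have "forced (tm_step (glue c0 r h X M)) t (Run (length xs), tapes k s)
     (Run (length xs + code_len c), tapes k s')"
    using Seq.prems by (intro Seq.IH(1)) auto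
  ultimately show ?case by (auto intro: forced_trans simp: add.assoc)
next
  case (CondT P s i c t s' d)
  let ?l = "(i, \<lambda>a. ((a, Stay), if P a then length xs + 1 else length xs + 2 + code_len c))"
  have len: "length xs + code_len c + 2 \<le> code_len c0"
    using arg_cong[OF CondT.prems(1), of length] by simp
  have n0: "compile c0 0 ! length xs = ?l"
    and n1: "compile c0 0 ! Suc (length xs + code_len c) =
      (i, \<lambda>a. ((a, Stay), length xs + 2 + code_len c + code_len d))"
    using CondT.prems by (auto simp: nth_append)
  have i: "i < k" using CondT by simp
  have 1: "forced (tm_step (glue c0 r h X M)) 1 (Run (length xs), tapes k s)
      (Run (Suc (length xs)), tapes k s)"
    using glue_jump[OF _ n0 i, of r M h X s] len CondT.prems(3) CondT.hyps by simp
  have 2: "forced (tm_step (glue c0 r h X M)) t (Run (length (xs @ [?l])), tapes k s)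
      (Run (length (xs @ [?l]) + code_len c), tapes k s')"
    using CondT.prems by (intro CondT.IH) auto
  have 3: "forced (tm_step (glue c0 r h X M)) 1 (Run (Suc (length xs + code_len c)), tapes k s')
      (Run (length xs + 2 + code_len c + code_len d), tapes k s')"
    using glue_jump[OF _ n1 i, of r M h X s'] len CondT.prems(3) by simp
  show ?case
    using forced_trans[OF forced_trans[OF 1] 3, of t] 2 by (simp add: algebra_simps)
next
  case (CondF P s i d t s' c)
  let ?l = "(i, \<lambda>a. ((a, Stay), if P a then length xs + 1 else length xs + 2 + code_len c))"
  let ?m = "(i, \<lambda>a. ((a, Stay), length xs + 2 + code_len c + code_len d))"
  have len: "length xs + code_len c + 2 \<le> code_len c0"
    using arg_cong[OF CondF.prems(1), of length] by simp
  have n0: "compile c0 0 ! length xs = ?l"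
    using CondF.prems by (auto simp: nth_append)
  have i: "i < k" using CondF by simp
  have 1: "forced (tm_step (glue c0 r h X M)) 1 (Run (length xs), tapes k s)
      (Run (length xs + 2 + code_len c), tapes k s)"
    using glue_jump[OF _ n0 i, of r M h X s] len CondF.prems(3) CondF.hyps by simp
  \<comment> \<open>What precedes the else branch: the test, the then branch and the jump over the
    else branch.\<close>
  let ?xs = "xs @ ?l # compile c (Suc (length xs)) @ [?m]"
  have 2: "forced (tm_step (glue c0 r h X M)) t (Run (length ?xs), tapes k s)
      (Run (length ?xs + code_len d), tapes k s')"
    using CondF.prems by (intro CondF.IH) auto
  show ?case
    using forced_trans[OF 1, of t] 2 by (simp add: algebra_simps)
next
  case (WhileF P s i c)
  let ?l = "(i, \<lambda>a. ((a, Stay), if P a then length xs + 1 else length xs + 2 + code_len c))"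
  have len: "length xs + code_len c + 2 \<le> code_len c0"
    using arg_cong[OF WhileF.prems(1), of length] by simp
  have n0: "compile c0 0 ! length xs = ?l"
    using WhileF.prems by (auto simp: nth_append)
  have i: "i < k" using WhileF by simp
  have 1: "forced (tm_step (glue c0 r h X M)) 1 (Run (length xs), tapes k s)
      (Run (length xs + 2 + code_len c), tapes k s)"
    using glue_jump[OF _ n0 i, of r M h X s] len WhileF.prems(3) WhileF.hyps by simp
  then show ?case by (simp add: algebra_simps)
next
  case (WhileT P s i c t s' u s'')
  let ?l = "(i, \<lambda>a. ((a, Stay), if P a then length xs + 1 else length xs + 2 + code_len c))"
  have len: "length xs + code_len c + 2 \<le> code_len c0"
    using arg_cong[OF WhileT.prems(1), of length] by simp
  have n0: "compile c0 0 ! length xs = ?l"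
    and n1: "compile c0 0 ! Suc (length xs + code_len c) = (i, \<lambda>a. ((a, Stay), length xs))"
    using WhileT.prems by (auto simp: nth_append)
  have i: "i < k" using WhileT by simp
  have 1: "forced (tm_step (glue c0 r h X M)) 1 (Run (length xs), tapes k s)
      (Run (Suc (length xs)), tapes k s)"
    using glue_jump[OF _ n0 i, of r M h X s] len WhileT.prems(3) WhileT.hyps by simp
  have 2: "forced (tm_step (glue c0 r h X M)) t (Run (length (xs @ [?l])), tapes k s)
      (Run (length (xs @ [?l]) + code_len c), tapes k s')"
    using WhileT.prems by (intro WhileT.IH(1)) auto
  have 3: "forced (tm_step (glue c0 r h X M)) 1 (Run (Suc (length xs + code_len c)), tapes k s')
      (Run (length xs), tapes k s')"
    using glue_jump[OF _ n1 i, of r M h X s'] len WhileT.prems(3) by simp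
  have 4: "forced (tm_step (glue c0 r h X M)) u (Run (length xs), tapes k s')
      (Run (length xs + code_len (While i P c)), tapes k s'')"
    using WhileT.prems by (intro WhileT.IH(2)) auto
  show ?case
    using forced_trans[OF forced_trans[OF forced_trans[OF 1] 3, of t] 4] 2
    by (simp add: algebra_simps)
qed


fun embed :: "nat \<Rightarrow> (answer \<Rightarrow> answer) \<Rightarrow> tape list \<Rightarrow> config \<Rightarrow> config" where
  "embed E h es (st, ts) = (relocate E h st, hd ts # es @ tl ts)"

lemma tm_step_length: "tm_step M (st, ts) (st', ts') \<Longrightarrow> length ts' = length ts"
  by (auto simp: tm_step_def)

text \<open>An equivalence, so neither computations nor halts are added or lost, except that a step
  needs a pair in \<open>X\<close> matching the extra tapes. If there is none, the machine is stuck;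
  this is how a clock stops it.\<close>

lemma glue_lift_step:
  assumes len: "length ts = Suc (work_tapes M)" "length es = r"
    and X: "\<And>e e'. (e, e') \<in> set X \<Longrightarrow> length e = r \<and> length e' = r"
  shows "tm_step (glue c r h X M) (embed (code_len c) h es (st, ts)) c' \<longleftrightarrow>
    (\<exists>e e' d. (e, e') \<in> set X \<and> e = map (\<lambda>t. t 0) es \<and> tm_step M (st, ts) d \<and>
       c' = embed (code_len c) h (map2 act e' es) d)" (is "?L \<longleftrightarrow> ?R")
proof -
  obtain t0 tws where ts: "ts = t0 # tws" "length tws = work_tapes M"
    using len by (cases ts) auto
  show ?thesis
  proof
    assume ?L
    then obtain q as q' acts where *: "((q, as), (q', acts)) \<in> set (instrs (glue c r h X M))"
      "relocate (code_len c) h st = Run q" "as = map (\<lambda>t. t 0) (t0 # es @ tws)"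
      "length acts = Suc (r + work_tapes M)" "c' = (q', map2 act acts (t0 # es @ tws))"
      using len ts by (auto simp: tm_step_def)
    obtain p where st: "st = Run p" "q = p + code_len c"
      using *(2) by (cases st) auto
    have "((q, as), (q', acts)) \<in> set (lift_instrs (code_len c) h X M)"
      using *(1) st by (auto simp: glue_def set_code_instrs)
    then obtain a as1 q1 b acts1 e e' where
      **: "((p, a # as1), (q1, b # acts1)) \<in> set (instrs M)"
        "length as1 = work_tapes M" "length acts1 = work_tapes M" "(e, e') \<in> set X"
        "as = a # e @ as1" "q' = relocate (code_len c) h q1" "acts = b # e' @ acts1"
      unfolding set_lift_instrs using st by auto
    have eq: "a = t0 0" "e = map (\<lambda>t. t 0) es" "as1 = map (\<lambda>t. t 0) tws"
      using **(2,4,5) *(3) X[OF **(4)] len ts by (auto simp: append_eq_append_conv)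
    have "tm_step M (st, ts) (q1, map2 act (b # acts1) (t0 # tws))"
      unfolding tm_step_def using ** eq st ts by auto
    moreover have "c' = embed (code_len c) h (map2 act e' es) (q1, map2 act (b # acts1) (t0 # tws))"
      using *(5) **(6,7) X[OF **(4)] len by simp
    ultimately show ?R using **(4) eq(2) by blast
  next
    assume ?R
    then obtain e e' d where *: "(e, e') \<in> set X" "e = map (\<lambda>t. t 0) es" "tm_step M (st, ts) d"
       "c' = embed (code_len c) h (map2 act e' es) d"
      by blast
    from *(3) obtain p as q1 acts where
      **: "((p, as), (q1, acts)) \<in> set (instrs M)" "st = Run p" "as = map (\<lambda>t. t 0) ts"
        "length acts = length ts" "d = (q1, map2 act acts ts)"
      unfolding tm_step_def by blast
    obtain b acts1 where acts: "acts = b # acts1" "length acts1 = work_tapes M"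
      using **(4) len by (cases acts) auto
    have "((p + code_len c, t0 0 # e @ map (\<lambda>t. t 0) tws), (relocate (code_len c) h q1, b # e' @ acts1))
       \<in> set (lift_instrs (code_len c) h X M)"
    proof -
      have "((p, t0 0 # map (\<lambda>t. t 0) tws), (q1, b # acts1)) \<in> set (instrs M)"
        "length (map (\<lambda>t. t 0) tws) = work_tapes M"
        using **(1,3) acts(1) ts by simp_all
      with acts(2) *(1) show ?thesis
        unfolding set_lift_instrs by blast
    qed
    then have "((p + code_len c, t0 0 # e @ map (\<lambda>t. t 0) tws),
        (relocate (code_len c) h q1, b # e' @ acts1)) \<in> set (instrs (glue c r h X M))"
      by (simp add: glue_def)
    then show ?L
      unfolding tm_step_def using *(2,4) **(2,5) acts ts len X[OF *(1)] by auto
  qed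
qed

lemma glue_forced_init:
  assumes "run c (input_store x) d s" "regs c \<subseteq> {..r}"
  shows "forced (tm_step (glue c r h X M)) d (init (glue c r h X M) x)
     (Run (code_len c), tapes (Suc (r + work_tapes M)) s)"
proof -
  have "regs c \<subseteq> {..<Suc (r + work_tapes M)}"
    using assms(2) by (rule subset_trans) auto
  from glue_forced[OF assms(1) _ this refl, of c "[]" "[]" h X] show ?thesis
    by (simp add: init_glue)
qed

lemma forced_not_halted:
  assumes "forced (tm_step M) d c e" "t < d" "(tm_step M ^^ t) c (st, ts)"
  shows "\<exists>q. st = Run q"
  using forced_relpowp_less[OF assms] by (auto simp: tm_step_def)

lemma act_blank [simp]: "(\<lambda>_. Blank)(0 := Blank) = (\<lambda>_. Blank)"
  by auto

lemma act_Blank_Stay: "act (Blank, Stay) (\<lambda>_. Blank) = (\<lambda>_. Blank)"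
  by simp

section \<open>Unrestricted and clocked continuation by a machine\<close>

definition idle :: "nat \<Rightarrow> (sym list \<times> (sym \<times> move) list) list" where
  "idle r = [(replicate r Blank, replicate r (Blank, Stay))]"

text \<open>Every step of the machine erases one symbol 1 from tape 1. When the tape is used up no
  instruction applies, and the computation is stuck without halting.\<close>

definition clock :: "nat \<Rightarrow> (sym list \<times> (sym \<times> move) list) list" where
  "clock r = [(Bit True # replicate (r - 1) Blank, (Blank, Rgt) # replicate (r - 1) (Blank, Stay))]"

definition then_run :: "com \<Rightarrow> nat \<Rightarrow> tm \<Rightarrow> tm" where
  "then_run c r M = glue c r (\<lambda>a. a) (idle r) M"

text \<open>All answers become Yes because BH counts halts with any answer, whereas NP asks for Yes
  and \<open>run_time\<close> disregards DontKnow.\<close>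

definition then_clocked :: "com \<Rightarrow> nat \<Rightarrow> tm \<Rightarrow> tm" where
  "then_clocked c r M = glue c r (\<lambda>_. Yes) (clock r) M"

lemma tapes_Suc: "tapes (Suc n) s = input_tape (s 0) # tapes n (\<lambda>i. s (Suc i))"
  by (simp add: tapes_def map_upt_Suc del: upt_Suc)

lemma tapes_empty: "tapes n (\<lambda>_. []) = replicate n (\<lambda>_. Blank)"
  by (simp add: tapes_def input_tape_Nil map_replicate_const)

lemma tapes_input_store:
  "tapes (Suc (r + w)) (input_store y) =
    input_tape y # replicate r (\<lambda>_. Blank) @ replicate w (\<lambda>_. Blank)"
  by (simp add: tapes_Suc input_store_def tapes_empty replicate_add)

lemma tapes_clock_store:
  assumes "0 < r"
  shows "tapes (Suc (r + w)) ((input_store y)(1 := z)) =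
    input_tape y # (input_tape z # replicate (r - 1) (\<lambda>_. Blank)) @ replicate w (\<lambda>_. Blank)"
  using assms by (cases r) (simp_all add: tapes_Suc input_store_def tapes_empty replicate_add)

lemma then_run_relpowp:
  assumes "run c (input_store x) d (input_store y)" "regs c \<subseteq> {..r}"
  shows "(tm_step (then_run c r M) ^^ (d + t)) (init (then_run c r M) x) c' \<longleftrightarrow>
    (\<exists>e. (tm_step M ^^ t) (init M y) e \<and>
       c' = embed (code_len c) (\<lambda>a. a) (replicate r (\<lambda>_. Blank)) e)"
proof -
  let ?R = "tm_step (then_run c r M)" and ?bl = "replicate r (\<lambda>_. Blank) :: tape list"
  have "(?R ^^ (d + t)) (init (then_run c r M) x) c' \<longleftrightarrow>
     (?R ^^ t) (embed (code_len c) (\<lambda>a. a) ?bl (init M y)) c'"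
    unfolding then_run_def forced_relpowp[OF glue_forced_init[OF assms]] tapes_input_store
    by (simp add: init_def)
  also have "\<dots> \<longleftrightarrow> (\<exists>e. (tm_step M ^^ t) (init M y) e \<and> c' = embed (code_len c) (\<lambda>a. a) ?bl e)"
  proof (rule relpowp_embed[where I = "\<lambda>(st, ts). length ts = Suc (work_tapes M)"], goal_cases)
    case (1 e c')
    obtain st ts where e: "e = (st, ts)" by (cases e)
    have m: "map2 act (replicate r (Blank, Stay)) ?bl = ?bl"
      by (intro nth_equalityI) auto
    show ?case
      unfolding e then_run_def using 1 e
      by (subst glue_lift_step) (auto simp: idle_def map_replicate_const m)
  next
    case (2 e e')
    then show ?case by (auto dest: tm_step_length)
  next
    case 3
    then show ?case by (simp add: init_def)
  qed
  finally show ?thesis .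
qed

lemma then_clocked_relpowp:
  assumes "run c (input_store x) d ((input_store y)(1 := replicate n True))" "regs c \<subseteq> {..r}" "0 < r"
  shows "(tm_step (then_clocked c r M) ^^ (d + t)) (init (then_clocked c r M) x) c' \<longleftrightarrow>
    t \<le> n \<and> (\<exists>e. (tm_step M ^^ t) (init M y) e \<and> c' = embed (code_len c) (\<lambda>_. Yes)
      (input_tape (replicate (n - t) True) # replicate (r - 1) (\<lambda>_. Blank)) e)"
proof -
  let ?R = "tm_step (then_clocked c r M)"
  let ?es = "\<lambda>n. input_tape (replicate n True) # replicate (r - 1) (\<lambda>_. Blank)"
  have step: "?R (embed (code_len c) (\<lambda>_. Yes) (?es n) (st, ts)) c' \<longleftrightarrow>
     0 < n \<and> (\<exists>e. tm_step M (st, ts) e \<and> c' = embed (code_len c) (\<lambda>_. Yes) (?es (n - 1)) e)"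
    if "length ts = Suc (work_tapes M)" for st ts n c'
  proof -
    have m: "map2 act (replicate (r - 1) (Blank, Stay)) (replicate (r - 1) (\<lambda>_. Blank)) =
        replicate (r - 1) (\<lambda>_. Blank)"
      by (intro nth_equalityI) auto
    have top: "input_tape (replicate n True) 0 = Bit True \<longleftrightarrow> 0 < n"
      by (cases n) (auto simp: input_tape_0)
    have "act (Blank, Rgt) (input_tape (replicate n True)) = input_tape (replicate (n - 1) True)"
      using pop_tape[of "replicate n True"] by (simp add: tl_replicate)
    then show ?thesis
      unfolding then_clocked_def using that assms(3) top
      by (subst glue_lift_step)
        (auto simp: clock_def map_replicate_const m act_Blank_Stay simp del: act.simps)
  qed
  have main: "(?R ^^ t) (embed (code_len c) (\<lambda>_. Yes) (?es n) (st, ts)) c' \<longleftrightarrow>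
     t \<le> n \<and> (\<exists>e. (tm_step M ^^ t) (st, ts) e \<and>
       c' = embed (code_len c) (\<lambda>_. Yes) (?es (n - t)) e)"
    if "length ts = Suc (work_tapes M)" for st ts
    using that
  proof (induction t arbitrary: n st ts)
    case 0
    then show ?case by auto
  next
    case (Suc t)
    have "(?R ^^ Suc t) (embed (code_len c) (\<lambda>_. Yes) (?es n) (st, ts)) c' \<longleftrightarrow>
       0 < n \<and> (\<exists>st' ts'. tm_step M (st, ts) (st', ts') \<and>
         (?R ^^ t) (embed (code_len c) (\<lambda>_. Yes) (?es (n - 1)) (st', ts')) c')"
      unfolding relpowp_Suc_left step[OF Suc.prems] by (metis prod.collapse)
    also have "\<dots> \<longleftrightarrow> 0 < n \<and> (\<exists>st' ts'. tm_step M (st, ts) (st', ts') \<and>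
       t \<le> n - 1 \<and> (\<exists>e. (tm_step M ^^ t) (st', ts') e \<and>
         c' = embed (code_len c) (\<lambda>_. Yes) (?es (n - 1 - t)) e))"
      using Suc.IH[of _ "n - 1"] tm_step_length Suc.prems by metis
    also have "\<dots> \<longleftrightarrow> Suc t \<le> n \<and> (\<exists>e. (tm_step M ^^ Suc t) (st, ts) e \<and>
       c' = embed (code_len c) (\<lambda>_. Yes) (?es (n - Suc t)) e)"
      unfolding relpowp_Suc_left by (cases n) auto
    finally show ?case .
  qed
  have "(?R ^^ (d + t)) (init (then_clocked c r M) x) c' \<longleftrightarrow>
     (?R ^^ t) (embed (code_len c) (\<lambda>_. Yes) (?es n) (init M y)) c'"
    unfolding then_clocked_def forced_relpowp[OF glue_forced_init[OF assms(1,2)]]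
      tapes_clock_store[OF assms(3)]
    by (simp add: init_def)
  also have "\<dots> \<longleftrightarrow> t \<le> n \<and> (\<exists>e. (tm_step M ^^ t) (init M y) e \<and>
      c' = embed (code_len c) (\<lambda>_. Yes) (?es (n - t)) e)"
    using main[of "snd (init M y)" "fst (init M y)"] by (simp add: init_def)
  finally show ?thesis .
qed

text \<open>The program occupies the states below \<open>code_len c\<close> and the lifted machine
  the states from there on, so the two tables cannot conflict; \<open>idle r\<close> consists of one
  pair and adds no choice.\<close>

lemma deterministic_then_run:
  assumes "deterministic M"
  shows "deterministic (then_run c r M)"
  unfolding deterministic_def
proof (rule single_valuedI)
  fix l y z
  assume y: "(l, y) \<in> set (instrs (then_run c r M))" and z: "(l, z) \<in> set (instrs (then_run c r M))"
  obtain pc as where l: "l = (pc, as)" by (cases l)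
  let ?C = "code_instrs (Suc (r + work_tapes M)) (compile c 0)"
  let ?L = "lift_instrs (code_len c) (\<lambda>a. a) (idle r) M"
  have inst: "set (instrs (then_run c r M)) = set ?C \<union> set ?L"
    by (simp add: then_run_def glue_def)
  show "y = z"
  proof (cases "pc < code_len c")
    case True
    then have "(l, u) \<notin> set ?L" for u by (auto simp: set_lift_instrs l)
    with y z inst show ?thesis by (auto simp: l set_code_instrs)
  next
    case False
    then have "(l, u) \<notin> set ?C" for u by (auto simp: set_code_instrs l)
    with y z inst have "(l, y) \<in> set ?L" "(l, z) \<in> set ?L" by auto
    with assms show ?thesis
      by (auto simp: set_lift_instrs l idle_def deterministic_def dest: single_valuedD)
  qed
qed

lemma halts_in_then_run:
  assumes "run c (input_store x) d (input_store y)" "regs c \<subseteq> {..r}"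
  shows "halts_in (then_run c r M) x t a \<longleftrightarrow> (\<exists>t'. t = d + t' \<and> halts_in M y t' a)"
proof (cases "t < d")
  case True
  then have "\<not> halts_in (then_run c r M) x t a"
    using forced_not_halted[OF glue_forced_init[OF assms] True]
    unfolding halts_in_def then_run_def by blast
  with True show ?thesis by auto
next
  case False
  then obtain t' where t: "t = d + t'" using le_iff_add linorder_not_less by blast
  have "(\<exists>ts. (Halt a, ts) = embed E (\<lambda>a. a) es e) \<longleftrightarrow> (\<exists>ts. e = (Halt a, ts))" for E es e
    by (cases e; cases "fst e") auto
  then show ?thesis
    unfolding halts_in_def t then_run_relpowp[OF assms] by (metis add_left_cancel)
qed

lemma halts_in_then_clocked:
  assumes "run c (input_store x) d ((input_store y)(1 := replicate n True))" "regs c \<subseteq> {..r}" "0 < r"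
  shows "halts_in (then_clocked c r M) x t a \<longleftrightarrow>
    a = Yes \<and> (\<exists>t' \<le> n. \<exists>b. t = d + t' \<and> halts_in M y t' b)"
proof (cases "t < d")
  case True
  then have "\<not> halts_in (then_clocked c r M) x t a"
    using forced_not_halted[OF glue_forced_init[OF assms(1,2)] True]
    unfolding halts_in_def then_clocked_def by blast
  with True show ?thesis by auto
next
  case False
  then obtain t' where t: "t = d + t'" using le_iff_add linorder_not_less by blast
  have "(\<exists>ts. (Halt a, ts) = embed E (\<lambda>_. Yes) es e) \<longleftrightarrow>
      a = Yes \<and> (\<exists>b ts. e = (Halt b, ts))" for E es e
    by (cases e; cases "fst e") auto
  then have "(\<exists>ts. Q \<and> (\<exists>e. S e \<and> (Halt a, ts) = embed E (\<lambda>_. Yes) es e)) \<longleftrightarrow>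
      a = Yes \<and> Q \<and> (\<exists>b ts. S (b, ts) \<and> (\<exists>c. b = Halt c))" for Q S E es
    by metis
  then show ?thesis
    unfolding halts_in_def t then_clocked_relpowp[OF assms] by auto
qed

lemma then_clocked_time:
  assumes "run c (input_store x) d ((input_store y)(1 := replicate n True))" "regs c \<subseteq> {..r}" "0 < r"
    "(tm_step (then_clocked c r M) ^^ t) (init (then_clocked c r M) x) e"
  shows "t \<le> d + n"
proof (rule ccontr)
  assume "\<not> t \<le> d + n"
  then obtain t' where t: "t = d + t'" "\<not> t' \<le> n"
    using le_Suc_ex[of d t] by auto
  show False
    using assms(4) t(2) unfolding t(1) then_clocked_relpowp[OF assms(1-3)] by blast
qed

text \<open>A program ends by leaving its code. Gluing this machine behind it turns that into a
  halt, at the price of one step, and leaves the output on tape 0.\<close>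

definition halt_tm :: tm where
  "halt_tm = TM 0 (map (\<lambda>a. ((0, [a]), (Halt Yes, [(a, Stay)]))) stack_syms)"

lemma deterministic_halt_tm: "deterministic halt_tm"
  unfolding deterministic_def halt_tm_def tm.sel by (rule single_valuedI) auto

lemma ptime_funI:
  assumes "\<And>x. \<exists>d \<le> poly p (length x). run c (input_store x) d (input_store (f x))"
    "regs c \<subseteq> {..r}"
  shows "ptime_fun f"
proof -
  have "\<exists>t \<le> poly (p + 1) (length x). \<exists>a ts.
       (tm_step (then_run c r halt_tm) ^^ t) (init (then_run c r halt_tm) x) (Halt a, ts) \<and>
       holds_output (hd ts) (f x)" for x
  proof -
  obtain d where d: "d \<le> poly p (length x)" "run c (input_store x) d (input_store (f x))"
    using assms by blast
  have "tm_step halt_tm (init halt_tm (f x)) (Halt Yes, [input_tape (f x)])"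
    using top_sym_in[of "f x"]
    by (auto simp: tm_step_def init_def halt_tm_def input_tape_0 input_tape_upd_top
        simp del: fun_upd_apply)
  then have "\<exists>e. (tm_step halt_tm ^^ 1) (init halt_tm (f x)) e \<and>
      embed (code_len c) (\<lambda>a. a) (replicate r (\<lambda>_. Blank)) (Halt Yes, [input_tape (f x)]) =
      embed (code_len c) (\<lambda>a. a) (replicate r (\<lambda>_. Blank)) e"
    unfolding relpowp_1 by blast
  then have "(tm_step (then_run c r halt_tm) ^^ (d + 1)) (init (then_run c r halt_tm) x)
     (embed (code_len c) (\<lambda>a. a) (replicate r (\<lambda>_. Blank)) (Halt Yes, [input_tape (f x)]))"
    unfolding then_run_relpowp[OF d(2) assms(2)] .
  then have "(tm_step (then_run c r halt_tm) ^^ (d + 1)) (init (then_run c r halt_tm) x)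
     (Halt Yes, input_tape (f x) # replicate r (\<lambda>_. Blank))"
    by simp
  moreover have "holds_output (hd (input_tape (f x) # replicate r (\<lambda>_. Blank))) (f x)"
    by (auto simp: holds_output_def input_tape_def)
  moreover have "d + 1 \<le> poly (p + 1) (length x)"
    using d(1) by simp
  ultimately show ?thesis
    by blast
  qed
  moreover have "deterministic (then_run c r halt_tm)"
    by (intro deterministic_then_run deterministic_halt_tm)
  ultimately show ?thesis
    unfolding ptime_fun_def by blast
qed

declare One_nat_def [simp del]

section \<open>Verification of stack programs\<close>

text \<open>Upper bounds in place of the exact costs of \<open>run\<close>, so that sums of costs
  can be rounded up to simple expressions by \<open>exec_conseq\<close>.\<close>

definition exec :: "com \<Rightarrow> store \<Rightarrow> nat \<Rightarrow> store \<Rightarrow> bool" where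
  "exec c s T s' \<longleftrightarrow> (\<exists>t \<le> T. run c s t s')"

lemma exec_conseq: "exec c s T s' \<Longrightarrow> s' = s'' \<Longrightarrow> T \<le> T' \<Longrightarrow> exec c s T' s''"
  by (auto simp: exec_def intro: order_trans)

lemma exec_Skip: "exec Skip s 0 s"
  and exec_Push: "exec (Push i b) s 2 (s(i := b # s i))"
  and exec_Pop: "exec (Pop i) s 1 (s(i := tl (s i)))"
  unfolding exec_def by (blast intro: run.intros)+

lemma exec_Seq: "exec c s T s' \<Longrightarrow> exec d s' U s'' \<Longrightarrow> exec (c ;; d) s (T + U) s''"
  unfolding exec_def by (meson add_mono run.Seq)

lemma exec_CondT: "P (top_sym (s i)) \<Longrightarrow> exec c s T s' \<Longrightarrow> exec (Cond i P c d) s (T + 2) s'"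
  unfolding exec_def by (meson add_le_mono1 run.CondT)

lemma exec_CondF: "\<not> P (top_sym (s i)) \<Longrightarrow> exec d s T s' \<Longrightarrow> exec (Cond i P c d) s (T + 1) s'"
  unfolding exec_def by (meson add_le_mono1 run.CondF)

lemma exec_WhileF: "\<not> P (top_sym (s i)) \<Longrightarrow> exec (While i P c) s 1 s"
  unfolding exec_def by (blast intro: run.intros)

lemma exec_WhileT:
  "P (top_sym (s i)) \<Longrightarrow> exec c s T s' \<Longrightarrow> exec (While i P c) s' U s'' \<Longrightarrow>
    exec (While i P c) s (T + U + 2) s''"
  unfolding exec_def by (meson add_le_mono1 add_mono run.WhileT)

lemmas exec_basic = exec_Skip exec_Push exec_Pop exec_Seq

section \<open>Tests, copying, and splitting an instance\<close>

definition filled :: "sym \<Rightarrow> bool" where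
  "filled a \<longleftrightarrow> a \<noteq> Blank"

definition is_one :: "sym \<Rightarrow> bool" where
  "is_one a \<longleftrightarrow> a = Bit True"

lemma filled_simps [simp]: "filled Blank = False" "filled (Bit b) = True" "filled (top_sym w) \<longleftrightarrow> w \<noteq> []"
  by (cases w; simp add: filled_def)+

lemma is_one_simps [simp]: "is_one Blank = False" "is_one (Bit b) = b"
  by (auto simp: is_one_def)

abbreviation ones :: "nat \<Rightarrow> bool list" where
  "ones n \<equiv> replicate n True"

lemma is_one_top_ones [simp]: "is_one (top_sym (ones n)) \<longleftrightarrow> 0 < n"
  by (cases n) auto

lemma ones_1 [simp]: "ones 1 = [True]" "ones (n + 1) = True # ones n"
  by (simp_all add: One_nat_def)

definition copy_bit :: "nat \<Rightarrow> nat \<Rightarrow> com" where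
  "copy_bit i j = Cond i is_one (Push j True) (Push j False)"

lemma exec_copy_bit: "s i = b # w \<Longrightarrow> exec (copy_bit i j) s 4 (s(j := b # s j))"
  unfolding copy_bit_def
  using exec_CondT[where d = "Push j False", OF _ exec_Push, of is_one s i j True]
    exec_conseq[OF exec_CondF[where c = "Push j True", OF _ exec_Push, of is_one s i j False] refl, of 4]
  by (cases b) auto

definition clear :: "nat \<Rightarrow> com" where
  "clear i = While i filled (Pop i)"

lemma exec_clear: "exec (clear i) s (3 * length (s i) + 1) (s(i := []))"
proof (induction "s i" arbitrary: s)
  case Nil
  then show ?case
    unfolding clear_def
    by - (rule exec_conseq[OF exec_WhileF], auto simp: fun_eq_iff)
next
  case (Cons b w)
  have "exec (clear i) (s(i := w)) (3 * length w + 1) (s(i := []))"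
    using Cons(1)[of "s(i := w)"] by simp
  then show ?case
    unfolding clear_def using Cons(2)[symmetric]
    by - (rule exec_conseq[OF exec_WhileT[OF _ exec_Pop]], auto)
qed

definition move :: "nat \<Rightarrow> nat \<Rightarrow> com" where
  "move i j = While i filled (copy_bit i j ;; Pop i)"

lemma exec_move:
  assumes "i \<noteq> j"
  shows "exec (move i j) s (7 * length (s i) + 1) (s(i := [], j := rev (s i) @ s j))"
proof (induction "s i" arbitrary: s)
  case Nil
  then show ?case
    unfolding move_def
    by - (rule exec_conseq[OF exec_WhileF], auto simp: fun_eq_iff)
next
  case (Cons b w)
  have "exec (move i j) (s(j := b # s j, i := w)) (7 * length w + 1)
     (s(i := [], j := rev (s i) @ s j))"
    using Cons(1)[of "s(j := b # s j, i := w)"] assms Cons(2)[symmetric]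
    by (auto simp: fun_upd_twist)
  then show ?case
    unfolding move_def using Cons(2)[symmetric] assms
    by - (rule exec_conseq[OF exec_WhileT[OF _ exec_Seq[OF exec_copy_bit exec_Pop]]], auto)
qed

lemma exec_loop:
  assumes "\<And>k. k < n \<Longrightarrow> P (top_sym (S k i)) \<and> exec c (S k) T (S (Suc k))"
    and "\<not> P (top_sym (S n i))"
  shows "exec (While i P c) (S 0) (n * (T + 2) + 1) (S n)"
  using assms
proof (induction n arbitrary: S)
  case 0
  then show ?case using exec_WhileF[of P "S 0" i c] by simp
next
  case (Suc n)
  have "exec (While i P c) (S (Suc 0)) (n * (T + 2) + 1) (S (Suc n))"
    using Suc(1)[of "\<lambda>k. S (Suc k)"] Suc(2,3) by auto
  then have "exec (While i P c) (S 0) (T + (n * (T + 2) + 1) + 2) (S (Suc n))"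
    using Suc(2)[of 0] exec_WhileT by blast
  then show ?case by (rule exec_conseq) auto
qed

lemma exec_loop':
  assumes "\<And>k. k < n \<Longrightarrow> P (top_sym (S k i)) \<and> exec c (S k) T (S (Suc k))"
    and "\<not> P (top_sym (S n i))" "s = S 0" "s' = S n" "n * (T + 2) + 1 \<le> T'"
  shows "exec (While i P c) s T' s'"
  using exec_conseq[OF exec_loop[of n P S i c T]] assms by auto

text \<open>
  In all programs, register 0 holds the input and the output. After \<open>split\<close> on input
  \<open>1\<^sup>m0w\<close> of length \<open>n\<close>, register 0 holds \<open>w\<close>, register 1 holds \<open>1\<^sup>n\<close>, register 4 holds \<open>1\<^sup>m\<close>,
  and register 2 is nonempty; it remains empty if the input consists of ones only.
\<close>

definition split :: com where
  "split =
     While 0 is_one (Pop 0 ;; Push 1 True ;; Push 4 True) ;;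
     Cond 0 filled
       (Pop 0 ;; Push 1 True ;; Push 2 True ;;
        While 0 filled (copy_bit 0 3 ;; Push 1 True ;; Pop 0) ;; move 3 0)
       Skip"

lemma exec_split_ones:
  assumes "s 0 = ones m @ w" "s 1 = []" "s 4 = []" "\<not> is_one (top_sym w)"
  shows "exec (While 0 is_one (Pop 0 ;; Push 1 True ;; Push 4 True)) s (7 * m + 1)
    (s(0 := w, 1 := ones m, 4 := ones m))"
proof (rule exec_loop'[where n = m and T = 5 and
      S = "\<lambda>k. s(0 := ones (m - k) @ w, 1 := ones k, 4 := ones k)"], goal_cases)
  case (1 k)
  then obtain l where l: "m - k = Suc l" "m - Suc k = l"
    by (metis Suc_diff_Suc)
  show ?case
  proof
    show "exec (Pop 0 ;; Push 1 True ;; Push 4 True) (s(0 := ones (m - k) @ w, 1 := ones k, 4 := ones k)) 5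
       (s(0 := ones (m - Suc k) @ w, 1 := ones (Suc k), 4 := ones (Suc k)))"
      by (rule exec_conseq, (rule exec_basic)+) (auto simp: fun_eq_iff l)
  qed (simp add: l)
next
  case 2
  show ?case using assms(4) by simp
qed (use assms in \<open>auto simp: fun_eq_iff\<close>)

lemma exec_split_rest:
  assumes "s 0 = w" "s 1 = ones m"
  shows "exec (While 0 filled (copy_bit 0 3 ;; Push 1 True ;; Pop 0)) s (9 * length w + 1)
    (s(0 := [], 1 := ones (m + length w), 3 := rev w @ s 3))"
  using assms
proof (induction w arbitrary: s m)
  case Nil
  then show ?case
    by - (rule exec_conseq[OF exec_WhileF], auto simp: fun_eq_iff)
next
  case (Cons b w)
  let ?s = "s(3 := b # s 3, 1 := ones (Suc m), 0 := w)"
  have "exec (copy_bit 0 3 ;; Push 1 True ;; Pop 0) s 7 ?s"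
    by (rule exec_conseq,
        (rule exec_basic | (rule exec_copy_bit[of _ _ b w], (simp add: Cons.prems; fail)))+)
      (use Cons.prems in \<open>auto simp: fun_eq_iff\<close>)
  moreover have "exec (While 0 filled (copy_bit 0 3 ;; Push 1 True ;; Pop 0)) ?s (9 * length w + 1)
      (?s(0 := [], 1 := ones (Suc m + length w), 3 := rev w @ ?s 3))"
    by (rule Cons.IH) auto
  ultimately show ?case
    using Cons.prems
    by - (rule exec_conseq[OF exec_WhileT], auto simp: fun_eq_iff)
qed

lemma exec_split:
  assumes "s 0 = ones m @ False # w" "s 1 = []" "s 2 = []" "s 3 = []" "s 4 = []"
  shows "exec split s (20 * length (s 0) + 20)
    (s(0 := w, 1 := ones (Suc (m + length w)), 2 := [True], 4 := ones m))"
  unfolding split_def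
  by (rule exec_conseq, (rule exec_basic | (rule exec_CondT, (simp; fail))
      | (rule exec_split_ones[where m = m and w = "False # w"] exec_move, (simp add: assms; fail)+)
      | (rule exec_split_rest[where m = "Suc m", OF refl], (simp add: assms; fail)+))+)
    (use assms in \<open>auto simp: fun_eq_iff\<close>)

lemma exec_split_all_ones:
  assumes "s 0 = ones m" "s 1 = []" "s 2 = []" "s 3 = []" "s 4 = []"
  shows "exec split s (20 * length (s 0) + 20) (s(0 := [], 1 := ones m, 4 := ones m))"
  unfolding split_def
  by (rule exec_conseq, (rule exec_basic | (rule exec_CondF, (simp; fail))
      | (rule exec_split_ones[where m = m and w = "[]"], (simp add: assms; fail)+))+)
    (use assms in \<open>auto simp: fun_eq_iff\<close>)


text \<open>On a string of ones, which is never in BH, \<open>clear 1\<close> leaves an empty clock,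
  so that the machine behind the program cannot make a single step.\<close>

definition clock_prog :: com where
  "clock_prog = split ;; clear 4 ;; Cond 2 filled (Pop 2) (clear 1)"

lemma exec_clock_prog:
  assumes "x = ones m @ False # w"
  shows "exec clock_prog (input_store x) (40 * length x + 40)
    ((input_store w)(1 := ones (length x)))"
  unfolding clock_prog_def
  by (rule exec_conseq, (rule exec_basic exec_clear | (rule exec_CondT, (simp; fail))
      | (rule exec_split[where m = m and w = w], (simp add: assms input_store_def; fail)+))+)
    (use assms in \<open>auto simp: fun_eq_iff input_store_def\<close>)

lemma exec_clock_prog_all_ones:
  "exec clock_prog (input_store (ones m)) (40 * m + 40) ((input_store [])(1 := ones 0))"
  unfolding clock_prog_def
  by (rule exec_conseq, (rule exec_basic exec_clear
      | (rule exec_CondF, (simp add: input_store_def; fail))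
      | (rule exec_split_all_ones[where m = m], (simp add: input_store_def; fail)+))+)
    (auto simp: fun_eq_iff input_store_def)

section \<open>Decoding the self-delimiting code of a number\<close>

definition double :: "nat \<Rightarrow> nat \<Rightarrow> com" where
  "double i j = While i filled (Pop i ;; Push j True ;; Push j True)"

lemma exec_double:
  assumes "s i = ones a" "s j = []" "i \<noteq> j"
  shows "exec (double i j) s (7 * a + 1) (s(i := [], j := ones (2 * a)))"
  unfolding double_def
proof (rule exec_loop'[where n = a and T = 5 and S = "\<lambda>k. s(i := ones (a - k), j := ones (2 * k))"],
    goal_cases)
  case (1 k)
  then obtain l where l: "a - k = Suc l" "a - Suc k = l"
    by (metis Suc_diff_Suc)
  show ?case
  proof
    show "exec (Pop i ;; Push j True ;; Push j True) (s(i := ones (a - k), j := ones (2 * k))) 5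
       (s(i := ones (a - Suc k), j := ones (2 * Suc k)))"
      by (rule exec_conseq, (rule exec_basic)+) (use assms in \<open>auto simp: fun_eq_iff l\<close>)
  qed (use assms in \<open>simp add: l\<close>)
qed (use assms in \<open>auto simp: fun_eq_iff\<close>)

fun bits_val :: "nat \<Rightarrow> bool list \<Rightarrow> nat" where
  "bits_val r [] = r"
| "bits_val r (b # bs) = bits_val (2 * r + of_bool b) bs"

lemma bits_val_append: "bits_val r (bs @ [b]) = 2 * bits_val r bs + of_bool b"
  by (induction bs arbitrary: r) auto

lemma bits_val_ge: "r \<le> bits_val r bs"
proof (induction bs arbitrary: r)
  case (Cons b bs)
  show ?case using Cons[of "2 * r + of_bool b"] by simp
qed simp

lemma bits_val_bin: "bits_val 0 (bin n) = n"
proof (induction n rule: bin.induct)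
  case (1 n)
  then show ?case
    by (subst bin.simps) (auto simp: bits_val_append)
qed

text \<open>The marker 1 in front of each digit makes the code self-delimiting: the first 0 in
  marker position ends it, and the rest of the stack is the word. The value is accumulated in unary,
  ready to serve as a clock.\<close>

definition decode :: com where
  "decode = While 0 is_one
     (Pop 0 ;; double 1 2 ;; move 2 1 ;; Cond 0 is_one (Push 1 True) Skip ;; Pop 0) ;; Pop 0"

lemma exec_decode_loop:
  assumes "s 0 = concat (map (\<lambda>b. [True, b]) bs) @ False # w" "s 1 = ones r" "s 2 = []"
  shows "exec (While 0 is_one
     (Pop 0 ;; double 1 2 ;; move 2 1 ;; Cond 0 is_one (Push 1 True) Skip ;; Pop 0)) s
     (length bs * (30 * bits_val r bs + 30) + 1) (s(0 := False # w, 1 := ones (bits_val r bs)))"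
  using assms
proof (induction bs arbitrary: s r)
  case Nil
  then show ?case
    by - (rule exec_conseq[OF exec_WhileF], auto simp: fun_eq_iff)
next
  case (Cons b bs)
  let ?r = "2 * r + of_bool b"
  let ?s = "s(0 := concat (map (\<lambda>b. [True, b]) bs) @ False # w, 1 := ones ?r)"
  have "exec (Pop 0 ;; double 1 2 ;; move 2 1 ;; Cond 0 is_one (Push 1 True) Skip ;; Pop 0) s
     (21 * r + 20) ?s"
  proof (cases b)
    case True
    show ?thesis
      by (rule exec_conseq, (rule exec_basic | (rule exec_CondT, (simp add: Cons.prems True; fail))
        | (rule exec_double[where a = r] exec_move, (simp add: Cons.prems; fail)+))+)
       (use Cons.prems True in \<open>auto simp: fun_eq_iff\<close>)
  next
    case False
    show ?thesis
      by (rule exec_conseq, (rule exec_basic | (rule exec_CondF, (simp add: Cons.prems False; fail))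
        | (rule exec_double[where a = r] exec_move, (simp add: Cons.prems; fail)+))+)
       (use Cons.prems False in \<open>auto simp: fun_eq_iff\<close>)
  qed
  moreover have "exec (While 0 is_one
      (Pop 0 ;; double 1 2 ;; move 2 1 ;; Cond 0 is_one (Push 1 True) Skip ;; Pop 0)) ?s
      (length bs * (30 * bits_val ?r bs + 30) + 1)
      (?s(0 := False # w, 1 := ones (bits_val ?r bs)))"
    using Cons.prems by (intro Cons.IH) auto
  \<comment> \<open>The accumulator never decreases, so the cost of this round is bounded in terms
    of the final value.\<close>
  moreover have "r \<le> bits_val ?r bs"
    using bits_val_ge[of ?r bs] by simp
  ultimately show ?case
    using Cons.prems by - (rule exec_conseq[OF exec_WhileT], auto simp: fun_eq_iff algebra_simps)
qed

lemma length_bin_le: "length (bin n) \<le> n"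
proof (induction n rule: bin.induct)
  case (1 n)
  then show ?case by (subst bin.simps) auto
qed

lemma exec_decode:
  "exec decode (input_store (overline_nat n @ False # w)) (30 * n * n + 30 * n + 2)
     ((input_store w)(1 := ones n))"
proof -
  have le: "length (bin n) * (30 * n + 30) \<le> n * (30 * n + 30)"
    by (intro mult_right_mono length_bin_le) simp
  have 1: "exec (While 0 is_one
     (Pop 0 ;; double 1 2 ;; move 2 1 ;; Cond 0 is_one (Push 1 True) Skip ;; Pop 0))
     (input_store (overline_nat n @ False # w)) (length (bin n) * (30 * n + 30) + 1)
     ((input_store (overline_nat n @ False # w))(0 := False # w, 1 := ones n))"
    using exec_decode_loop[of "input_store (overline_nat n @ False # w)" "bin n" w 0]
    by (simp add: input_store_def overline_nat_def bits_val_bin)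
  show ?thesis
    unfolding decode_def using le
    by - (rule exec_conseq[OF exec_Seq[OF 1 exec_Pop]],
      auto simp: fun_eq_iff input_store_def algebra_simps)
qed

section \<open>Polynomial values in unary\<close>

fun push_all :: "nat \<Rightarrow> bool list \<Rightarrow> com" where
  "push_all i [] = Skip"
| "push_all i (b # bs) = Push i b ;; push_all i bs"

lemma exec_push_all: "exec (push_all i bs) s (2 * length bs) (s(i := rev bs @ s i))"
proof (induction bs arbitrary: s)
  case Nil
  then show ?case by (auto intro: exec_conseq[OF exec_Skip])
next
  case (Cons b bs)
  have "exec (push_all i (b # bs)) s (2 + 2 * length bs)
      ((s(i := b # s i))(i := rev bs @ (s(i := b # s i)) i))"
    unfolding push_all.simps by (rule exec_Seq[OF exec_Push Cons])
  then show ?case by (rule exec_conseq) auto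
qed

text \<open>Horner's rule in unary: the argument is read from register 1, the value is left in register 5.\<close>

fun horner :: "nat list \<Rightarrow> com" where
  "horner [] = Skip"
| "horner (a # as) =
     horner as ;;
     While 5 filled (Pop 5 ;; While 1 filled (Pop 1 ;; Push 6 True ;; Push 7 True) ;; move 6 1) ;;
     move 7 5 ;; push_all 5 (ones a)"

fun horner_val :: "nat list \<Rightarrow> nat \<Rightarrow> nat" where
  "horner_val [] n = 0"
| "horner_val (a # as) n = a + n * horner_val as n"

fun horner_time :: "nat list \<Rightarrow> nat \<Rightarrow> nat" where
  "horner_time [] n = 0"
| "horner_time (a # as) n =
     horner_time as n + horner_val as n * (14 * n + 5) + 7 * (n * horner_val as n) + 2 * a + 2"

lemma exec_copy_ones:
  assumes "s 1 = ones n" "s 6 = []" "s 7 = ones b"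
  shows "exec (While 1 filled (Pop 1 ;; Push 6 True ;; Push 7 True)) s (7 * n + 1)
    (s(1 := [], 6 := ones n, 7 := ones (b + n)))"
proof (rule exec_loop'[where n = n and T = 5 and
      S = "\<lambda>k. s(1 := ones (n - k), 6 := ones k, 7 := ones (b + k))"], goal_cases)
  case (1 k)
  then obtain l where l: "n - k = Suc l" "n - Suc k = l"
    by (metis Suc_diff_Suc)
  show ?case
  proof
    show "exec (Pop 1 ;; Push 6 True ;; Push 7 True)
       (s(1 := ones (n - k), 6 := ones k, 7 := ones (b + k))) 5
       (s(1 := ones (n - Suc k), 6 := ones (Suc k), 7 := ones (b + Suc k)))"
      by (rule exec_conseq, (rule exec_basic)+) (auto simp: fun_eq_iff l)
  qed (simp add: l)
qed (use assms in \<open>auto simp: fun_eq_iff\<close>)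

lemma exec_multiply:
  assumes "s 1 = ones n" "s 5 = ones a" "s 6 = []" "s 7 = []"
  shows "exec (While 5 filled (Pop 5 ;; While 1 filled (Pop 1 ;; Push 6 True ;; Push 7 True) ;; move 6 1)) s
    (a * (14 * n + 5) + 1) (s(5 := [], 7 := ones (n * a)))"
proof (rule exec_loop'[where n = a and T = "14 * n + 3" and
      S = "\<lambda>k. s(5 := ones (a - k), 7 := ones (n * k))"], goal_cases)
  case (1 k)
  then obtain l where l: "a - k = Suc l" "a - Suc k = l"
    by (metis Suc_diff_Suc)
  show ?case
  proof
    show "exec (Pop 5 ;; While 1 filled (Pop 1 ;; Push 6 True ;; Push 7 True) ;; move 6 1)
       (s(5 := ones (a - k), 7 := ones (n * k))) (14 * n + 3)
       (s(5 := ones (a - Suc k), 7 := ones (n * Suc k)))"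
      by (rule exec_conseq, (rule exec_basic
          | (rule exec_copy_ones[where n = n and b = "n * k"] exec_move, (simp add: assms; fail)+))+)
        (use assms in \<open>auto simp: fun_eq_iff l add.commute\<close>)
  qed (simp add: l)
qed (use assms in \<open>auto simp: fun_eq_iff\<close>)

lemma exec_horner:
  assumes "s 1 = ones n" "s 5 = []" "s 6 = []" "s 7 = []"
  shows "exec (horner cs) s (horner_time cs n) (s(5 := ones (horner_val cs n)))"
proof (induction cs)
  case Nil
  then show ?case using assms by (auto intro!: exec_conseq[OF exec_Skip] simp: fun_eq_iff)
next
  case (Cons a as)
  show ?case
    unfolding horner.simps
    by (rule exec_conseq, rule exec_Seq[OF Cons], (rule exec_basic exec_push_all
      | (rule exec_multiply[where n = n and a = "horner_val as n"] exec_move, (simp add: assms; fail)+))+)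
      (use assms in \<open>auto simp: fun_eq_iff replicate_add[symmetric] simp del: replicate_add\<close>)
qed

section \<open>Encoding a number, and assembling the image of an instance\<close>

definition halve :: com where
  "halve = While 1 filled (Pop 1 ;; Cond 1 filled (Pop 1 ;; Push 6 True) (Push 7 True))"

lemma exec_halve:
  assumes "s 1 = ones n" "s 6 = ones b" "s 7 = []"
  shows "exec halve s (8 * n + 1) (s(1 := [], 6 := ones (b + n div 2), 7 := ones (n mod 2)))"
  using assms
proof (induction n arbitrary: s b rule: less_induct)
  case (less n)
  let ?c = "Pop 1 ;; Cond 1 filled (Pop 1 ;; Push 6 True) (Push 7 True)"
  consider "n = 0" | "n = 1" | k where "n = Suc (Suc k)"
    by (metis One_nat_def not0_implies_Suc)
  then show ?case
  proof cases
    case 1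
    then show ?thesis
      unfolding halve_def using less.prems
      by - (rule exec_conseq[OF exec_WhileF], auto simp: fun_eq_iff)
  next
    case 2
    have step: "exec ?c s 4 (s(1 := [], 7 := [True]))"
      by (rule exec_conseq, (rule exec_basic | (rule exec_CondF, (simp add: less.prems 2; fail)))+)
        (use less.prems 2 in \<open>auto simp: fun_eq_iff\<close>)
    show ?thesis
      unfolding halve_def
      by (rule exec_conseq[OF exec_WhileT[OF _ step exec_WhileF]])
        (use less.prems 2 in \<open>auto simp: fun_eq_iff\<close>)
  next
    case 3
    let ?s = "s(1 := ones k, 6 := ones (Suc b))"
    have 1: "exec ?c s 6 ?s"
      by (rule exec_conseq, (rule exec_basic | (rule exec_CondT, (simp add: less.prems 3; fail)))+)
        (use less.prems 3 in \<open>auto simp: fun_eq_iff\<close>)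
    have 2: "exec (While 1 filled ?c) ?s (8 * k + 1)
       (?s(1 := [], 6 := ones (Suc b + k div 2), 7 := ones (k mod 2)))"
      unfolding halve_def[symmetric] by (rule less.IH) (use less.prems 3 in auto)
    show ?thesis
      unfolding halve_def
      by (rule exec_conseq[OF exec_WhileT[OF _ 1 2]]) (use less.prems 3 in \<open>auto simp: fun_eq_iff\<close>)
  qed
qed

text \<open>The digits are produced from the least significant one upwards; pushing them on a stack
  leaves the most significant one on top, with each marker above its digit.\<close>

definition encode :: com where
  "encode = While 1 filled
     (halve ;; Cond 7 filled (Pop 7 ;; Push 0 True) (Push 0 False) ;; Push 0 True ;; move 6 1)"

lemma overline_nat_0: "overline_nat 0 = []"
  by (simp add: overline_nat_def bin.simps)

lemma overline_nat_rec: "0 < n \<Longrightarrow> overline_nat n = overline_nat (n div 2) @ [True, odd n]"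
  by (subst overline_nat_def, subst bin.simps) (simp add: overline_nat_def)

lemma exec_encode:
  assumes "s 1 = ones n" "s 6 = []" "s 7 = []"
  shows "exec encode s (70 * n + 1) (s(1 := [], 0 := overline_nat n @ s 0))"
  using assms
proof (induction n arbitrary: s rule: less_induct)
  case (less n)
  let ?c = "halve ;; Cond 7 filled (Pop 7 ;; Push 0 True) (Push 0 False) ;; Push 0 True ;; move 6 1"
  show ?case
  proof (cases "n = 0")
    case True
    then show ?thesis
      unfolding encode_def using less.prems
      by - (rule exec_conseq[OF exec_WhileF], auto simp: fun_eq_iff overline_nat_0)
  next
    case False
    let ?s = "s(1 := ones (n div 2), 0 := True # odd n # s 0)"
    have 1: "exec ?c s (15 * n + 15) ?s"
    proof (cases "odd n")
      case True
      then have "n mod 2 = 1" by presburger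
      show ?thesis
        by (rule exec_conseq, (rule exec_basic
            | (rule exec_CondT, (simp add: less.prems \<open>n mod 2 = 1\<close>; fail))
            | (rule exec_halve[where n = n and b = 0] exec_move, (simp add: less.prems; fail)+))+)
          (use less.prems \<open>n mod 2 = 1\<close> True in \<open>auto simp: fun_eq_iff\<close>)
    next
      case False
      then have "n mod 2 = 0" by presburger
      show ?thesis
        by (rule exec_conseq, (rule exec_basic
            | (rule exec_CondF, (simp add: less.prems \<open>n mod 2 = 0\<close>; fail))
            | (rule exec_halve[where n = n and b = 0] exec_move, (simp add: less.prems; fail)+))+)
          (use less.prems \<open>n mod 2 = 0\<close> False in \<open>auto simp: fun_eq_iff\<close>)
    qed
    \<comment> \<open>Halving makes the total cost linear: for \<open>n >= 1\<close>, the
      \<open>15 * n + 17\<close> of this round and \<open>35 * n\<close> for the remaining rounds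
      add up to at most \<open>70 * n\<close>.\<close>
    have 2: "exec (While 1 filled ?c) ?s (70 * (n div 2) + 1)
        (?s(1 := [], 0 := overline_nat (n div 2) @ ?s 0))"
      unfolding encode_def[symmetric] by (rule less.IH) (use less.prems False in auto)
    show ?thesis
      unfolding encode_def
      by (rule exec_conseq[OF exec_WhileT[OF _ 1 2]])
        (use less.prems False in \<open>auto simp: fun_eq_iff overline_nat_rec[of n]\<close>)
  qed
qed

text \<open>The padding is what remains of the unary target size after one unit has been spent for
  each symbol of the stack to be padded.\<close>

definition pad_out :: com where
  "pad_out = While 0 filled (copy_bit 0 6 ;; Pop 5 ;; Pop 0) ;; move 6 0 ;; move 5 0"

lemma exec_pad_out_loop:
  assumes "s 0 = v" "s 5 = ones N"
  shows "exec (While 0 filled (copy_bit 0 6 ;; Pop 5 ;; Pop 0)) s (8 * length v + 1)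
    (s(0 := [], 5 := ones (N - length v), 6 := rev v @ s 6))"
  using assms
proof (induction v arbitrary: s N)
  case Nil
  then show ?case
    by - (rule exec_conseq[OF exec_WhileF], auto simp: fun_eq_iff)
next
  case (Cons b v)
  let ?s = "s(6 := b # s 6, 5 := ones (N - 1), 0 := v)"
  have "exec (copy_bit 0 6 ;; Pop 5 ;; Pop 0) s 6 ?s"
    by (rule exec_conseq,
        (rule exec_basic | (rule exec_copy_bit[of _ _ b v], (simp add: Cons.prems; fail)))+)
      (use Cons.prems in \<open>auto simp: fun_eq_iff\<close>)
  moreover have "exec (While 0 filled (copy_bit 0 6 ;; Pop 5 ;; Pop 0)) ?s (8 * length v + 1)
      (?s(0 := [], 5 := ones (N - 1 - length v), 6 := rev v @ ?s 6))"
    by (rule Cons.IH) auto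
  ultimately show ?case
    using Cons.prems by - (rule exec_conseq[OF exec_WhileT], auto simp: fun_eq_iff)
qed

lemma exec_pad_out:
  assumes "s 0 = v" "s 5 = ones N" "s 6 = []"
  shows "exec pad_out s (15 * length v + 7 * N + 3) (s(0 := ones (N - length v) @ v, 5 := []))"
  unfolding pad_out_def
  by (rule exec_conseq, (rule exec_basic
      | (rule exec_pad_out_loop[where v = v and N = N] exec_move, (simp add: assms; fail)+))+)
    (use assms in \<open>auto simp: fun_eq_iff\<close>)

text \<open>The target size is computed before the case distinction because strings of ones also
  need it: they are sent to strings of ones of that size, which keeps the map
  size-invariant.\<close>

definition reduction_prog :: "nat list \<Rightarrow> bool list \<Rightarrow> com" where
  "reduction_prog cs C =
     split ;; clear 4 ;; horner cs ;;
     Cond 2 filled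
       (Pop 2 ;; Push 0 False ;; encode ;; push_all 0 (rev (False # C @ [False])) ;; pad_out)
       (clear 1 ;; move 5 0)"

definition reduction_tail :: "bool list \<Rightarrow> nat \<Rightarrow> bool list \<Rightarrow> bool list" where
  "reduction_tail C n w = C @ False # overline_nat n @ False # w"

lemma length_overline_nat: "length (overline_nat n) = 2 * length (bin n)"
  by (simp add: overline_nat_def length_concat comp_def sum_list_triv)

lemma exec_reduction_prog:
  assumes "x = ones m @ False # w"
  shows "exec (reduction_prog cs C) (input_store x)
    (200 * length x + horner_time cs (length x) + 17 * length C + 7 * horner_val cs (length x) + 200)
    (input_store (ones (horner_val cs (length x) - Suc (length (reduction_tail C (length x) w))) @
       False # reduction_tail C (length x) w))"
proof -
  have x: "length x = Suc (m + length w)" using assms by simp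
  have *: "length (overline_nat (Suc (m + length w))) \<le> 2 * Suc (m + length w)"
    by (metis length_bin_le length_overline_nat mult_le_mono2)
  show ?thesis
    unfolding reduction_prog_def x
    by (rule exec_conseq, (rule exec_basic exec_clear exec_push_all | (rule exec_CondT, (simp; fail))
      | (rule exec_split[where m = m and w = w] exec_horner[where n = "Suc (m + length w)"]
          exec_encode[where n = "Suc (m + length w)"], (simp add: assms input_store_def; fail)+)
      | (rule exec_pad_out[OF refl, where N = "horner_val cs (Suc (m + length w))"],
          (simp add: assms input_store_def; fail)+))+)
     (use assms * in \<open>auto simp: fun_eq_iff input_store_def reduction_tail_def\<close>)
qed

lemma exec_reduction_prog_all_ones:
  "exec (reduction_prog cs C) (input_store (ones m))
    (200 * m + horner_time cs m + 17 * length C + 7 * horner_val cs m + 200)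
    (input_store (ones (horner_val cs m)))"
  unfolding reduction_prog_def
  by (rule exec_conseq, (rule exec_basic exec_clear exec_move[of 5 0, simplified]
      | (rule exec_CondF, (simp add: input_store_def; fail))
      | (rule exec_split_all_ones[where m = m] exec_horner[where n = m],
          (simp add: input_store_def; fail)+))+)
    (auto simp: fun_eq_iff input_store_def)

section \<open>Programs for the cumulative distributions\<close>

text \<open>
  Long division: the first \<open>k\<close> binary digits of \<open>(r + 0.w)/n\<close>, where \<open>r < n\<close> is the current
  remainder and the digits of \<open>w\<close> are appended to it one by one.
\<close>

fun quotient_bits :: "nat \<Rightarrow> nat \<Rightarrow> bool list \<Rightarrow> nat \<Rightarrow> bool list" where
  "quotient_bits n r w 0 = []"
| "quotient_bits n r w (Suc k) =
     (let r' = 2 * r + of_bool (is_one (top_sym w)) in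
      if r' < n then False # quotient_bits n r' (tl w) k else True # quotient_bits n (r' - n) (tl w) k)"

lemma length_quotient_bits [simp]: "length (quotient_bits n r w k) = k"
  by (induction k arbitrary: r w) (auto simp: Let_def)

text \<open>Prepares both outcomes of a comparison in one pass. Register 9 is nonempty iff
  \<open>r < n\<close>; then register 4 holds \<open>r\<close> again, and otherwise register 7 holds
  \<open>r - n\<close>. Register 8 saves \<open>n\<close>.\<close>

definition compare_prog :: com where
  "compare_prog = While 1 filled (Pop 1 ;; Push 8 True ;; Cond 7 filled (Pop 7 ;; Push 4 True) (Push 9 True))"

lemma exec_compare_prog:
  assumes "s 1 = ones n" "s 4 = []" "s 7 = ones r" "s 8 = []" "s 9 = []"
  shows "exec compare_prog s (10 * n + 1)
    (s(1 := [], 4 := ones (min r n), 7 := ones (r - n), 8 := ones n, 9 := ones (n - r)))"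
  unfolding compare_prog_def
proof (rule exec_loop'[where n = n and T = 8 and
      S = "\<lambda>k. s(1 := ones (n - k), 4 := ones (min r k), 7 := ones (r - k), 8 := ones k, 9 := ones (k - r))"],
    goal_cases)
  case (1 k)
  then obtain l where l: "n - k = Suc l" "n - Suc k = l"
    by (metis Suc_diff_Suc)
  show ?case
  proof
    let ?s = "s(1 := ones (n - k), 4 := ones (min r k), 7 := ones (r - k), 8 := ones k, 9 := ones (k - r))"
    let ?s' = "s(1 := ones (n - Suc k), 4 := ones (min r (Suc k)), 7 := ones (r - Suc k),
        8 := ones (Suc k), 9 := ones (Suc k - r))"
    show "exec (Pop 1 ;; Push 8 True ;; Cond 7 filled (Pop 7 ;; Push 4 True) (Push 9 True)) ?s 8 ?s'"
    proof (cases "k < r")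
      case True
      then obtain d where d: "r = Suc (k + d)"
        using less_imp_Suc_add by blast
      show ?thesis
        by (rule exec_conseq, (rule exec_basic | (rule exec_CondT, (simp add: d; fail)))+)
          (use d in \<open>auto simp: fun_eq_iff l min_def\<close>)
    next
      case False
      then obtain d where d: "k = r + d"
        using le_Suc_ex linorder_not_less by blast
      show ?thesis
        by (rule exec_conseq, (rule exec_basic | (rule exec_CondF, (simp add: d; fail)))+)
          (use d in \<open>auto simp: fun_eq_iff l min_def Suc_diff_le\<close>)
    qed
  qed (simp add: l)
qed (use assms in \<open>auto simp: fun_eq_iff\<close>)

inductive_cases run_SeqE: "run (c ;; d) s t s'"

text \<open>Lets the first two commands of a division step be verified as a block, so that the case
  distinction on the appended digit does not spread to the rest.\<close>

lemma exec_assoc: "exec ((c ;; d) ;; e) s T s' \<Longrightarrow> exec (c ;; d ;; e) s T s'"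
proof -
  assume "exec ((c ;; d) ;; e) s T s'"
  then obtain t where t: "t \<le> T" "run ((c ;; d) ;; e) s t s'"
    unfolding exec_def by blast
  from t(2) obtain t1 u s1 where 1: "run (c ;; d) s t1 s1" "run e s1 u s'" "t = t1 + u"
    by (rule run_SeqE)
  from 1(1) obtain t2 u2 s2 where "run c s t2 s2" "run d s2 u2 s1" "t1 = t2 + u2"
    by (rule run_SeqE)
  then have "run (c ;; d ;; e) s (t2 + (u2 + u)) s'"
    using 1(2) by (intro run.Seq)
  then show ?thesis
    unfolding exec_def using t(1) 1(3) \<open>t1 = t2 + u2\<close> by (metis add.assoc)
qed

definition division_step :: com where
  "division_step =
     double 4 7 ;; Cond 0 is_one (Push 7 True) Skip ;; Pop 0 ;; compare_prog ;;
     Cond 9 filled (clear 9 ;; Push 6 False) (Push 6 True ;; clear 4 ;; move 7 4) ;; move 8 1"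

lemma exec_division_step:
  assumes "s 0 = w" "s 1 = ones n" "s 4 = ones r" "s 7 = []" "s 8 = []" "s 9 = []" "r < n"
    and r': "r' = 2 * r + of_bool (is_one (top_sym w))"
  shows "exec division_step s (60 * n + 60)
    (if r' < n then s(0 := tl w, 4 := ones r', 6 := False # s 6)
     else s(0 := tl w, 4 := ones (r' - n), 6 := True # s 6))"
proof -
  have 1: "exec (double 4 7 ;; Cond 0 is_one (Push 7 True) Skip) s (7 * r + 5)
     (s(4 := [], 7 := ones r'))"
  proof (cases "is_one (top_sym w)")
    case True
    then have "r' = 2 * r + 1" using r' by simp
    show ?thesis
      unfolding \<open>r' = 2 * r + 1\<close>
      by (rule exec_conseq, (rule exec_basic | (rule exec_double[where a = r], (simp add: assms; fail)+)
          | (rule exec_CondT, (simp add: assms True; fail)))+) (auto simp: fun_eq_iff)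
  next
    case False
    then have "r' = 2 * r" using r' by simp
    show ?thesis
      unfolding \<open>r' = 2 * r\<close>
      by (rule exec_conseq, (rule exec_basic | (rule exec_double[where a = r], (simp add: assms; fail)+)
          | (rule exec_CondF, (simp add: assms False; fail)))+) (auto simp: fun_eq_iff)
  qed
  have "r' < 2 * n" using r' \<open>r < n\<close> by (auto simp: of_bool_def)
  let ?s = "s(4 := [], 7 := ones r')"
  have 2: "exec (Pop 0 ;; compare_prog ;;
     Cond 9 filled (clear 9 ;; Push 6 False) (Push 6 True ;; clear 4 ;; move 7 4) ;; move 8 1) ?s
     (50 * n + 50)
     (if r' < n then s(0 := tl w, 4 := ones r', 6 := False # s 6)
      else s(0 := tl w, 4 := ones (r' - n), 6 := True # s 6))"
  proof (cases "r' < n")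
    case True
    show ?thesis
      by (rule exec_conseq, (rule exec_basic exec_clear
          | (rule exec_compare_prog[where n = n and r = r'] exec_move, (simp add: assms; fail)+)
          | (rule exec_CondT, (simp add: True not_le; fail)))+)
        (use assms True in \<open>auto simp: fun_eq_iff\<close>)
  next
    case False
    show ?thesis
      by (rule exec_conseq, (rule exec_basic exec_clear
          | (rule exec_compare_prog[where n = n and r = r'] exec_move, (simp add: assms; fail)+)
          | (rule exec_CondF, (simp add: leI[OF False]; fail)))+)
        (use assms False \<open>r' < 2 * n\<close> in \<open>auto simp: fun_eq_iff\<close>)
  qed
  show ?thesis
    unfolding division_step_def using \<open>r < n\<close>
    by - (rule exec_conseq[OF exec_assoc[OF exec_Seq[OF 1 2]]], auto)
qed


text \<open>The cumulative value at a nonempty string of ones is 1, which no finite binary fraction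
  attains; the answer 1^k misses it by exactly 2^-k. At the empty string the value is 0, given by
  the empty answer.\<close>

definition division_prog :: com where
  "division_prog =
     Cond 2 filled
       (Pop 2 ;; While 5 filled (Pop 5 ;; division_step) ;; clear 0 ;; clear 1 ;; clear 4 ;; move 6 0)
       (clear 4 ;; Cond 1 filled (clear 1 ;; move 5 0) (clear 5))"

text \<open>The unread digits and the final remainder are not tracked exactly: they are erased
  afterwards, and their sizes only matter for the cost of that.\<close>

lemma exec_division_loop:
  assumes "s 0 = w" "s 1 = ones n" "s 4 = ones r" "s 5 = ones k" "s 7 = []" "s 8 = []" "s 9 = []" "r < n"
  shows "\<exists>v r'. r' < n \<and> length v \<le> length w \<and>
    exec (While 5 filled (Pop 5 ;; division_step)) s (k * (60 * n + 63) + 1)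
      (s(0 := v, 4 := ones r', 5 := [], 6 := rev (quotient_bits n r w k) @ s 6))"
  using assms
proof (induction k arbitrary: s w r)
  case 0
  then show ?case
    by (intro exI[of _ w] exI[of _ r] conjI exec_conseq[OF exec_WhileF]) (auto simp: fun_eq_iff)
next
  case (Suc k)
  define r' where r': "r' = 2 * r + of_bool (is_one (top_sym w))"
  define b where "b \<longleftrightarrow> \<not> r' < n"
  define r'' where "r'' = (if b then r' - n else r')"
  \<comment> \<open>Appending a digit to a remainder below \<open>n\<close> gives at most
    \<open>2 * n - 1\<close>, so one subtraction restores the invariant.\<close>
  have "r' < 2 * n" using r' Suc.prems(8) by (auto simp: of_bool_def)
  then have "r'' < n" by (auto simp: r''_def b_def)
  let ?s = "s(5 := ones k, 0 := tl w, 4 := ones r'', 6 := b # s 6)"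
  have step: "exec division_step (s(5 := ones k)) (60 * n + 60) ?s"
    by (rule exec_conseq[OF exec_division_step[OF _ _ _ _ _ _ Suc.prems(8) r']])
      (use Suc.prems in \<open>auto simp: r''_def b_def fun_eq_iff\<close>)
  have eq: "s(5 := tl (s 5)) = s(5 := ones k)"
    using Suc.prems by simp
  have 1: "exec (Pop 5 ;; division_step) s (1 + (60 * n + 60)) ?s"
    by (rule exec_Seq[OF exec_Pop[of 5 s, unfolded eq] step])
  have div: "quotient_bits n r w (Suc k) = b # quotient_bits n r'' (tl w) k"
    by (simp add: Let_def r'[symmetric] b_def r''_def)
  have "\<exists>v r3. r3 < n \<and> length v \<le> length (tl w) \<and>
     exec (While 5 filled (Pop 5 ;; division_step)) ?s (k * (60 * n + 63) + 1)
      (?s(0 := v, 4 := ones r3, 5 := [], 6 := rev (quotient_bits n r'' (tl w) k) @ ?s 6))"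
    by (rule Suc.IH) (use Suc.prems \<open>r'' < n\<close> in auto)
  then obtain v r3 where v: "r3 < n" "length v \<le> length (tl w)"
     "exec (While 5 filled (Pop 5 ;; division_step)) ?s (k * (60 * n + 63) + 1)
      (?s(0 := v, 4 := ones r3, 5 := [], 6 := rev (quotient_bits n r'' (tl w) k) @ ?s 6))"
    by blast
  have "exec (While 5 filled (Pop 5 ;; division_step)) s (Suc k * (60 * n + 63) + 1)
      (s(0 := v, 4 := ones r3, 5 := [], 6 := rev (quotient_bits n r w (Suc k)) @ s 6))"
    by (rule exec_conseq[OF exec_WhileT[OF _ 1 v(3)]])
      (use Suc.prems div in \<open>auto simp: fun_eq_iff\<close>)
  moreover have "length v \<le> length w"
    using v(2) by simp
  ultimately show ?case
    using v(1) by blast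
qed

lemma exec_division_prog:
  assumes "s = (input_store w)(1 := ones (Suc (m + length w)), 2 := [True], 4 := ones m, 5 := ones k)"
    and n: "n = Suc (m + length w)"
  shows "exec division_prog s (k * (60 * n + 100) + 100 * n + 100)
    (input_store (quotient_bits n m w k))"
proof -
  obtain v r' where v: "r' < n" "length v \<le> length w"
    "exec (While 5 filled (Pop 5 ;; division_step)) (s(2 := [])) (k * (60 * n + 63) + 1)
      ((s(2 := []))(0 := v, 4 := ones r', 5 := [], 6 := rev (quotient_bits n m w k) @ (s(2 := [])) 6))"
    using exec_division_loop[of "s(2 := [])" w n m k] assms by (auto simp: input_store_def)
  have eq: "s(2 := tl (s 2)) = s(2 := [])"
    by (simp add: assms)
  have 1: "exec (Pop 2) s 1 (s(2 := []))"
    using exec_Pop[of 2 s] unfolding eq .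
  show ?thesis
    unfolding division_prog_def
    by (rule exec_conseq, (rule exec_Seq exec_clear 1 v(3)
          | (rule exec_CondT, (simp add: assms; fail))
          | (rule exec_move, (simp; fail)))+)
      (use v assms in \<open>auto simp: fun_eq_iff input_store_def algebra_simps\<close>)
qed

lemma exec_division_prog_all_ones:
  assumes "s = (input_store [])(1 := ones n, 4 := ones n, 5 := ones k)"
  shows "exec division_prog s (k * (60 * n + 100) + 100 * n + 100)
    (input_store (if n = 0 then [] else ones k))"
proof (cases "n = 0")
  case True
  show ?thesis
    unfolding division_prog_def
    by (rule exec_conseq, (rule exec_basic exec_clear
        | (rule exec_CondF, (simp add: assms input_store_def True; fail)))+)
      (use assms True in \<open>auto simp: fun_eq_iff input_store_def\<close>)
next
  case False
  show ?thesis
    unfolding division_prog_def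
    by (rule exec_conseq, (rule exec_basic exec_clear
        | (rule exec_CondF, (simp add: assms input_store_def; fail))
        | (rule exec_CondT, (simp add: assms input_store_def False; fail))
        | (rule exec_move, (simp; fail)))+)
      (use assms False in \<open>auto simp: fun_eq_iff input_store_def algebra_simps\<close>)
qed

section \<open>Reading the pair of a precision and a string; parity of the size\<close>

definition input_prog :: com where
  "input_prog = While 0 is_one (Pop 0 ;; Push 5 True) ;; Pop 0 ;; split"

lemma exec_input_loop:
  assumes "s 0 = ones k @ w" "s 5 = []" "\<not> is_one (top_sym w)"
  shows "exec (While 0 is_one (Pop 0 ;; Push 5 True)) s (5 * k + 1) (s(0 := w, 5 := ones k))"
proof (rule exec_loop'[where n = k and T = 3 and S = "\<lambda>j. s(0 := ones (k - j) @ w, 5 := ones j)"],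
    goal_cases)
  case (1 j)
  then obtain l where l: "k - j = Suc l" "k - Suc j = l"
    by (metis Suc_diff_Suc)
  show ?case
  proof
    show "exec (Pop 0 ;; Push 5 True) (s(0 := ones (k - j) @ w, 5 := ones j)) 3
       (s(0 := ones (k - Suc j) @ w, 5 := ones (Suc j)))"
      by (rule exec_conseq, (rule exec_basic)+) (auto simp: fun_eq_iff l)
  qed (simp add: l)
next
  case 2
  show ?case using assms(3) by simp
qed (use assms in \<open>auto simp: fun_eq_iff\<close>)

lemma exec_input_prog:
  assumes "v = [] \<and> x = [] \<or> v = False # x" "x = ones m @ False # w"
  shows "exec input_prog (input_store (ones k @ v)) (5 * k + 20 * length x + 30)
    ((input_store w)(1 := ones (Suc (m + length w)), 2 := [True], 4 := ones m, 5 := ones k))"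
proof -
  have v: "\<not> is_one (top_sym v)" "tl v = x"
    using assms by auto
  show ?thesis
    unfolding input_prog_def
    by (rule exec_conseq, (rule exec_basic
        | (rule exec_input_loop[where k = k and w = v], (simp add: input_store_def v; fail)+)
        | (rule exec_split[where m = m and w = w], (simp add: input_store_def v assms(2); fail)+))+)
      (use v assms(2) in \<open>auto simp: fun_eq_iff input_store_def\<close>)
qed

lemma exec_input_prog_all_ones:
  assumes "v = [] \<and> n = 0 \<or> v = False # ones n"
  shows "exec input_prog (input_store (ones k @ v)) (5 * k + 20 * n + 30)
    ((input_store [])(1 := ones n, 4 := ones n, 5 := ones k))"
proof -
  have v: "\<not> is_one (top_sym v)" "tl v = ones n"
    using assms by auto
  show ?thesis
    unfolding input_prog_def
    by (rule exec_conseq, (rule exec_basic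
        | (rule exec_input_loop[where k = k and w = v], (simp add: input_store_def v; fail)+)
        | (rule exec_split_all_ones[where m = n], (simp add: input_store_def v; fail)+))+)
      (use v in \<open>auto simp: fun_eq_iff input_store_def\<close>)
qed

definition parity_prog :: com where
  "parity_prog = While 1 filled
     (Pop 1 ;; Push 7 True ;; Cond 1 filled (Pop 1 ;; Push 7 True) (Push 8 True)) ;; move 7 1"

lemma exec_parity_loop:
  assumes "s 1 = ones n" "s 7 = ones b" "s 8 = []"
  shows "exec (While 1 filled
     (Pop 1 ;; Push 7 True ;; Cond 1 filled (Pop 1 ;; Push 7 True) (Push 8 True))) s (10 * n + 1)
     (s(1 := [], 7 := ones (b + n), 8 := ones (n mod 2)))"
  using assms
proof (induction n arbitrary: s b rule: less_induct)
  case (less n)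
  let ?c = "Pop 1 ;; Push 7 True ;; Cond 1 filled (Pop 1 ;; Push 7 True) (Push 8 True)"
  consider "n = 0" | "n = 1" | k where "n = Suc (Suc k)"
    by (metis One_nat_def not0_implies_Suc)
  then show ?case
  proof cases
    case 1
    then show ?thesis
      using less.prems by - (rule exec_conseq[OF exec_WhileF], auto simp: fun_eq_iff)
  next
    case 2
    have step: "exec ?c s 6 (s(1 := [], 7 := ones (Suc b), 8 := [True]))"
      by (rule exec_conseq, (rule exec_basic | (rule exec_CondF, (simp add: less.prems 2; fail)))+)
        (use less.prems 2 in \<open>auto simp: fun_eq_iff\<close>)
    show ?thesis
      by (rule exec_conseq[OF exec_WhileT[OF _ step exec_WhileF]])
        (use less.prems 2 in \<open>auto simp: fun_eq_iff\<close>)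
  next
    case 3
    let ?s = "s(1 := ones k, 7 := ones (Suc (Suc b)))"
    have 1: "exec ?c s 8 ?s"
      by (rule exec_conseq, (rule exec_basic | (rule exec_CondT, (simp add: less.prems 3; fail)))+)
        (use less.prems 3 in \<open>auto simp: fun_eq_iff\<close>)
    have 2: "exec (While 1 filled ?c) ?s (10 * k + 1)
       (?s(1 := [], 7 := ones (Suc (Suc b) + k), 8 := ones (k mod 2)))"
      by (rule less.IH) (use less.prems 3 in auto)
    show ?thesis
      by (rule exec_conseq[OF exec_WhileT[OF _ 1 2]]) (use less.prems 3 in \<open>auto simp: fun_eq_iff\<close>)
  qed
qed

lemma exec_parity_prog:
  assumes "s 1 = ones n" "s 7 = []" "s 8 = []"
  shows "exec parity_prog s (17 * n + 2) (s(8 := ones (n mod 2)))"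
  unfolding parity_prog_def
  by (rule exec_conseq, (rule exec_basic
      | (rule exec_parity_loop[where n = n and b = 0] exec_move, (simp add: assms; fail)+))+)
    (use assms in \<open>auto simp: fun_eq_iff\<close>)

text \<open>On an odd sphere all mass lies on words 1^l0v with |v| = l. For 1^m0w of the same size m
  + |w| = 2l, so comparing \<open>m\<close> with |w| decides whether it comes before all these words
  (value 0), after all of them (value 1, answered by 1^k), or is one of them (value 0.w, answered
  exactly by w).\<close>

definition odd_prog :: com where
  "odd_prog =
     clear 1 ;;
     Cond 2 filled
       (Pop 2 ;;
        While 0 filled (copy_bit 0 7 ;; Pop 0 ;; Cond 4 filled (Pop 4) (Push 8 True)) ;;
        Cond 8 filled (clear 8 ;; clear 7 ;; clear 5)
          (Cond 4 filled (clear 4 ;; clear 7 ;; move 5 0) (clear 5 ;; move 7 0)))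
       (clear 4 ;; move 5 0)"

lemma exec_odd_loop:
  assumes "s 0 = w" "s 4 = ones (m - l)" "s 8 = ones (l - m)"
  shows "exec (While 0 filled (copy_bit 0 7 ;; Pop 0 ;; Cond 4 filled (Pop 4) (Push 8 True))) s
    (10 * length w + 1)
    (s(0 := [], 7 := rev w @ s 7, 4 := ones (m - (l + length w)), 8 := ones (l + length w - m)))"
  using assms
proof (induction w arbitrary: s l)
  case Nil
  then show ?case
    by - (rule exec_conseq[OF exec_WhileF], auto simp: fun_eq_iff)
next
  case (Cons b w)
  let ?s = "s(7 := b # s 7, 0 := w, 4 := ones (m - Suc l), 8 := ones (Suc l - m))"
  have 1: "exec (copy_bit 0 7 ;; Pop 0 ;; Cond 4 filled (Pop 4) (Push 8 True)) s 8 ?s"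
  proof (cases "l < m")
    case True
    then obtain d where d: "m = Suc (l + d)"
      using less_imp_Suc_add by blast
    show ?thesis
      by (rule exec_conseq, (rule exec_basic | (rule exec_copy_bit[of _ _ b w], (simp add: Cons.prems; fail))
          | (rule exec_CondT, (simp add: Cons.prems d; fail)))+)
        (use Cons.prems d in \<open>auto simp: fun_eq_iff\<close>)
  next
    case False
    then obtain d where d: "l = m + d"
      using le_Suc_ex linorder_not_less by blast
    show ?thesis
      by (rule exec_conseq, (rule exec_basic | (rule exec_copy_bit[of _ _ b w], (simp add: Cons.prems; fail))
          | (rule exec_CondF, (simp add: Cons.prems d; fail)))+)
        (use Cons.prems d in \<open>auto simp: fun_eq_iff Suc_diff_le\<close>)
  qed
  have 2: "exec (While 0 filled (copy_bit 0 7 ;; Pop 0 ;; Cond 4 filled (Pop 4) (Push 8 True))) ?s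
      (10 * length w + 1) (?s(0 := [], 7 := rev w @ ?s 7, 4 := ones (m - (Suc l + length w)),
        8 := ones (Suc l + length w - m)))"
    by (rule Cons.IH) auto
  show ?case
    by (rule exec_conseq[OF exec_WhileT[OF _ 1 2]]) (use Cons.prems in \<open>auto simp: fun_eq_iff\<close>)
qed

lemma exec_odd_prog:
  assumes "s = (input_store w)(1 := ones (Suc (m + length w)), 2 := [True], 4 := ones m, 5 := ones k)"
  shows "exec odd_prog s (20 * (m + length w) + 10 * k + 100)
    (input_store (if m < length w then [] else if length w < m then ones k else w))"
proof -
  consider "m < length w" | "length w < m" | "m = length w" by linarith
  then show ?thesis
  proof cases
    case 1
    then obtain d where d: "length w = Suc (m + d)"
      using less_imp_Suc_add by blast
    show ?thesis
      unfolding odd_prog_def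
      by (rule exec_conseq, (rule exec_basic exec_clear
          | (rule exec_odd_loop[where w = w and m = m and l = 0], (simp add: assms input_store_def; fail)+)
          | (rule exec_move, (simp; fail))
          | (rule exec_CondT, (simp add: assms d; fail)))+)
        (use assms d in \<open>auto simp: fun_eq_iff input_store_def\<close>)
  next
    case 2
    then obtain d where d: "m = Suc (length w + d)"
      using less_imp_Suc_add by blast
    show ?thesis
      unfolding odd_prog_def
      by (rule exec_conseq, (rule exec_basic exec_clear
          | (rule exec_odd_loop[where w = w and m = m and l = 0], (simp add: assms input_store_def; fail)+)
          | (rule exec_move, (simp; fail))
          | (rule exec_CondT, (simp add: assms d; fail))
          | (rule exec_CondF, (simp add: assms d; fail)))+)
        (use assms d in \<open>auto simp: fun_eq_iff input_store_def\<close>)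
  next
    case 3
    show ?thesis
      unfolding odd_prog_def
      by (rule exec_conseq, (rule exec_basic exec_clear
          | (rule exec_odd_loop[where w = w and m = m and l = 0], (simp add: assms input_store_def; fail)+)
          | (rule exec_move, (simp; fail))
          | (rule exec_CondT, (simp add: assms 3; fail))
          | (rule exec_CondF, (simp add: assms 3; fail)))+)
        (use assms 3 in \<open>auto simp: fun_eq_iff input_store_def\<close>)
  qed
qed

lemma exec_odd_prog_all_ones:
  assumes "s = (input_store [])(1 := ones n, 4 := ones n, 5 := ones k)"
  shows "exec odd_prog s (20 * n + 10 * k + 100) (input_store (ones k))"
  unfolding odd_prog_def
  by (rule exec_conseq, (rule exec_basic exec_clear
      | (rule exec_move, (simp; fail))
      | (rule exec_CondF, (simp add: assms input_store_def; fail)))+)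
    (use assms in \<open>auto simp: fun_eq_iff input_store_def\<close>)

section \<open>The cumulative distributions\<close>

lemma bin_frac_Nil [simp]: "bin_frac [] = 0"
  by (simp add: bin_frac_def)

lemma bin_frac_Cons [simp]: "bin_frac (b # bs) = (of_bool b + bin_frac bs) / 2"
  by (simp add: bin_frac_def sum.lessThan_Suc_shift sum_divide_distrib add_divide_distrib
      del: sum.lessThan_Suc)

lemma bin_frac_ones: "bin_frac (ones k) = 1 - 1 / 2 ^ k"
  by (induction k) (auto simp: field_simps)

lemma bin_frac_quotient_bits:
  assumes "r < n"
  shows "bin_frac (quotient_bits n r w k) \<le> (real r + bin_frac w) / n \<and>
    (real r + bin_frac w) / n \<le> bin_frac (quotient_bits n r w k) + 1 / 2 ^ k"
  using assms
proof (induction k arbitrary: r w)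
  case 0
  have "0 \<le> bin_frac w" "bin_frac w \<le> 1"
    by (induction w) auto
  with 0 show ?case by (auto simp: field_simps)
next
  case (Suc k)
  define r' where r': "r' = 2 * r + of_bool (is_one (top_sym w))"
  have w: "2 * bin_frac w = of_bool (is_one (top_sym w)) + bin_frac (tl w)"
    by (cases w) auto
  have "real r' = 2 * real r + of_bool (is_one (top_sym w))"
    by (simp add: r')
  then have "real r' + bin_frac (tl w) = 2 * (real r + bin_frac w)"
    unfolding distrib_left w by simp
  \<comment> \<open>Twice the quotient: its integer part is the next digit, and its fractional part
    is the quotient belonging to the next remainder.\<close>
  define u where "u = (real r' + bin_frac (tl w)) / n"
  have v: "(real r + bin_frac w) / n = u / 2"
    unfolding u_def \<open>real r' + bin_frac (tl w) = 2 * (real r + bin_frac w)\<close>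
    by (simp del: distrib_left_numeral)
  show ?case
  proof (cases "r' < n")
    case True
    then have "quotient_bits n r w (Suc k) = False # quotient_bits n r' (tl w) k"
      by (simp add: Let_def r'[symmetric])
    then show ?thesis
      using Suc.IH[OF True, of "tl w"] unfolding v u_def[symmetric] by simp
  next
    case False
    then have div: "quotient_bits n r w (Suc k) = True # quotient_bits n (r' - n) (tl w) k"
      by (simp add: Let_def r'[symmetric])
    have "r' < 2 * n" using r' Suc.prems by (auto simp: of_bool_def)
    then have lt: "r' - n < n" using Suc.prems by simp
    have "(real (r' - n) + bin_frac (tl w)) / n = u - 1"
      using False Suc.prems by (simp add: u_def of_nat_diff field_simps)
    then show ?thesis
      using Suc.IH[OF lt, of "tl w"] unfolding v div by (simp add: add_divide_distrib)
  qed
qed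

text \<open>The cumulative sum for arbitrary functions. Recursion on the first bit replaces
  \<open>g\<close> by its restriction to words with a given first bit, which need not be an
  ensemble.\<close>

definition sum_less :: "(bool list \<Rightarrow> real) \<Rightarrow> bool list \<Rightarrow> real" where
  "sum_less g x = sum g {y. (y, x) \<in> lex {(False, True)}}"

lemma finite_length_eq [simp]: "finite {y :: bool list. length y = n}"
  using finite_lists_length_eq[of "UNIV :: bool set" n] by simp

lemma card_length_eq: "card {y :: bool list. length y = n} = 2 ^ n"
  using card_lists_length_eq[of "UNIV :: bool set" n] by simp

lemma lex_length_eq: "(y, x) \<in> lex r \<Longrightarrow> length y = length x"
  by (auto simp: lex_conv)

lemma finite_lex: "finite {y :: bool list. (y, x) \<in> lex r}"
  by (rule finite_subset[OF _ finite_length_eq[of "length x"]]) (auto dest: lex_length_eq)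

lemma cumulative_eq: "cumulative \<mu> x = sum_less \<mu> x"
  unfolding cumulative_def sphere_prob_def sum_less_def
  by (rule sum.cong) (auto dest: lex_length_eq)

lemma sum_less_cong:
  assumes "\<And>y. length y = length x \<Longrightarrow> g y = g' y"
  shows "sum_less g x = sum_less g' x"
  unfolding sum_less_def by (rule sum.cong) (auto dest: lex_length_eq simp: assms)

lemma sum_less_Nil: "sum_less g [] = 0"
  by (simp add: sum_less_def)

lemma sum_less_False: "sum_less g (False # x) = sum_less (\<lambda>y. g (False # y)) x"
proof -
  have "{y. (y, False # x) \<in> lex {(False, True)}} = Cons False ` {y. (y, x) \<in> lex {(False, True)}}"
  proof (intro set_eqI)
    fix y
    show "y \<in> {y. (y, False # x) \<in> lex {(False, True)}} \<longleftrightarrow>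
        y \<in> Cons False ` {y. (y, x) \<in> lex {(False, True)}}"
      by (cases y) (auto simp: image_iff)
  qed
  then show ?thesis
    by (simp add: sum_less_def sum.reindex comp_def)
qed

lemma sum_less_True:
  "sum_less g (True # x) = (\<Sum>y | length y = length x. g (False # y)) + sum_less (\<lambda>y. g (True # y)) x"
proof -
  let ?A = "{y. length y = length x}" and ?B = "{y. (y, x) \<in> lex {(False, True)}}"
  have "{y. (y, True # x) \<in> lex {(False, True)}} = Cons False ` ?A \<union> Cons True ` ?B"
  proof (intro set_eqI)
    fix y
    show "y \<in> {y. (y, True # x) \<in> lex {(False, True)}} \<longleftrightarrow> y \<in> Cons False ` ?A \<union> Cons True ` ?B"
      by (cases y) (auto simp: image_iff)
  qed
  moreover have "Cons False ` ?A \<inter> Cons True ` ?B = {}"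
    by auto
  ultimately have "sum_less g (True # x) = sum g (Cons False ` ?A) + sum g (Cons True ` ?B)"
    unfolding sum_less_def by (simp add: sum.union_disjoint finite_lex)
  then show ?thesis
    by (simp add: sum_less_def sum.reindex comp_def)
qed

lemma sum_less_const: "sum_less (\<lambda>_. c) x = c * 2 ^ length x * bin_frac x"
proof (induction x)
  case (Cons b x)
  then show ?case
    by (cases b) (auto simp: sum_less_False sum_less_True card_length_eq field_simps)
qed (simp add: sum_less_Nil)

text \<open>The size \<open>n\<close> is kept as a parameter because the density still refers to the
  full size after leading ones have been stripped.\<close>

definition bh_weight :: "nat \<Rightarrow> ensemble" where
  "bh_weight n y = (case dropWhile (\<lambda>b. b) y of [] \<Rightarrow> 0 | _ # w \<Rightarrow> 1 / (real n * 2 ^ length w))"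

lemma bh_weight_Cons [simp]:
  "bh_weight n (True # y) = bh_weight n y"
  "bh_weight n (False # y) = 1 / (real n * 2 ^ length y)"
  by (auto simp: bh_weight_def)

lemma bh_ensemble_eq: "y \<noteq> [] \<Longrightarrow> bh_ensemble y = bh_weight (length y) y"
  by (auto simp: bh_ensemble_def bh_weight_def split: list.splits)

text \<open>Each leading one contributes 1/n: the words that have a 0 in its place and agree before
  it have tails of one length l, and there are 2^l of them with mass 1/(n 2^l) each.\<close>

lemma sum_less_bh_weight:
  "sum_less (bh_weight n) (ones m @ x) = real m / n + sum_less (bh_weight n) x"
  by (induction m) (auto simp: sum_less_True card_length_eq add_divide_distrib)

lemma cumulative_bh_ensemble:
  "cumulative bh_ensemble (ones m @ False # w) = (real m + bin_frac w) / Suc (m + length w)"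
proof -
  let ?n = "Suc (m + length w)"
  have "cumulative bh_ensemble (ones m @ False # w) = sum_less (bh_weight ?n) (ones m @ False # w)"
    unfolding cumulative_eq
    by (rule sum_less_cong, subst bh_ensemble_eq) auto
  also have "\<dots> = real m / ?n + sum_less (\<lambda>y. 1 / (real ?n * 2 ^ length y)) w"
    unfolding sum_less_bh_weight sum_less_False bh_weight_Cons ..
  also have "sum_less (\<lambda>y. 1 / (real ?n * 2 ^ length y)) w = sum_less (\<lambda>_. 1 / (real ?n * 2 ^ length w)) w"
    by (rule sum_less_cong) simp
  also have "real m / ?n + \<dots> = (real m + bin_frac w) / ?n"
    unfolding sum_less_const by (simp add: add_divide_distrib del: of_nat_Suc)
  finally show ?thesis .
qed

lemma cumulative_bh_ensemble_all_ones: "cumulative bh_ensemble (ones n) = of_bool (0 < n)"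
proof (cases "n = 0")
  case True
  then show ?thesis by (simp add: cumulative_eq sum_less_Nil)
next
  case False
  have "cumulative bh_ensemble (ones n) = sum_less (bh_weight n) (ones n)"
    unfolding cumulative_eq
    by (rule sum_less_cong, subst bh_ensemble_eq) (use False in auto)
  also have "\<dots> = 1"
    using sum_less_bh_weight[of n n "[]"] False by (simp add: sum_less_Nil)
  finally show ?thesis using False by simp
qed

lemma sum_lists_Suc:
  "(\<Sum>y | length y = Suc n. g y) =
    (\<Sum>y | length y = n. g (False # y)) + (\<Sum>y | length y = n. g (True # y :: bool list) :: real)"
proof -
  let ?A = "{y :: bool list. length y = n}"
  have "{y. length y = Suc n} = Cons False ` ?A \<union> Cons True ` ?A"
  proof (intro set_eqI)
    fix y :: "bool list"
    show "y \<in> {y. length y = Suc n} \<longleftrightarrow> y \<in> Cons False ` ?A \<union> Cons True ` ?A"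
      by (cases y) (auto simp: image_iff)
  qed
  moreover have "Cons False ` ?A \<inter> Cons True ` ?A = {}"
    by auto
  ultimately have "(\<Sum>y | length y = Suc n. g y) = sum g (Cons False ` ?A) + sum g (Cons True ` ?A)"
    by (simp add: sum.union_disjoint)
  then show ?thesis
    by (simp add: sum.reindex comp_def)
qed

lemma sum_bh_weight: "(\<Sum>y | length y = k. bh_weight n y) = real k / n"
proof (induction k)
  case 0
  then show ?case by (simp add: bh_weight_def)
next
  case (Suc k)
  then show ?case
    by (simp add: sum_lists_Suc card_length_eq add_divide_distrib)
qed

lemma spherical_bh_ensemble: "spherical_ensemble bh_ensemble"
  unfolding spherical_ensemble_def
proof (intro conjI allI)
  show "0 \<le> bh_ensemble x" for x
    by (auto simp: bh_ensemble_def split: list.splits)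
  show "sphere_prob bh_ensemble n UNIV = 1" for n
  proof (cases "n = 0")
    case True
    then show ?thesis by (simp add: sphere_prob_def bh_ensemble_def)
  next
    case False
    have "sphere_prob bh_ensemble n UNIV = (\<Sum>y | length y = n. bh_weight n y)"
      unfolding sphere_prob_def
      by (rule sum.cong) (use False in \<open>auto simp: bh_ensemble_eq\<close>)
    with False show ?thesis by (simp add: sum_bh_weight)
  qed
qed

text \<open>With \<open>h(l) = 2l + 1\<close>, the odd spheres carry the uniform distribution on the words \<open>1\<^sup>l0w\<close>,
  \<open>|w| = l\<close>, and the even spheres, which \<open>h\<close> misses, carry the original distribution.\<close>

abbreviation odd_size :: "nat \<Rightarrow> nat" where
  "odd_size l \<equiv> 2 * l + 1"

abbreviation odd_ensemble :: ensemble where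
  "odd_ensemble \<equiv> induced_ensemble (padded_set odd_size) bh_ensemble"

lemma padded_set_odd_size: "padded_set odd_size = {ones (length w) @ False # w | w. True}"
  by (auto simp: padded_set_def pad_def)

lemma padded_sphere:
  "{x \<in> padded_set odd_size. length x = n} =
    (if odd n then (\<lambda>w. ones (n div 2) @ False # w) ` {w. length w = n div 2} else {})"
proof (cases "odd n")
  case True
  then have n: "n = 2 * (n div 2) + 1" by presburger
  have "x \<in> padded_set odd_size \<and> length x = n \<longleftrightarrow>
      x \<in> (\<lambda>w. ones (n div 2) @ False # w) ` {w. length w = n div 2}" for x
  proof
    assume "x \<in> padded_set odd_size \<and> length x = n"
    then obtain w where w: "x = ones (length w) @ False # w" "length x = n"
      by (auto simp: padded_set_odd_size)
    then have "length w = n div 2" by auto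
    with w show "x \<in> (\<lambda>w. ones (n div 2) @ False # w) ` {w. length w = n div 2}"
      by auto
  next
    assume "x \<in> (\<lambda>w. ones (n div 2) @ False # w) ` {w. length w = n div 2}"
    then obtain w where w: "x = ones (n div 2) @ False # w" "length w = n div 2"
      by auto
    then have "x = ones (length w) @ False # w" by simp
    moreover have "length x = n" using w n by simp
    ultimately show "x \<in> padded_set odd_size \<and> length x = n"
      unfolding padded_set_odd_size by blast
  qed
  with True show ?thesis by auto
next
  case False
  then show ?thesis by (auto simp: padded_set_odd_size)
qed

lemma sphere_prob_padded_set: "sphere_prob bh_ensemble n (padded_set odd_size) = (if odd n then 1 / n else 0)"
proof (cases "odd n")
  case True
  then have n: "n = n div 2 + 1 + n div 2" by presburger
  have "sphere_prob bh_ensemble n (padded_set odd_size) =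
      (\<Sum>w | length w = n div 2. bh_ensemble (ones (n div 2) @ False # w))"
    unfolding sphere_prob_def padded_sphere using True by (simp add: sum.reindex inj_on_def)
  also have "\<dots> = (\<Sum>w :: bool list | length w = n div 2. 1 / (real n * 2 ^ (n div 2)))"
  proof (rule sum.cong[OF refl], clarify)
    fix w :: "bool list" assume "length w = n div 2"
    with n show "bh_ensemble (ones (n div 2) @ False # w) = 1 / (real n * 2 ^ (n div 2))"
      unfolding bh_ensemble_values by metis
  qed
  also have "\<dots> = 1 / n"
    by (simp add: card_length_eq)
  finally show ?thesis using True by simp
next
  case False
  then show ?thesis unfolding sphere_prob_def padded_sphere by simp
qed

lemma odd_ensemble_even: "even (length x) \<Longrightarrow> odd_ensemble x = bh_ensemble x"
  by (simp add: induced_ensemble_def sphere_prob_padded_set)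

lemma odd_ensemble_odd:
  assumes "odd (length x)"
  shows "odd_ensemble x = (if x \<in> padded_set odd_size then 1 / 2 ^ (length x div 2) else 0)"
proof (cases "x \<in> padded_set odd_size")
  case True
  then obtain w where x: "x = ones (length w) @ False # w"
    by (auto simp: padded_set_odd_size)
  have "{y \<in> {x} \<inter> padded_set odd_size. length y = length x} = {x}"
    using True by auto
  then have "sphere_prob bh_ensemble (length x) ({x} \<inter> padded_set odd_size) = bh_ensemble x"
    by (simp add: sphere_prob_def)
  moreover have "bh_ensemble x = 1 / (real (length x) * 2 ^ length w)"
    unfolding x bh_ensemble_values by simp
  moreover have "length x div 2 = length w" "length x \<noteq> 0"
    by (simp_all add: x)
  ultimately show ?thesis
    using True assms by (simp add: induced_ensemble_def sphere_prob_padded_set)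
next
  case False
  then have "{x} \<inter> padded_set odd_size = {}"
    by auto
  then have "sphere_prob bh_ensemble (length x) ({x} \<inter> padded_set odd_size) = 0"
    by (simp add: sphere_prob_def)
  moreover have "x \<noteq> []" using assms by auto
  ultimately show ?thesis
    using False assms by (simp add: induced_ensemble_def sphere_prob_padded_set)
qed

lemma spherical_odd_ensemble: "spherical_ensemble odd_ensemble"
  unfolding spherical_ensemble_def
proof (intro conjI allI)
  show "0 \<le> odd_ensemble x" for x
    using spherical_bh_ensemble
    by (cases "odd (length x)") (auto simp: odd_ensemble_odd odd_ensemble_even spherical_ensemble_def)
  show "sphere_prob odd_ensemble n UNIV = 1" for n
  proof (cases "odd n")
    case True
    have "sphere_prob odd_ensemble n UNIV =
        (\<Sum>x | length x = n. if x \<in> padded_set odd_size then 1 / 2 ^ (n div 2) else 0)"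
      unfolding sphere_prob_def by (rule sum.cong) (use True in \<open>auto simp: odd_ensemble_odd\<close>)
    also have "\<dots> = (\<Sum>x \<in> {x \<in> padded_set odd_size. length x = n}. 1 / 2 ^ (n div 2))"
      by (subst sum.inter_filter[symmetric]) (auto intro!: arg_cong[where f = card])
    also have "\<dots> = 1"
      unfolding padded_sphere using True by (simp add: card_image inj_on_def card_length_eq)
    finally show ?thesis .
  next
    case False
    then have "sphere_prob odd_ensemble n UNIV = sphere_prob bh_ensemble n UNIV"
      unfolding sphere_prob_def by (intro sum.cong) (auto simp: odd_ensemble_even)
    then show ?thesis
      using spherical_bh_ensemble by (simp add: spherical_ensemble_def)
  qed
qed

text \<open>The density on an odd sphere arises for \<open>j = l\<close>; the two parameters are
  separated because stripping a leading one lowers only \<open>j\<close>.\<close>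

definition pad_weight :: "nat \<Rightarrow> nat \<Rightarrow> ensemble" where
  "pad_weight j l y = (if \<exists>w. y = ones j @ False # w \<and> length w = l then 1 / 2 ^ l else 0)"

lemma pad_weight_simps:
  "pad_weight (Suc j) l (True # y) = pad_weight j l y"
  "pad_weight (Suc j) l (False # y) = 0"
  "pad_weight 0 l (False # y) = (if length y = l then 1 / 2 ^ l else 0)"
  "pad_weight 0 l (True # y) = 0"
  by (auto simp: pad_weight_def)

lemma sum_less_zero: "sum_less (\<lambda>_. 0) x = 0"
  by (simp add: sum_less_def)

lemma sum_less_pad_weight:
  assumes "j + l = m + length w"
  shows "sum_less (pad_weight j l) (ones m @ False # w) =
    (if m < j then 0 else if j < m then 1 else bin_frac w)"
  using assms
proof (induction m arbitrary: j)
  case 0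
  show ?case
  proof (cases j)
    case 0
    with \<open>j + l = 0 + length w\<close> have "sum_less (\<lambda>y. pad_weight 0 l (False # y)) w = sum_less (\<lambda>y. 1 / 2 ^ l) w"
      by (intro sum_less_cong) (simp add: pad_weight_simps)
    with 0 \<open>j + l = 0 + length w\<close> show ?thesis
      by (simp add: sum_less_False sum_less_const)
  qed (simp add: sum_less_False pad_weight_simps sum_less_zero)
next
  case (Suc m)
  show ?case
  proof (cases j)
    case 0
    then show ?thesis
      using Suc.prems by (simp add: sum_less_True pad_weight_simps sum_less_zero card_length_eq)
  next
    case (Suc i)
    then show ?thesis
      using Suc.IH[of i] Suc.prems by (simp add: sum_less_True pad_weight_simps)
  qed
qed

lemma sum_less_pad_weight_all_ones: "sum_less (pad_weight j l) (ones (j + 1 + l)) = 1"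
  by (induction j) (auto simp: sum_less_True pad_weight_simps sum_less_zero card_length_eq One_nat_def)

lemma cumulative_odd_ensemble_odd:
  assumes "odd (length x)"
  shows "cumulative odd_ensemble x = sum_less (pad_weight (length x div 2) (length x div 2)) x"
  unfolding cumulative_eq
proof (rule sum_less_cong)
  fix y :: "bool list"
  assume y: "length y = length x"
  then have "y \<in> padded_set odd_size \<longleftrightarrow>
      (\<exists>w. y = ones (length x div 2) @ False # w \<and> length w = length x div 2)"
  proof (intro iffI)
    assume "y \<in> padded_set odd_size"
    then obtain w where w: "y = ones (length w) @ False # w"
      by (auto simp: padded_set_odd_size)
    then have "length y = 2 * length w + 1"
      by (metis length_append length_Cons length_replicate add_Suc_right mult_2 Suc_eq_plus1)
    then have "length w = length x div 2" using y by simp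
    with w show "\<exists>w. y = ones (length x div 2) @ False # w \<and> length w = length x div 2"
      by metis
  next
    assume "\<exists>w. y = ones (length x div 2) @ False # w \<and> length w = length x div 2"
    then show "y \<in> padded_set odd_size"
      unfolding padded_set_odd_size by (metis (mono_tags, lifting) mem_Collect_eq)
  qed
  with y assms show "odd_ensemble y = pad_weight (length x div 2) (length x div 2) y"
    by (simp add: odd_ensemble_odd pad_weight_def)
qed

lemma cumulative_odd_ensemble_even:
  "even (length x) \<Longrightarrow> cumulative odd_ensemble x = cumulative bh_ensemble x"
  unfolding cumulative_eq by (intro sum_less_cong) (simp add: odd_ensemble_even)

section \<open>Membership in DistNP\<close>

lemma ones_append_eq:
  "ones m @ False # w = ones m' @ False # w' \<longleftrightarrow> m = m' \<and> w = w'"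
proof (induction m arbitrary: m')
  case 0
  then show ?case by (cases m') auto
next
  case (Suc m)
  then show ?case by (cases m') auto
qed

lemma ones_neq_append: "ones n \<noteq> ones m @ False # w"
proof
  assume "ones n = ones m @ False # w"
  then have "False \<in> set (ones n)" by simp
  then show False by auto
qed

lemma all_ones_cases:
  obtains "x = ones (length x)" | m w where "x = ones m @ False # w" "length x = Suc (m + length w)"
proof (induction x arbitrary: thesis)
  case (Cons b x)
  show ?case
  proof (cases b)
    case False
    then show ?thesis using Cons.prems(2)[of 0 x] by simp
  next
    case True
    show ?thesis
    proof (rule Cons.IH)
      assume "x = ones (length x)"
      with True show ?thesis by (intro Cons.prems(1)) simp
    next
      fix m w assume "x = ones m @ False # w" "length x = Suc (m + length w)"
      with True show ?thesis by (intro Cons.prems(2)[of "Suc m" w]) simp_all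
    qed
  qed
qed simp

lemma execD: "exec c s T s' \<Longrightarrow> \<exists>t \<le> T. run c s t s'"
  by (simp add: exec_def)

text \<open>The case \<open>v = []\<close> concerns inputs 1^k, which present no pair. The machine
  has to stop in polynomial time on them too, and the common hypothesis lets the programs treat them
  like the pair of \<open>k\<close> and the empty string.\<close>

lemma ptime_real_funI:
  assumes exec: "\<And>k x v. v = [] \<and> x = [] \<or> v = False # x \<Longrightarrow>
      \<exists>y. exec c (input_store (ones k @ v)) (poly p (length (ones k @ v))) (input_store y) \<and>
        \<bar>bin_frac y - g x\<bar> \<le> 1 / 2 ^ k"
    and "regs c \<subseteq> {..r}"
  shows "ptime_real_fun g"
proof -
  have "\<exists>y. exec c (input_store u) (poly p (length u)) (input_store y) \<and>
     (\<forall>k x. u = ones k @ False # x \<longrightarrow> \<bar>bin_frac y - g x\<bar> \<le> 1 / 2 ^ k)" for u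
  proof (cases u rule: all_ones_cases)
    case 1
    obtain y where "exec c (input_store (ones (length u) @ []))
        (poly p (length (ones (length u) @ []))) (input_store y)"
      using exec[of "[]" "[]" "length u"] by auto
    with 1 have "exec c (input_store u) (poly p (length u)) (input_store y)"
      by (metis append_Nil2)
    with 1 ones_neq_append show ?thesis by metis
  next
    case (2 k x)
    obtain y where "exec c (input_store u) (poly p (length u)) (input_store y)"
        "\<bar>bin_frac y - g x\<bar> \<le> 1 / 2 ^ k"
      using exec[of "False # x" x k] 2 by auto
    then show ?thesis
      using 2 ones_append_eq by metis
  qed
  \<comment> \<open>The computed function is obtained by choice from the final stores; on inputs
    without a zero nothing is asked of its value.\<close>
  then obtain F where F: "exec c (input_store u) (poly p (length u)) (input_store (F u))"
     "u = ones k @ False # x \<Longrightarrow> \<bar>bin_frac (F u) - g x\<bar> \<le> 1 / 2 ^ k" for u k x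
    by metis
  have "ptime_fun F"
    by (rule ptime_funI[OF execD[OF F(1)] assms(2)])
  with F(2) show ?thesis
    unfolding ptime_real_fun_def by metis
qed

lemma poly_quadratic: "poly [:a, b, c:] L = a + b * L + c * (L * L)" for a b c L :: nat
  by (simp add: algebra_simps)

lemma ptime_cumulative_bh: "ptime_real_fun (cumulative bh_ensemble)"
proof (rule ptime_real_funI[where c = "input_prog ;; division_prog" and p = "[:400, 400, 60:]" and r = 9])
  fix k x v
  assume v: "v = [] \<and> x = [] \<or> v = False # x"
  let ?L = "length (ones k @ v)"
  have L: "k \<le> ?L" "length x \<le> ?L" using v by auto
  \<comment> \<open>Long division takes about \<open>60 * n\<close> steps for each of the
    \<open>k\<close> digits, which accounts for the coefficient 60 of the square.\<close>
  then have kx: "k * length x \<le> ?L * ?L" by (rule mult_mono) auto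
  show "\<exists>y. exec (input_prog ;; division_prog) (input_store (ones k @ v))
      (poly [:400, 400, 60:] ?L) (input_store y) \<and> \<bar>bin_frac y - cumulative bh_ensemble x\<bar> \<le> 1 / 2 ^ k"
  proof (cases x rule: all_ones_cases)
    case 1
    have v': "v = [] \<and> length x = 0 \<or> v = False # ones (length x)"
      using v 1 by auto
    have "exec (input_prog ;; division_prog) (input_store (ones k @ v))
      (poly [:400, 400, 60:] ?L) (input_store (if length x = 0 then [] else ones k))"
      unfolding poly_quadratic
      by (rule exec_conseq[OF exec_Seq[OF exec_input_prog_all_ones[OF v']
            exec_division_prog_all_ones[OF refl]] refl])
        (use L kx in \<open>simp add: algebra_simps del: length_append length_replicate\<close>)
    moreover have "cumulative bh_ensemble x = of_bool (x \<noteq> [])"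
      using 1 cumulative_bh_ensemble_all_ones[of "length x"] by simp
    ultimately show ?thesis
      by (intro exI[of _ "if length x = 0 then [] else ones k"]) (auto simp: bin_frac_ones)
  next
    case (2 m w)
    have "exec (input_prog ;; division_prog) (input_store (ones k @ v))
      (poly [:400, 400, 60:] ?L) (input_store (quotient_bits (Suc (m + length w)) m w k))"
      unfolding poly_quadratic
      by (rule exec_conseq[OF exec_Seq[OF exec_input_prog[OF v 2(1)]
            exec_division_prog[OF refl refl]] refl])
        (use L kx 2(2) in \<open>simp add: algebra_simps del: length_append length_replicate\<close>)
    moreover have "\<bar>bin_frac (quotient_bits (Suc (m + length w)) m w k) - cumulative bh_ensemble x\<bar> \<le> 1 / 2 ^ k"
      using bin_frac_quotient_bits[of m "Suc (m + length w)" w k]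
      unfolding 2(1) cumulative_bh_ensemble by linarith
    ultimately show ?thesis by blast
  qed
next
  show "regs (input_prog ;; division_prog) \<subseteq> {..9}"
    by (simp add: input_prog_def split_def division_prog_def division_step_def compare_prog_def
        double_def clear_def move_def copy_bit_def)
qed

definition odd_cumulative_prog :: com where
  "odd_cumulative_prog = input_prog ;; parity_prog ;; Cond 8 filled (Pop 8 ;; odd_prog) division_prog"

lemma exec_odd_cumulative_prog:
  assumes "exec input_prog (input_store u) T s" "s 1 = ones n" "s 7 = []" "s 8 = []"
    and "exec (if odd n then odd_prog else division_prog) s U s'"
  shows "exec odd_cumulative_prog (input_store u) (T + 17 * n + U + 10) s'"
proof (cases "odd n")
  case True
  then have "n mod 2 = 1" by presburger
  then have p: "exec parity_prog s (17 * n + 2) (s(8 := [True]))"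
    using exec_parity_prog[OF assms(2-4)] by simp
  have eq: "(s(8 := [True]))(8 := tl ((s(8 := [True])) 8)) = s"
    using assms(4) by auto
  have c: "exec (Cond 8 filled (Pop 8 ;; odd_prog) division_prog) (s(8 := [True])) (1 + U + 2) s'"
    using assms(5) True
    by (intro exec_CondT exec_Seq[OF exec_Pop[of 8 "s(8 := [True])", unfolded eq]]) auto
  show ?thesis
    unfolding odd_cumulative_prog_def
    by (rule exec_conseq[OF exec_Seq[OF assms(1) exec_Seq[OF p c]]]) auto
next
  case False
  then have "n mod 2 = 0" by presburger
  then have "exec parity_prog s (17 * n + 2) (s(8 := []))"
    using exec_parity_prog[OF assms(2-4)] by simp
  moreover have "s(8 := []) = s"
    using assms(4) by auto
  ultimately have p: "exec parity_prog s (17 * n + 2) s" by metis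
  have c: "exec (Cond 8 filled (Pop 8 ;; odd_prog) division_prog) s (U + 1) s'"
    using assms(4,5) False by (intro exec_CondF) auto
  show ?thesis
    unfolding odd_cumulative_prog_def
    by (rule exec_conseq[OF exec_Seq[OF assms(1) exec_Seq[OF p c]]]) auto
qed

lemma ptime_cumulative_odd: "ptime_real_fun (cumulative odd_ensemble)"
proof (rule ptime_real_funI[where c = odd_cumulative_prog and p = "[:500, 500, 60:]" and r = 9])
  fix k x v
  assume v: "v = [] \<and> x = [] \<or> v = False # x"
  let ?L = "length (ones k @ v)" and ?n = "length x"
  have L: "k \<le> ?L" "length x \<le> ?L" using v by auto
  then have kx: "k * length x \<le> ?L * ?L" by (rule mult_mono) auto
  show "\<exists>y. exec odd_cumulative_prog (input_store (ones k @ v))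
      (poly [:500, 500, 60:] ?L) (input_store y) \<and> \<bar>bin_frac y - cumulative odd_ensemble x\<bar> \<le> 1 / 2 ^ k"
  proof (cases x rule: all_ones_cases)
    case 1
    let ?y = "if ?n = 0 then [] else ones k"
    let ?s = "(input_store [])(1 := ones ?n, 4 := ones ?n, 5 := ones k)"
    have v': "v = [] \<and> ?n = 0 \<or> v = False # ones ?n"
      using v 1 by auto
    have sub: "exec (if odd ?n then odd_prog else division_prog) ?s
        (k * (60 * ?n + 100) + 100 * ?n + 100) (input_store ?y)"
    proof (cases "odd ?n")
      case True
      show ?thesis
        unfolding if_P[OF True]
        by (rule exec_conseq[OF exec_odd_prog_all_ones[OF refl]])
          (use True in \<open>auto simp: algebra_simps\<close>)
    next
      case False
      then show ?thesis
        unfolding if_not_P[OF False] by (intro exec_division_prog_all_ones[OF refl])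
    qed
    have "exec odd_cumulative_prog (input_store (ones k @ v)) (poly [:500, 500, 60:] ?L) (input_store ?y)"
      unfolding poly_quadratic
      by (rule exec_conseq[OF exec_odd_cumulative_prog[OF exec_input_prog_all_ones[OF v'] _ _ _ sub] refl])
        (use L kx in \<open>simp_all add: algebra_simps input_store_def del: length_append length_replicate\<close>)
    moreover have "cumulative odd_ensemble x = of_bool (x \<noteq> [])"
    proof (cases "odd ?n")
      case True
      then have "?n = ?n div 2 + 1 + ?n div 2" by presburger
      with 1 have "x = ones (?n div 2 + 1 + ?n div 2)" by metis
      then have "sum_less (pad_weight (?n div 2) (?n div 2)) x = 1"
        by (metis sum_less_pad_weight_all_ones)
      with True show ?thesis by (auto simp: cumulative_odd_ensemble_odd)
    next
      case False
      then show ?thesis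
        using 1 cumulative_bh_ensemble_all_ones[of ?n] by (simp add: cumulative_odd_ensemble_even)
    qed
    ultimately show ?thesis
      by (intro exI[of _ ?y]) (auto simp: bin_frac_ones)
  next
    case (2 m w)
    let ?y = "if odd ?n then (if m < length w then [] else if length w < m then ones k else w)
      else quotient_bits ?n m w k"
    let ?s = "(input_store w)(1 := ones (Suc (m + length w)), 2 := [True], 4 := ones m, 5 := ones k)"
    have sub: "exec (if odd ?n then odd_prog else division_prog) ?s
        (k * (60 * ?n + 100) + 100 * ?n + 100) (input_store ?y)"
    proof (cases "odd ?n")
      case True
      show ?thesis
        unfolding if_P[OF True]
        by (rule exec_conseq[OF exec_odd_prog[OF refl] refl])
          (simp add: 2(2) algebra_simps)
    next
      case False
      then show ?thesis
        unfolding if_not_P[OF False] by (intro exec_division_prog[OF refl 2(2)])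
    qed
    have "exec odd_cumulative_prog (input_store (ones k @ v)) (poly [:500, 500, 60:] ?L) (input_store ?y)"
      unfolding poly_quadratic
      by (rule exec_conseq[OF exec_odd_cumulative_prog[OF exec_input_prog[OF v 2(1)] _ _ _ sub[unfolded 2(2)]]])
        (use L kx 2(2) in \<open>simp_all add: algebra_simps input_store_def del: length_append length_replicate\<close>)
    moreover have "\<bar>bin_frac ?y - cumulative odd_ensemble x\<bar> \<le> 1 / 2 ^ k"
    proof (cases "odd ?n")
      case True
      then have "?n div 2 + ?n div 2 = m + length w"
        using 2(2) by presburger
      then have "cumulative odd_ensemble x =
          (if m < ?n div 2 then 0 else if ?n div 2 < m then 1 else bin_frac w)"
        using sum_less_pad_weight[of "?n div 2" "?n div 2" m w] True 2(1)
        by (simp add: cumulative_odd_ensemble_odd)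
      moreover have "m < ?n div 2 \<longleftrightarrow> m < length w" "?n div 2 < m \<longleftrightarrow> length w < m"
        using \<open>?n div 2 + ?n div 2 = m + length w\<close> by linarith+
      ultimately show ?thesis
        using True by (simp add: bin_frac_ones)
    next
      case False
      then have "cumulative odd_ensemble x = (real m + bin_frac w) / ?n"
        unfolding 2(2) using cumulative_bh_ensemble[of m w] 2(1) by (simp add: cumulative_odd_ensemble_even)
      then show ?thesis
        using False bin_frac_quotient_bits[of m ?n w k] 2(2) by simp
    qed
    ultimately show ?thesis by blast
  qed
next
  show "regs odd_cumulative_prog \<subseteq> {..9}"
    by (simp add: odd_cumulative_prog_def parity_prog_def odd_prog_def input_prog_def split_def
        division_prog_def division_step_def compare_prog_def double_def clear_def move_def copy_bit_def)
qed

section \<open>Bounded halting problems are in NP\<close>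

lemma pad_in_BH: "ones m @ False # w \<in> BH M \<longleftrightarrow> (\<exists>t \<le> Suc (m + length w). \<exists>a. halts_in M w t a)"
proof
  assume "ones m @ False # w \<in> BH M"
  then obtain n w' where *: "ones m @ False # w = ones (n - Suc (length w')) @ False # w'"
      "length w' < n" "\<exists>t \<le> n. \<exists>a. halts_in M w' t a"
    unfolding BH_def pad_def by blast
  then have "m = n - Suc (length w)" "w' = w"
    unfolding ones_append_eq by auto
  with *(2) have "n = Suc (m + length w)" by simp
  with * \<open>w' = w\<close> show "\<exists>t \<le> Suc (m + length w). \<exists>a. halts_in M w t a" by simp
next
  assume "\<exists>t \<le> Suc (m + length w). \<exists>a. halts_in M w t a"
  moreover have "ones m @ False # w = pad (Suc (m + length w)) w" by (simp add: pad_def)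
  moreover have "length w < Suc (m + length w)" by simp
  ultimately show "ones m @ False # w \<in> BH M"
    unfolding BH_def by blast
qed

lemma ones_notin_BH: "ones n \<notin> BH M"
  using ones_neq_append unfolding BH_def pad_def by blast

lemma regs_clock_prog: "regs clock_prog \<subseteq> {..9}"
  by (simp add: clock_prog_def split_def clear_def move_def copy_bit_def)

text \<open>NP requires a time bound on all computations, not only on accepting ones, and the clock
  supplies it: preparing it costs at most 40n + 40 steps, and it then allows at most n more.\<close>

lemma BH_in_NP: "BH M \<in> NP"
proof -
  let ?N = "then_clocked clock_prog 9 M"
  have "(\<forall>t c. (tm_step ?N ^^ t) (init ?N x) c \<longrightarrow> t \<le> poly [:40, 41:] (length x)) \<and>
     (x \<in> BH M \<longleftrightarrow> (\<exists>t. halts_in ?N x t Yes))" for x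
  proof (cases x rule: all_ones_cases)
    case 1
    have "exec clock_prog (input_store x) (40 * length x + 40) ((input_store [])(1 := ones 0))"
      using exec_clock_prog_all_ones[of "length x"] 1 by metis
    then obtain d where d: "d \<le> 40 * length x + 40" "run clock_prog (input_store x) d ((input_store [])(1 := ones 0))"
      by (blast dest: execD)
    \<comment> \<open>A halt takes at least one step, so the empty clock rules out
      acceptance.\<close>
    have "\<not> halts_in M [] 0 a" for a
      by (simp add: halts_in_def init_def)
    moreover have "x \<notin> BH M"
      using 1 ones_notin_BH by metis
    ultimately have "x \<in> BH M \<longleftrightarrow> (\<exists>t. halts_in ?N x t Yes)"
      unfolding halts_in_then_clocked[OF d(2) regs_clock_prog zero_less_numeral] by auto
    moreover have "t \<le> poly [:40, 41:] (length x)" if "(tm_step ?N ^^ t) (init ?N x) c" for t c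
      using then_clocked_time[OF d(2) regs_clock_prog zero_less_numeral that] d(1) by simp
    ultimately show ?thesis by blast
  next
    case (2 m w)
    obtain d where d: "d \<le> 40 * length x + 40"
        "run clock_prog (input_store x) d ((input_store w)(1 := ones (length x)))"
      using execD[OF exec_clock_prog[OF 2(1)]] by blast
    have "x \<in> BH M \<longleftrightarrow> (\<exists>t. halts_in ?N x t Yes)"
      unfolding halts_in_then_clocked[OF d(2) regs_clock_prog zero_less_numeral]
      unfolding 2(2) unfolding 2(1) pad_in_BH by blast
    moreover have "t \<le> poly [:40, 41:] (length x)" if "(tm_step ?N ^^ t) (init ?N x) c" for t c
      using then_clocked_time[OF d(2) regs_clock_prog zero_less_numeral that] d(1) by simp
    ultimately show ?thesis by blast
  qed
  then show ?thesis
    unfolding NP_def by blast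
qed

lemma DBH_in_DistNP: "DBH M \<in> DistNP"
  unfolding DBH_def DistNP_def
  using BH_in_NP spherical_bh_ensemble ptime_cumulative_bh by blast

lemma DBH_padded_in_DistNP: "DBH_padded M odd_size \<in> DistNP"
  unfolding DBH_padded_def DistNP_def
  using BH_in_NP spherical_odd_ensemble ptime_cumulative_odd by blast

text \<open>True for \<open>n = 0\<close> as well, since 0 has the empty expansion. Computing
  \<open>odd_size\<close> thus amounts to appending one digit.\<close>

lemma bin_odd_size: "bin (odd_size n) = bin n @ [True]"
  by (subst bin.simps) simp

lemma ptime_odd_size: "ptime_nat_fun odd_size"
proof -
  let ?c = "move 0 1 ;; Push 0 True ;; move 1 0"
  have "exec ?c (input_store x) (poly [:4, 14:] (length x)) (input_store (x @ [True]))" for x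
    by (rule exec_conseq, (rule exec_basic | (rule exec_move, (simp; fail)))+)
      (auto simp: fun_eq_iff input_store_def)
  then have "ptime_fun (\<lambda>x. x @ [True])"
    by (intro ptime_funI[where c = ?c and p = "[:4, 14:]" and r = 1] execD)
      (auto simp: move_def copy_bit_def)
  then show ?thesis
    unfolding ptime_nat_fun_def using bin_odd_size by metis
qed

section \<open>Transfer of decision procedures along a reduction\<close>

lemma run_time_le_iff:
  "run_time M x \<le> enat B \<longleftrightarrow> (\<exists>t \<le> B. halts_in M x t Yes \<or> halts_in M x t No)"
proof
  let ?A = "{enat t | t. halts_in M x t Yes \<or> halts_in M x t No}"
  assume le: "run_time M x \<le> enat B"
  then have "?A \<noteq> {}"
    unfolding run_time_def by (metis Inf_enat_def enat_ord_code(5) not_infinity_eq infinity_ileE)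
  then have "run_time M x \<in> ?A"
    unfolding run_time_def Inf_enat_def by (metis (mono_tags, lifting) LeastI equals0I)
  with le show "\<exists>t \<le> B. halts_in M x t Yes \<or> halts_in M x t No" by auto
next
  assume "\<exists>t \<le> B. halts_in M x t Yes \<or> halts_in M x t No"
  then obtain t where t: "t \<le> B" "halts_in M x t Yes \<or> halts_in M x t No" by blast
  then have "run_time M x \<le> enat t"
    unfolding run_time_def by (intro Inf_lower) blast
  with t(1) show "run_time M x \<le> enat B"
    by (meson enat_ord_simps(1) order_trans)
qed

lemma poly_nat_mono: "x \<le> y \<Longrightarrow> poly p x \<le> poly p y" for p :: "nat poly"
  by (induction p) (simp_all add: mult_mono)

lemma poly_le_power: "\<exists>c d. 0 < c \<and> (\<forall>x \<ge> 1. \<bar>poly q x\<bar> \<le> c * x ^ d)" for q :: "real poly"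
proof (induction q)
  case 0
  show ?case by (intro exI[of _ 1] exI[of _ 0]) auto
next
  case (pCons a q)
  then obtain c d where cd: "0 < c" "\<And>x. x \<ge> 1 \<Longrightarrow> \<bar>poly q x\<bar> \<le> c * x ^ d" by blast
  have "\<bar>poly (pCons a q) x\<bar> \<le> (\<bar>a\<bar> + c) * x ^ Suc d" if x: "x \<ge> 1" for x
  proof -
    have "\<bar>poly (pCons a q) x\<bar> \<le> \<bar>a\<bar> + x * \<bar>poly q x\<bar>"
      using x by (simp add: abs_mult order_trans[OF abs_triangle_ineq])
    also have "\<dots> \<le> \<bar>a\<bar> * x ^ Suc d + x * (c * x ^ d)"
      using x cd(2)[OF x] by (intro add_mono mult_left_mono) (auto simp: mult_le_cancel_left1 one_le_power
          simp del: power_Suc)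
    finally show ?thesis by (simp add: algebra_simps)
  qed
  then show ?case using cd(1) by (intro exI[of _ "\<bar>a\<bar> + c"] exI[of _ "Suc d"]) auto
qed

text \<open>At a root of \<open>q\<close> the bound 1/q(n) has the value 0 by the convention for
  division, so the finitely many roots have to be left behind.\<close>

lemma eventually_poly_neq_0:
  assumes "q \<noteq> (0 :: real poly)"
  shows "eventually (\<lambda>n. poly q (real n) \<noteq> 0) sequentially"
proof -
  have "finite (real -` {x. poly q x = 0})"
    by (intro finite_vimageI poly_roots_finite assms) (auto simp: inj_on_def)
  then show ?thesis
    by (simp add: cofinite_eq_sequentially[symmetric] eventually_cofinite vimage_def)
qed

text \<open>\<open>g\<close> vanishes faster than any inverse polynomial in its argument
  \<open>N n\<close>. A higher power of \<open>N n\<close> can therefore absorb the polynomial loss,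
  and \<open>n <= N n\<close> turns what remains into a bound in \<open>n\<close>.\<close>

lemma small_o_transfer:
  fixes g G :: "nat \<Rightarrow> real" and N :: "nat \<Rightarrow> nat"
  assumes g: "\<And>q :: real poly. q \<noteq> 0 \<Longrightarrow> g \<in> o(\<lambda>n. 1 / poly q (real n))"
    and G: "\<And>n. 1 \<le> n \<Longrightarrow> \<bar>G n\<bar> \<le> \<kappa> * real (N n) ^ 2 * \<bar>g (N n)\<bar>"
    and N: "\<And>n. n \<le> N n" and \<kappa>: "0 < \<kappa>" and q: "q \<noteq> 0"
  shows "G \<in> o(\<lambda>n. 1 / poly q (real n))"
proof (rule landau_o.smallI)
  fix e :: real
  assume e: "0 < e"
  obtain c d where cd: "0 < c" "\<And>x. x \<ge> 1 \<Longrightarrow> \<bar>poly q x\<bar> \<le> c * x ^ d"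
    using poly_le_power by blast
  \<comment> \<open>Compensates the constants \<open>\<kappa>\<close> of the domination and
    \<open>c\<close> of the bound on \<open>q\<close>.\<close>
  define e' where "e' = e / (\<kappa> * c)"
  have "e' > 0" using e \<kappa> cd(1) by (simp add: e'_def)
  \<comment> \<open>Two of the \<open>d + 2\<close> powers pay for the factor
    \<open>N n ^ 2\<close>, the others for \<open>q\<close>.\<close>
  have "g \<in> o(\<lambda>n. 1 / poly (monom 1 (d + 2)) (real n))"
    by (rule g) (simp add: monom_eq_0_iff)
  then have "eventually (\<lambda>n. norm (g n) \<le> e' * norm (1 / poly (monom 1 (d + 2)) (real n))) sequentially"
    using \<open>e' > 0\<close> by (rule landau_o.smallD)
  moreover have "filterlim N sequentially sequentially"
    using N by (intro filterlim_at_top_mono[OF filterlim_ident]) auto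
  ultimately have "eventually (\<lambda>n. norm (g (N n)) \<le>
      e' * norm (1 / poly (monom 1 (d + 2)) (real (N n)))) sequentially"
    by (rule eventually_compose_filterlim)
  then show "eventually (\<lambda>n. norm (G n) \<le> e * norm (1 / poly q (real n))) sequentially"
    using eventually_poly_neq_0[OF q] eventually_ge_at_top[of 1]
  proof eventually_elim
    case (elim n)
    let ?x = "real (N n)"
    have x: "1 \<le> real n" "real n \<le> ?x" using elim(3) N[of n] by auto
    have "norm (G n) \<le> \<kappa> * ?x ^ 2 * \<bar>g (N n)\<bar>"
      using G elim(3) by simp
    also have "\<dots> \<le> \<kappa> * ?x ^ 2 * (e' / ?x ^ (d + 2))"
      using elim(1) \<kappa> x by (intro mult_left_mono) (auto simp: poly_monom)
    also have "\<dots> = \<kappa> * e' / ?x ^ d"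
      using x by (simp add: power_add power2_eq_square field_simps)
    also have "\<dots> \<le> \<kappa> * e' / real n ^ d"
      using x \<kappa> \<open>e' > 0\<close> by (intro divide_left_mono power_mono mult_pos_pos) auto
    also have "\<dots> = e / (c * real n ^ d)"
      using \<kappa> cd(1) x by (simp add: e'_def field_simps)
    also have "\<dots> \<le> e / \<bar>poly q (real n)\<bar>"
      using cd x e elim(2) by (intro divide_left_mono mult_pos_pos) auto
    finally show ?case by simp
  qed
qed

text \<open>Where the composite machine is slow at \<open>x\<close>, the given machine is slow at
  \<open>f x\<close>. By domination the preimage of that slow set has at most polynomially larger
  mass than the set, which keeps it negligible.\<close>

lemma SGPtime_decides_transfer:
  fixes N T :: "nat poly"
  assumes prog: "\<And>x. exec c (input_store x) (poly T (length x)) (input_store (f x))" "regs c \<subseteq> {..r}"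
    and red: "\<And>x. x \<in> D \<longleftrightarrow> f x \<in> E"
    and len: "\<And>x. length (f x) = poly N (length x)" and N: "\<And>n. n \<le> poly N n"
    and \<mu>: "\<And>x. 0 \<le> \<mu> x" and \<nu>: "\<And>x. 0 \<le> \<nu> x"
    and dom: "\<And>n S. 1 \<le> n \<Longrightarrow>
      sphere_prob \<mu> n {x. f x \<in> S} \<le> \<kappa> * real (poly N n) ^ 2 * sphere_prob \<nu> (poly N n) S"
    and \<kappa>: "0 < \<kappa>" and A: "SGPtime_decides A (E, \<nu>)"
  shows "\<exists>B. composite B A f \<and> SGPtime_decides B (D, \<mu>)"
proof (intro exI conjI)
  let ?B = "then_run c r A"
  have halts: "\<exists>d \<le> poly T (length x). \<forall>t a. halts_in ?B x t a \<longleftrightarrow> (\<exists>t'. t = d + t' \<and> halts_in A (f x) t' a)" for x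
    using execD[OF prog(1)] halts_in_then_run[OF _ prog(2)] by metis
  from A obtain p :: "nat poly" where pd: "partially_decides A E"
    and p: "\<And>q :: real poly. q \<noteq> 0 \<Longrightarrow>
      (\<lambda>n. sphere_prob \<nu> n {x. run_time A x > enat (poly p n)}) \<in> o(\<lambda>n. 1 / poly q (real n))"
    by auto
  have det: "deterministic ?B"
    using pd by (intro deterministic_then_run) (simp add: partially_decides_def)
  show "composite ?B A f"
    unfolding composite_def
  proof (intro conjI det exI[of _ T] allI)
    fix x a
    obtain d where d: "d \<le> poly T (length x)"
        "\<And>t a. halts_in ?B x t a \<longleftrightarrow> (\<exists>t'. t = d + t' \<and> halts_in A (f x) t' a)"
      using halts[of x] by blast
    show "halts_in A (f x) t a \<longrightarrow> (\<exists>d \<le> poly T (length x). halts_in ?B x (d + t) a)" for t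
      using d by auto
    show "halts_in ?B x t a \<longrightarrow> (\<exists>t' \<le> t. halts_in A (f x) t' a)" for t
      unfolding d(2) by (metis le_add2)
  qed
  \<comment> \<open>The time to compute \<open>f\<close>, plus the bound for \<open>A\<close>
    evaluated at the size of the image.\<close>
  let ?P = "T + pcompose p N"
  have time: "run_time ?B x \<le> enat (poly ?P (length x))"
    if le: "run_time A (f x) \<le> enat (poly p (length (f x)))" for x
  proof -
    obtain t where t: "t \<le> poly p (length (f x))" "halts_in A (f x) t Yes \<or> halts_in A (f x) t No"
      using le unfolding run_time_le_iff by blast
    obtain d where d: "d \<le> poly T (length x)"
        "\<And>t a. halts_in ?B x t a \<longleftrightarrow> (\<exists>t'. t = d + t' \<and> halts_in A (f x) t' a)"
      using halts[of x] by blast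
    have "d + t \<le> poly ?P (length x)"
      using d(1) t(1) by (simp add: poly_pcompose len)
    moreover have "halts_in ?B x (d + t) Yes \<or> halts_in ?B x (d + t) No"
      unfolding d(2) using t(2) by auto
    ultimately show ?thesis
      unfolding run_time_le_iff by blast
  qed
  have nonneg: "0 \<le> sphere_prob \<mu> n S" "0 \<le> sphere_prob \<nu> n S" for n S
    unfolding sphere_prob_def by (auto intro!: sum_nonneg \<mu> \<nu>)
  have "(\<lambda>n. sphere_prob \<mu> n {x. run_time ?B x > enat (poly ?P n)}) \<in> o(\<lambda>n. 1 / poly q (real n))"
    if q: "q \<noteq> 0" for q :: "real poly"
  proof (rule small_o_transfer[OF p _ N \<kappa> q])
    fix n :: nat
    assume n: "1 \<le> n"
    let ?S = "{y. run_time A y > enat (poly p (poly N n))}"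
    have "sphere_prob \<mu> n {x. run_time ?B x > enat (poly ?P n)} \<le> sphere_prob \<mu> n {x. f x \<in> ?S}"
      unfolding sphere_prob_def
    proof (intro sum_mono2 \<mu>)
      show "finite {x \<in> {x. f x \<in> ?S}. length x = n}"
        by (rule finite_subset[OF _ finite_length_eq[of n]]) auto
      show "{x \<in> {x. run_time ?B x > enat (poly ?P n)}. length x = n} \<subseteq> {x \<in> {x. f x \<in> ?S}. length x = n}"
        using time len by (auto simp: not_le[symmetric] simp del: poly_add)
    qed
    also have "\<dots> \<le> \<kappa> * real (poly N n) ^ 2 * sphere_prob \<nu> (poly N n) ?S"
      by (rule dom[OF n])
    finally show "\<bar>sphere_prob \<mu> n {x. run_time ?B x > enat (poly ?P n)}\<bar> \<le>
        \<kappa> * real (poly N n) ^ 2 * \<bar>sphere_prob \<nu> (poly N n) ?S\<bar>"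
      using nonneg by simp
  qed
  moreover have "partially_decides ?B D"
    unfolding partially_decides_def
  proof (intro conjI det allI impI)
    fix x t a
    assume "halts_in ?B x t a"
    then obtain t' where "halts_in A (f x) t' a"
      using halts[of x] by blast
    with pd red show "a = DontKnow \<or> a = Yes \<and> x \<in> D \<or> a = No \<and> x \<notin> D"
      unfolding partially_decides_def by blast
  qed
  ultimately show "SGPtime_decides ?B (D, \<mu>)"
    unfolding SGPtime_decides.simps by blast
qed

section \<open>The reduction\<close>

lemma horner_val_coeffs: "horner_val (coeffs p) n = poly p n"
  by (induction p) (auto simp: cCons_def)

lemma horner_val_poly: "\<exists>p. \<forall>n. horner_val cs n = poly p n"
proof (induction cs)
  case Nil
  show ?case by (intro exI[of _ 0]) simp
next
  case (Cons a cs)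
  then obtain p where "\<forall>n. horner_val cs n = poly p n" by blast
  then show ?case by (intro exI[of _ "pCons a p"]) simp
qed

lemma horner_time_poly: "\<exists>p. \<forall>n. horner_time cs n = poly p n"
proof (induction cs)
  case Nil
  show ?case by (intro exI[of _ 0]) simp
next
  case (Cons a cs)
  then obtain p where p: "\<forall>n. horner_time cs n = poly p n" by blast
  obtain v where v: "\<forall>n. horner_val cs n = poly v n" using horner_val_poly by blast
  show ?case
    by (intro exI[of _ "p + v * [:5, 14:] + 7 * ([:0, 1:] * v) + [:2 * a + 2:]"])
      (simp add: p v algebra_simps)
qed

lemma regs_reduction_prog: "regs (reduction_prog cs C) \<subseteq> {..9}"
proof -
  have "regs (push_all i bs) \<subseteq> {i}" for i bs
    by (induction bs) auto
  moreover from this have "regs (horner cs) \<subseteq> {..9}"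
    by (induction cs) (force simp: move_def copy_bit_def)+
  ultimately show ?thesis
    by (force simp: reduction_prog_def split_def clear_def move_def copy_bit_def encode_def
        halve_def pad_out_def)
qed

definition reduction :: "nat poly \<Rightarrow> bool list \<Rightarrow> bool list \<Rightarrow> bool list" where
  "reduction N C x =
     (case dropWhile (\<lambda>b. b) x of
        [] \<Rightarrow> ones (poly N (length x))
      | _ # w \<Rightarrow> pad (poly N (length x)) (reduction_tail C (length x) w))"

lemma reduction_simps:
  "reduction N C (ones n) = ones (poly N n)"
  "reduction N C (ones m @ False # w) =
     pad (poly N (Suc (m + length w))) (reduction_tail C (Suc (m + length w)) w)"
  by (simp_all add: reduction_def dropWhile_append)

lemma exec_reduction:
  obtains T where "\<And>x. exec (reduction_prog (coeffs N) C) (input_store x) (poly T (length x))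
    (input_store (reduction N C x))"
proof -
  obtain p where p: "\<And>n. horner_time (coeffs N) n = poly p n"
    using horner_time_poly by blast
  let ?T = "[:17 * length C + 200, 200:] + p + 7 * N"
  have "exec (reduction_prog (coeffs N) C) (input_store x) (poly ?T (length x))
    (input_store (reduction N C x))" for x
  proof (cases x rule: all_ones_cases)
    case 1
    have "exec (reduction_prog (coeffs N) C) (input_store (ones n)) (poly ?T n)
      (input_store (reduction N C (ones n)))" for n
      by (rule exec_conseq[OF exec_reduction_prog_all_ones])
        (simp_all add: reduction_simps horner_val_coeffs p)
    with 1 show ?thesis by metis
  next
    case (2 m w)
    show ?thesis
      by (rule exec_conseq[OF exec_reduction_prog[OF 2(1)]])
        (simp_all add: 2(1) reduction_simps horner_val_coeffs p pad_def)
  qed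
  with that show ?thesis by blast
qed

text \<open>The first property has no bound on the time of U: the clocked machine halts only if M
  halts within n steps, so every halt of U is conclusive. For the second, the input of the clocked
  machine has length at most 3n and its run is quadratic in n, so the overhead of U stays polynomial
  in n.\<close>

lemma universal_clocked:
  fixes M U :: tm and \<gamma> :: "tm \<Rightarrow> nat"
  assumes "universal_tm \<gamma> U"
  defines "C \<equiv> overline_nat (\<gamma> (then_clocked decode 9 M))"
  obtains s :: "nat poly" where
    "\<And>n w t a. halts_in U (reduction_tail C n w) t a \<Longrightarrow> \<exists>t \<le> n. \<exists>a. halts_in M w t a"
    "\<And>n w. length w < n \<Longrightarrow> \<exists>t \<le> n. \<exists>a. halts_in M w t a \<Longrightarrow>
       \<exists>t \<le> poly s n. \<exists>a. halts_in U (reduction_tail C n w) t a"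
proof -
  let ?M = "then_clocked decode 9 M"
  let ?W = "\<lambda>n w. overline_nat n @ False # w"
  have tail: "reduction_tail C n w = overline_nat (\<gamma> ?M) @ False # ?W n w" for n w
    by (simp add: reduction_tail_def C_def)
  have regs: "regs decode \<subseteq> {..9}"
    by (simp add: decode_def double_def move_def copy_bit_def)
  have M: "\<exists>d \<le> 30 * n * n + 30 * n + 2. \<forall>t a. halts_in ?M (?W n w) t a \<longleftrightarrow>
      a = Yes \<and> (\<exists>t' \<le> n. \<exists>b. t = d + t' \<and> halts_in M w t' b)" for n w
    using execD[OF exec_decode[of n w]] halts_in_then_clocked[OF _ regs zero_less_numeral] by metis
  \<comment> \<open>The overhead polynomial belongs to one simulated machine. The number
    \<open>n\<close> is passed to that machine as data, so a single polynomial serves all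
    sizes.\<close>
  obtain s :: "nat poly" where s:
    "\<And>v. run_time U (overline_nat (\<gamma> ?M) @ False # v) \<le> enat (poly s (length v)) * run_time ?M v"
    using assms(1) unfolding universal_tm_def by blast
  show thesis
  proof (rule that)
    fix n w t a
    assume "halts_in U (reduction_tail C n w) t a"
    then have "\<exists>t. halts_in ?M (?W n w) t a"
      using assms(1) unfolding universal_tm_def tail by blast
    then show "\<exists>t \<le> n. \<exists>a. halts_in M w t a"
      using M[of n w] by blast
  next
    fix n w
    assume w: "length w < n" and "\<exists>t \<le> n. \<exists>a. halts_in M w t a"
    then obtain t b where t: "t \<le> n" "halts_in M w t b" by blast
    obtain d where d: "d \<le> 30 * n * n + 30 * n + 2" "halts_in ?M (?W n w) (d + t) Yes"
      using M[of n w] t by blast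
    \<comment> \<open>Decoding the clock, then at most \<open>n\<close> steps of M.\<close>
    have "d + t \<le> 30 * n * n + 31 * n + 2"
      using d(1) t(1) by simp
    then have time: "run_time ?M (?W n w) \<le> enat (30 * n * n + 31 * n + 2)"
      using d(2) run_time_le_iff by blast
    \<comment> \<open>At most \<open>2 * n\<close> symbols for the code of \<open>n\<close>, one
      separator, and at most \<open>n - 1\<close> symbols of \<open>w\<close>.\<close>
    have "length (?W n w) \<le> 3 * n"
      using w length_bin_le[of n] by (simp add: length_overline_nat)
    then have "poly s (length (?W n w)) \<le> poly s (3 * n)"
      by (rule poly_nat_mono)
    then have "run_time U (reduction_tail C n w) \<le> enat (poly s (3 * n)) * enat (30 * n * n + 31 * n + 2)"
      unfolding tail by (intro order_trans[OF s] mult_mono time) auto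
    also have "\<dots> = enat (poly (pcompose s [:0, 3:] * [:2, 31, 30:]) n)"
      by (simp add: poly_pcompose algebra_simps)
    finally show "\<exists>t \<le> poly (pcompose s [:0, 3:] * [:2, 31, 30:]) n. \<exists>a.
        halts_in U (reduction_tail C n w) t a"
      unfolding run_time_le_iff by blast
  qed
qed

section \<open>Domination of the distributions\<close>

lemma two_power_length_bin: "0 < n \<Longrightarrow> 2 ^ length (bin n) \<le> 2 * n"
proof (induction n rule: bin.induct)
  case (1 n)
  then show ?case
    by (subst bin.simps) (cases "n div 2 = 0"; auto simp: bin.simps[of 0])
qed

text \<open>Besides \<open>w\<close> the new tail holds \<open>C\<close>, two separators and the
  code of \<open>n\<close>. Two symbols per digit make the code cost a factor (2n)^2, so 2^|w| grows
  by at most 2^(|C|+4) n^2. Replacing the share 1/n of a tail length by 1/N gives a total loss of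
  2^(|C|+4) n N, which is at most 2^(|C|+4) N^2.\<close>

lemma bh_ensemble_reduction_le:
  assumes N: "even (poly N n)" "n \<le> poly N n" "length (reduction_tail C n w) < poly N n"
    and x: "x = ones m @ False # w" "length x = n"
  shows "bh_ensemble x \<le> 2 ^ (length C + 4) * real (poly N n) ^ 2 * odd_ensemble (reduction N C x)"
proof -
  let ?t = "reduction_tail C n w" and ?N = "real (poly N n)"
  have n: "n = Suc (m + length w)" using x by simp
  have "reduction N C x = pad (poly N n) ?t"
    unfolding x(1) reduction_simps n ..
  moreover have "length (pad (poly N n) ?t) = poly N n"
    using N(3) by (rule length_pad)
  moreover have "bh_ensemble (pad (poly N n) ?t) = 1 / (?N * 2 ^ length ?t)"
  proof -
    have "poly N n - Suc (length ?t) + 1 + length ?t = poly N n" using N(3) by simp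
    then show ?thesis unfolding pad_def bh_ensemble_values by metis
  qed
  ultimately have f: "odd_ensemble (reduction N C x) = 1 / (?N * 2 ^ length ?t)"
    using N(1) by (simp add: odd_ensemble_even)
  have "(2::nat) ^ length (bin n) \<le> 2 * n"
    using n by (intro two_power_length_bin) simp
  then have "((2::nat) ^ length (bin n)) ^ 2 \<le> (2 * n) ^ 2"
    by (rule power_mono) simp
  then have "2 ^ length (overline_nat n) \<le> 4 * n ^ 2"
    by (simp add: length_overline_nat power_mult[symmetric] mult.commute power_mult_distrib)
  then have "real (2 ^ length (overline_nat n)) \<le> real (4 * n ^ 2)"
    by (simp only: of_nat_le_iff)
  then have "2 ^ (length C + 2) * 2 ^ length w * real (2 ^ length (overline_nat n)) \<le>
      2 ^ (length C + 2) * 2 ^ length w * real (4 * n ^ 2)"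
    by (intro mult_left_mono) auto
  then have t: "2 ^ length ?t \<le> 2 ^ (length C + 4) * real n ^ 2 * 2 ^ length w"
    by (simp add: reduction_tail_def power_add algebra_simps)
  have pos: "0 < real n" "real n \<le> ?N" using n N(2) by auto
  have "bh_ensemble x = 1 / (real n * 2 ^ length w)"
    unfolding x(1) bh_ensemble_values n by simp
  also have "\<dots> = 2 ^ (length C + 4) * real n / (2 ^ (length C + 4) * real n ^ 2 * 2 ^ length w)"
    using pos by (simp add: power2_eq_square)
  also have "\<dots> \<le> 2 ^ (length C + 4) * ?N / 2 ^ length ?t"
    using t pos by (intro frac_le) auto
  also have "\<dots> = 2 ^ (length C + 4) * ?N ^ 2 * odd_ensemble (reduction N C x)"
    unfolding f using pos by (simp add: power2_eq_square)
  finally show ?thesis .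
qed

text \<open>The pointwise bound may be summed because \<open>reduction\<close> is injective on
  instances of one size that contain a zero: their images carry \<open>w\<close> in full, and
  \<open>w\<close> and the size determine \<open>m\<close>.\<close>

lemma sphere_prob_reduction_le:
  assumes N: "even (poly N n)" "n \<le> poly N n"
    "\<And>w. length w < n \<Longrightarrow> length (reduction_tail C n w) < poly N n" and n: "1 \<le> n"
  shows "sphere_prob bh_ensemble n {x. reduction N C x \<in> S} \<le>
    2 ^ (length C + 4) * real (poly N n) ^ 2 * sphere_prob odd_ensemble (poly N n) S"
proof -
  let ?f = "reduction N C" and ?K = "2 ^ (length C + 4) * real (poly N n) ^ 2 :: real"
  let ?X = "{x. ?f x \<in> S \<and> length x = n}"
  let ?Y = "{x \<in> ?X. x \<noteq> ones n}"
  have fin: "finite ?X"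
    by (rule finite_subset[OF _ finite_length_eq[of n]]) auto
  have Y: "\<exists>m w. x = ones m @ False # w \<and> n = Suc (m + length w)" if "x \<in> ?Y" for x
    using that by (cases x rule: all_ones_cases) auto
  have len: "length (?f x) = poly N n" if "x \<in> ?Y" for x
  proof -
    obtain m w where *: "x = ones m @ False # w" "n = Suc (m + length w)" using Y[OF \<open>x \<in> ?Y\<close>] by blast
    then have "length (reduction_tail C n w) < poly N n" by (intro N(3)) simp
    with * show ?thesis by (simp add: reduction_simps length_pad)
  qed
  have inj: "inj_on ?f ?Y"
  proof (rule inj_onI)
    fix x y
    assume "x \<in> ?Y" "y \<in> ?Y" and eq: "?f x = ?f y"
    obtain m w where x: "x = ones m @ False # w" "n = Suc (m + length w)" using Y[OF \<open>x \<in> ?Y\<close>] by blast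
    obtain m' w' where y: "y = ones m' @ False # w'" "n = Suc (m' + length w')" using Y[OF \<open>y \<in> ?Y\<close>] by blast
    have "pad (poly N n) (reduction_tail C n w) = pad (poly N n) (reduction_tail C n w')"
      using eq unfolding x(1) y(1) reduction_simps x(2)[symmetric] y(2)[symmetric] .
    then have "reduction_tail C n w = reduction_tail C n w'"
      unfolding pad_def ones_append_eq by blast
    then have "w = w'" by (simp add: reduction_tail_def)
    with x y show "x = y" by simp
  qed
  have "sphere_prob bh_ensemble n {x. ?f x \<in> S} = sum bh_ensemble ?X"
    unfolding sphere_prob_def by simp
  also have "\<dots> = sum bh_ensemble ?Y"
    using fin n bh_ensemble_values(2)[OF n] by (intro sum.mono_neutral_right) auto
  also have "\<dots> \<le> (\<Sum>x \<in> ?Y. ?K * odd_ensemble (?f x))"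
  proof (rule sum_mono)
    fix x assume "x \<in> ?Y"
    then obtain m w where x: "x = ones m @ False # w" "n = Suc (m + length w)" using Y by blast
    show "bh_ensemble x \<le> ?K * odd_ensemble (?f x)"
      by (rule bh_ensemble_reduction_le[OF N(1,2) N(3) x(1)]) (use x in simp_all)
  qed
  also have "\<dots> = ?K * sum odd_ensemble (?f ` ?Y)"
    unfolding sum.reindex[OF inj] comp_def sum_distrib_left ..
  also have "\<dots> \<le> ?K * sphere_prob odd_ensemble (poly N n) S"
    unfolding sphere_prob_def
  proof (intro mult_left_mono sum_mono2)
    show "finite {x \<in> S. length x = poly N n}"
      by (rule finite_subset[OF _ finite_length_eq[of "poly N n"]]) auto
    show "?f ` ?Y \<subseteq> {x \<in> S. length x = poly N n}"
      using len by auto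
  qed (use spherical_odd_ensemble in \<open>auto simp: spherical_ensemble_def\<close>)
  finally show ?thesis .
qed

theorem theorem5p5:
  fixes \<gamma> :: "tm \<Rightarrow> nat" and U M :: tm
  assumes "ptime_enumeration \<gamma>"
    and "universal_tm \<gamma> U"
  shows "\<exists>h f. ptime_nat_fun h \<and> strict_mono h \<and> (\<forall>n. n \<le> h n) \<and>
           SGPtime_reduction (DBH M) (DBH_padded U h) f"
proof -
  define C where "C = overline_nat (\<gamma> (then_clocked decode 9 M))"
  obtain s :: "nat poly" where s:
    "\<And>n w t a. halts_in U (reduction_tail C n w) t a \<Longrightarrow> \<exists>t \<le> n. \<exists>a. halts_in M w t a"
    "\<And>n w. length w < n \<Longrightarrow> \<exists>t \<le> n. \<exists>a. halts_in M w t a \<Longrightarrow>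
       \<exists>t \<le> poly s n. \<exists>a. halts_in U (reduction_tail C n w) t a"
    using universal_clocked[OF assms(2)] unfolding C_def by metis
  \<comment> \<open>The factor 2 keeps the target on the even spheres, \<open>s\<close> covers the
    time of U, and \<open>length C + 5 + 5 * n\<close> leaves room for the tail, of length at most
    \<open>length C + 3 * n + 1\<close>, while making \<open>N\<close> strictly increasing and at
    least \<open>n\<close>.\<close>
  define N where "N = [:2:] * (s + [:length C + 5, 5:])"
  have N: "poly N n = 2 * (poly s n + length C + 5 + 5 * n)" for n
    by (simp add: N_def)
  have even: "even (poly N n)" and ge: "n \<le> poly N n" and s_le: "poly s n \<le> poly N n" for n
    by (simp_all add: N)
  have mono: "strict_mono (poly N)"
  proof (rule strict_monoI)
    fix x y :: nat
    assume "x < y"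
    then have "poly s x \<le> poly s y" by (intro poly_nat_mono) simp
    with \<open>x < y\<close> show "poly N x < poly N y" by (simp add: N)
  qed
  have tail_less: "length (reduction_tail C n w) < poly N n" if "length w < n" for n w
    using that length_bin_le[of n] by (simp add: reduction_tail_def length_overline_nat N)
  let ?f = "reduction N C"
  obtain T where T: "\<And>x. exec (reduction_prog (coeffs N) C) (input_store x) (poly T (length x))
      (input_store (?f x))"
    using exec_reduction by blast
  have len: "length (?f x) = poly N (length x)" for x
  proof (cases x rule: all_ones_cases)
    case 1
    then show ?thesis by (metis length_replicate reduction_simps(1))
  next
    case (2 m w)
    then show ?thesis
      using tail_less[of w "length x"] by (simp add: 2(1) reduction_simps length_pad)
  qed
  have red: "x \<in> BH M \<longleftrightarrow> ?f x \<in> BH U" for x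
  proof (cases x rule: all_ones_cases)
    case 1
    then show ?thesis by (metis ones_notin_BH reduction_simps(1))
  next
    case (2 m w)
    let ?n = "length x" and ?t = "reduction_tail C (length x) w"
    have less: "length ?t < poly N ?n"
      using 2(2) by (intro tail_less) simp
    have "?f x \<in> BH U \<longleftrightarrow> (\<exists>t \<le> poly N ?n. \<exists>a. halts_in U ?t t a)"
      using less unfolding 2(2) unfolding 2(1) reduction_simps pad_def pad_in_BH by simp
    also have "\<dots> \<longleftrightarrow> (\<exists>t \<le> ?n. \<exists>a. halts_in M w t a)"
    proof
      assume "\<exists>t \<le> poly N ?n. \<exists>a. halts_in U ?t t a"
      then show "\<exists>t \<le> ?n. \<exists>a. halts_in M w t a"
        using s(1)[of ?n w] by blast
    next
      assume "\<exists>t \<le> ?n. \<exists>a. halts_in M w t a"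
      moreover have "length w < ?n" using 2(2) by simp
      ultimately obtain t a where "t \<le> poly s ?n" "halts_in U ?t t a"
        using s(2)[of w ?n] by blast
      \<comment> \<open>The halt of U found within \<open>poly s ?n\<close> steps is also within the
        time bound of the image, which is its size.\<close>
      then show "\<exists>t \<le> poly N ?n. \<exists>a. halts_in U ?t t a"
        using order_trans[OF _ s_le] by blast
    qed
    also have "\<dots> \<longleftrightarrow> x \<in> BH M"
      unfolding 2(2) unfolding 2(1) pad_in_BH ..
    finally show ?thesis ..
  qed
  have "ptime_reduction (BH M) (BH U) ?f"
    unfolding ptime_reduction_def
    using red ptime_funI[OF execD[OF T] regs_reduction_prog] by blast
  moreover have "size_invariant ?f"
    unfolding size_invariant_def len using strict_mono_less[OF mono] by blast
  moreover have "\<exists>B. composite B A ?f \<and> SGPtime_decides B (DBH M)"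
    if "SGPtime_decides A (DBH_padded U odd_size)" for A
    using that unfolding DBH_def DBH_padded_def
    by (intro SGPtime_decides_transfer[OF T regs_reduction_prog red len ge,
          where \<kappa> = "2 ^ (length C + 4)" and \<nu> = odd_ensemble]
        sphere_prob_reduction_le even ge tail_less)
      (use spherical_bh_ensemble spherical_odd_ensemble in \<open>auto simp: spherical_ensemble_def\<close>)
  ultimately have "SGPtime_reduction (DBH M) (DBH_padded U odd_size) ?f"
    unfolding SGPtime_reduction_def
    using DBH_in_DistNP DBH_padded_in_DistNP by (simp add: DBH_def DBH_padded_def)
  moreover have "strict_mono odd_size"
    by (rule strict_monoI) simp
  ultimately show ?thesis
    using ptime_odd_size by (intro exI[of _ odd_size] exI[of _ ?f]) auto
qed

end
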